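(* Let $n\geq 1$. For each $i\geq 0$, let $B_i$ be the Boolean lattice of subsets of $[i]=\{1,\dots,i\}$ with rank function $\rho_i(S)=|S|$, and let $P_i$ be the proper part (i.e. with the minimum and maximum removed) of the Segre product poset $B_i\circ_{\rho_i}B_i=\{(S,T)\in B_i\times B_i : |S|=|T|\}$ (ordered componentwise by inclusion). The group $\mathcal{S}_i\times\mathcal{S}_i$ acts on $P_i$ by $(\sigma,\tau)\cdot(S,T)=(\sigma(S),\tau(T))$, inducing a representation on the reduced top homology $\widetilde{H}_{i-2}(P_i)$ (with the conventions that $\widetilde{H}_{-2}(P_0)$ and $\widetilde{H}_{-1}(P_1)=\widetilde H_{-1}(\emptyset)$ are the trivial one-dimensional representations). Let $ch(\widetilde{H}_{i-2}(P_i))$ denote its product Frobenius characteristic. Then $$\sum_{i=0}^{n}(-1)^i h_{n-i}(x)\,h_{n-i}(y)\,ch(\widetilde{H}_{i-2}(P_i))=0,$$ where $h_k$ denotes the complete homogeneous symmetric function of degree $k$ (with $h_0=1$).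
   Context: For a class function $\chi$ on $\mathcal{S}_m\times\mathcal{S}_n$, its product Frobenius characteristic is $ch(\chi)=\sum_{\mu\vdash m,\ \lambda\vdash n} z_\mu^{-1}z_\lambda^{-1}\chi(\mu,\lambda)\,p_\mu(x)p_\lambda(y)$, a symmetric function in two independent sets of variables $x=(x_1,x_2,\dots)$ and $y=(y_1,y_2,\dots)$; here $\chi(\mu,\lambda)$ is the value of $\chi$ on pairs of permutations of cycle types $\mu$ and $\lambda$, $p_\mu$ are power sum symmetric functions and $z_\mu$ is the usual size of the centralizer of a permutation of cycle type $\mu$. The product Frobenius characteristic of a representation is that of its character. *)

theory Defs
  imports
    Complex_Main
    "HOL-Library.Multiset"
    "HOL-Library.FuncSet"
    "HOL-Library.Poly_Mapping"
    "HOL-Library.Product_Order"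
    "HOL-Combinatorics.Permutations"
    "HOL-Combinatorics.Orbits"
begin

section \<open>Formal power series in an arbitrary set of commuting variables\<close>

text \<open>
  A monomial is a finitely supported exponent vector, and a power series is an arbitrary
  function from monomials to coefficients. Symmetric functions in infinitely many variables
  have infinite support, so they are not elements of the ring
  \<^typ>\<open>('v \<Rightarrow>\<^sub>0 nat) \<Rightarrow>\<^sub>0 'a\<close> of polynomials.
\<close>

typedef ('v, 'a) mpowser = "UNIV :: (('v \<Rightarrow>\<^sub>0 nat) \<Rightarrow> 'a) set"
  morphisms mcoeff Abs_mpowser ..

setup_lifting type_definition_mpowser

lemma mpowser_eqI: "(\<And>m. mcoeff f m = mcoeff g m) \<Longrightarrow> f = g"
  by (metis ext mcoeff_inject)

lemma finite_monomial_splits: "finite {(a, b). a + b = (m :: 'v \<Rightarrow>\<^sub>0 nat)}"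
proof -
  let ?K = "Poly_Mapping.keys m"
  let ?S = "{(a, b). a + b = m}"
  let ?F = "PiE ?K (\<lambda>v. {..Poly_Mapping.lookup m v})"
  let ?r = "\<lambda>(a :: 'v \<Rightarrow>\<^sub>0 nat, b :: 'v \<Rightarrow>\<^sub>0 nat).
    (restrict (Poly_Mapping.lookup a) ?K, restrict (Poly_Mapping.lookup b) ?K)"
  have out: "Poly_Mapping.lookup a v = 0 \<and> Poly_Mapping.lookup b v = 0"
    if "a + b = m" "v \<notin> ?K" for a b :: "'v \<Rightarrow>\<^sub>0 nat" and v
    using that by (metis add_is_0 in_keys_iff lookup_add)
  have "inj_on ?r ?S"
  proof (rule inj_onI, clarsimp)
    fix a b a' b' :: "'v \<Rightarrow>\<^sub>0 nat"
    assume eq: "a' + b' = a + b" and m: "m = a + b"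
      and ra: "restrict (Poly_Mapping.lookup a) (Poly_Mapping.keys (a + b))
               = restrict (Poly_Mapping.lookup a') (Poly_Mapping.keys (a + b))"
      and rb: "restrict (Poly_Mapping.lookup b) (Poly_Mapping.keys (a + b))
               = restrict (Poly_Mapping.lookup b') (Poly_Mapping.keys (a + b))"
    have "Poly_Mapping.lookup a v = Poly_Mapping.lookup a' v
        \<and> Poly_Mapping.lookup b v = Poly_Mapping.lookup b' v" for v
    proof (cases "v \<in> ?K")
      case True
      then show ?thesis using fun_cong[OF ra, of v] fun_cong[OF rb, of v] m by simp
    next
      case False
      then show ?thesis using out[of a b v] out[of a' b' v] eq m by simp
    qed
    then show "a = a' \<and> b = b'" by (auto intro: poly_mapping_eqI)
  qed
  moreover have "?r ` ?S \<subseteq> ?F \<times> ?F"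
    by (auto simp: lookup_add)
  moreover have "finite (?F \<times> ?F)"
    by (intro finite_cartesian_product finite_PiE) auto
  ultimately show ?thesis
    by (meson finite_subset finite_imageD)
qed

instantiation mpowser :: (type, comm_ring_1) comm_ring_1
begin

lift_definition zero_mpowser :: "('a, 'b) mpowser" is "\<lambda>_. 0" .

lift_definition one_mpowser :: "('a, 'b) mpowser" is "\<lambda>m. if m = 0 then 1 else 0" .

lift_definition plus_mpowser :: "('a, 'b) mpowser \<Rightarrow> ('a, 'b) mpowser \<Rightarrow> ('a, 'b) mpowser"
  is "\<lambda>f g m. f m + g m" .

lift_definition minus_mpowser :: "('a, 'b) mpowser \<Rightarrow> ('a, 'b) mpowser \<Rightarrow> ('a, 'b) mpowser"
  is "\<lambda>f g m. f m - g m" .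

lift_definition uminus_mpowser :: "('a, 'b) mpowser \<Rightarrow> ('a, 'b) mpowser"
  is "\<lambda>f m. - f m" .

lift_definition times_mpowser :: "('a, 'b) mpowser \<Rightarrow> ('a, 'b) mpowser \<Rightarrow> ('a, 'b) mpowser"
  is "\<lambda>f g m. \<Sum>(a, b)\<in>{(a, b). a + b = m}. f a * g b" .

instance
proof
  fix f g h :: "('a, 'b) mpowser"
  show "f * g * h = f * (g * h)"
  proof (rule mpowser_eqI)
    fix m
    let ?S = "\<lambda>m :: 'a \<Rightarrow>\<^sub>0 nat. {(a, b). a + b = m}"
    have "mcoeff (f * g * h) m
        = (\<Sum>p\<in>?S m. \<Sum>q\<in>?S (fst p). mcoeff f (fst q) * mcoeff g (snd q) * mcoeff h (snd p))"
      by (simp add: times_mpowser.rep_eq case_prod_beta sum_distrib_right)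
    also have "\<dots> = (\<Sum>(p, q)\<in>Sigma (?S m) (\<lambda>p. ?S (fst p)).
        mcoeff f (fst q) * mcoeff g (snd q) * mcoeff h (snd p))"
      by (intro sum.Sigma finite_monomial_splits ballI)
    also have "\<dots> = (\<Sum>(p, q)\<in>Sigma (?S m) (\<lambda>p. ?S (snd p)).
        mcoeff f (fst p) * (mcoeff g (fst q) * mcoeff h (snd q)))"
      by (rule sum.reindex_bij_witness[
            where i = "\<lambda>((a, _), (b, c)). ((a + b, c), (a, b))"
              and j = "\<lambda>((_, c), (a, b)). ((a, b + c), (b, c))"])
        (auto simp: ac_simps)
    also have "\<dots> = (\<Sum>p\<in>?S m. \<Sum>q\<in>?S (snd p).
        mcoeff f (fst p) * (mcoeff g (fst q) * mcoeff h (snd q)))"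
      by (rule sum.Sigma[symmetric]) (intro finite_monomial_splits ballI)+
    also have "\<dots> = mcoeff (f * (g * h)) m"
      by (simp add: times_mpowser.rep_eq case_prod_beta sum_distrib_left)
    finally show "mcoeff (f * g * h) m = mcoeff (f * (g * h)) m" .
  qed
  show "f * g = g * f"
  proof (rule mpowser_eqI)
    fix m
    show "mcoeff (f * g) m = mcoeff (g * f) m"
      unfolding times_mpowser.rep_eq
      by (rule sum.reindex_bij_witness[where i = prod.swap and j = prod.swap])
        (auto simp: ac_simps)
  qed
  show "1 * f = f"
  proof (rule mpowser_eqI)
    fix m
    have "mcoeff (1 * f) m = (\<Sum>p\<in>{(a, b). a + b = m}. if p = (0, m) then mcoeff f m else 0)"
      unfolding times_mpowser.rep_eq one_mpowser.rep_eq
      by (rule sum.cong) (auto split: if_splits)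
    also have "\<dots> = mcoeff f m"
      using finite_monomial_splits[of m] by (subst sum.delta) auto
    finally show "mcoeff (1 * f) m = mcoeff f m" .
  qed
  show "(f + g) * h = f * h + g * h"
    by (rule mpowser_eqI)
      (simp add: times_mpowser.rep_eq plus_mpowser.rep_eq case_prod_beta algebra_simps sum.distrib)
  show "f + g + h = f + (g + h)" "f + g = g + f" "0 + f = f" "- f + f = 0" "f - g = f + - g"
    by (transfer; auto simp: algebra_simps)+
  show "(0 :: ('a, 'b) mpowser) \<noteq> 1"
    by transfer (metis zero_neq_one)
qed

end

lift_definition mconst :: "'a \<Rightarrow> ('v, 'a :: zero) mpowser"
  is "\<lambda>c m. if m = 0 then c else 0" .


section \<open>Symmetric functions\<close>

text \<open>The argument \<open>x\<close> is the (injective) sequence of variables.\<close>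

lift_definition power_sum :: "(nat \<Rightarrow> 'v) \<Rightarrow> nat \<Rightarrow> ('v, 'a :: zero_neq_one) mpowser"
  is "\<lambda>x k m. if \<exists>i. m = Poly_Mapping.single (x i) k then 1 else 0" .

lift_definition complete_hom :: "(nat \<Rightarrow> 'v) \<Rightarrow> nat \<Rightarrow> ('v, 'a :: zero_neq_one) mpowser"
  is "\<lambda>x k m. if Poly_Mapping.keys m \<subseteq> range x
      \<and> (\<Sum>v\<in>Poly_Mapping.keys m. Poly_Mapping.lookup m v) = k then 1 else 0" .

definition power_sum_part :: "(nat \<Rightarrow> 'v) \<Rightarrow> nat multiset \<Rightarrow> ('v, 'a :: comm_ring_1) mpowser"
  where "power_sum_part x \<mu> = (\<Prod>k\<in>#\<mu>. power_sum x k)"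


section \<open>The product Frobenius characteristic\<close>

definition partitions :: "nat \<Rightarrow> nat multiset set"
  where "partitions n = {\<mu>. 0 \<notin># \<mu> \<and> sum_mset \<mu> = n}"

definition cycle_type :: "nat \<Rightarrow> (nat \<Rightarrow> nat) \<Rightarrow> nat multiset"
  where "cycle_type n \<sigma> = image_mset card (mset_set (orbit \<sigma> ` {1..n}))"

definition perm_of_type :: "nat \<Rightarrow> nat multiset \<Rightarrow> nat \<Rightarrow> nat"
  where "perm_of_type n \<mu> = (SOME \<sigma>. \<sigma> permutes {1..n} \<and> cycle_type n \<sigma> = \<mu>)"

definition centralizer_size :: "nat \<Rightarrow> nat multiset \<Rightarrow> nat"
  where "centralizer_size n \<mu> =
    card {\<tau>. \<tau> permutes {1..n} \<and> \<tau> \<circ> perm_of_type n \<mu> = perm_of_type n \<mu> \<circ> \<tau>}"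

text \<open>The two alphabets are the variables \<open>Inl 0, Inl 1, \<dots>\<close> and \<open>Inr 0, Inr 1, \<dots>\<close>.\<close>

definition product_frobenius ::
    "nat \<Rightarrow> nat \<Rightarrow> ((nat \<Rightarrow> nat) \<Rightarrow> (nat \<Rightarrow> nat) \<Rightarrow> complex) \<Rightarrow> (nat + nat, complex) mpowser"
  where "product_frobenius m n \<chi> =
    (\<Sum>\<mu>\<in>partitions m. \<Sum>\<nu>\<in>partitions n.
      mconst (inverse (of_nat (centralizer_size m \<mu>)) * inverse (of_nat (centralizer_size n \<nu>))
              * \<chi> (perm_of_type m \<mu>) (perm_of_type n \<nu>))
      * power_sum_part Inl \<mu> * power_sum_part Inr \<nu>)"


section \<open>Reduced homology of the order complex of a finite poset\<close>

definition fscale :: "'k :: field \<Rightarrow> ('b \<Rightarrow>\<^sub>0 'k) \<Rightarrow> ('b \<Rightarrow>\<^sub>0 'k)"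
  where "fscale c = Poly_Mapping.map ((*) c)"

lemma lookup_fscale [simp]: "Poly_Mapping.lookup (fscale c v) b = c * Poly_Mapping.lookup v b"
  by (simp add: fscale_def map.rep_eq when_def)

global_interpretation free_space: vector_space "fscale :: 'k :: field \<Rightarrow> ('b \<Rightarrow>\<^sub>0 'k) \<Rightarrow> _"
  by unfold_locales (auto intro!: poly_mapping_eqI simp: lookup_add algebra_simps)

text \<open>The cosets of the elements of \<open>B\<close> are pairwise distinct and form a basis of \<open>V / W\<close>.\<close>

definition quotient_basis ::
    "('b \<Rightarrow>\<^sub>0 'k :: field) set \<Rightarrow> ('b \<Rightarrow>\<^sub>0 'k) set \<Rightarrow> ('b \<Rightarrow>\<^sub>0 'k) set \<Rightarrow> bool"
  where "quotient_basis V W B \<longleftrightarrow> finite B \<and> B \<subseteq> V \<and>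
    (\<forall>a. (\<Sum>b\<in>B. fscale (a b) b) \<in> W \<longrightarrow> (\<forall>b\<in>B. a b = 0)) \<and>
    (\<forall>v\<in>V. \<exists>a. v - (\<Sum>b\<in>B. fscale (a b) b) \<in> W)"

text \<open>The matrix, with respect to such a basis, of the endomorphism of \<open>V / W\<close> induced by \<open>f\<close>.\<close>

definition quotient_matrix ::
    "('b \<Rightarrow>\<^sub>0 'k :: field) set \<Rightarrow> ('b \<Rightarrow>\<^sub>0 'k) set \<Rightarrow> (('b \<Rightarrow>\<^sub>0 'k) \<Rightarrow> ('b \<Rightarrow>\<^sub>0 'k))
      \<Rightarrow> (('b \<Rightarrow>\<^sub>0 'k) \<Rightarrow> ('b \<Rightarrow>\<^sub>0 'k) \<Rightarrow> 'k) \<Rightarrow> bool"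
  where "quotient_matrix W B f A \<longleftrightarrow>
    (\<forall>b\<in>B. f b - (\<Sum>b'\<in>B. fscale (A b' b) b') \<in> W)"

definition quotient_trace ::
    "('b \<Rightarrow>\<^sub>0 'k :: field) set \<Rightarrow> ('b \<Rightarrow>\<^sub>0 'k) set \<Rightarrow> (('b \<Rightarrow>\<^sub>0 'k) \<Rightarrow> ('b \<Rightarrow>\<^sub>0 'k)) \<Rightarrow> 'k"
  where "quotient_trace V W f =
    (let B = SOME B. quotient_basis V W B; A = SOME A. quotient_matrix W B f A
     in \<Sum>b\<in>B. A b b)"

definition linear_extension :: "('b \<Rightarrow> ('c \<Rightarrow>\<^sub>0 'k)) \<Rightarrow> ('b \<Rightarrow>\<^sub>0 'k :: field) \<Rightarrow> ('c \<Rightarrow>\<^sub>0 'k)"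
  where "linear_extension f v =
    (\<Sum>b\<in>Poly_Mapping.keys v. fscale (Poly_Mapping.lookup v b) (f b))"

text \<open>
  A \<open>k\<close>-simplex of the order complex is a chain of \<open>k + 1\<close> elements; the empty chain is the
  simplex of degree \<open>-1\<close>, which makes the homology below the reduced one. Simplices are
  oriented by the order of the poset.
\<close>

definition simplices :: "'p :: order set \<Rightarrow> int \<Rightarrow> 'p set set"
  where "simplices P k =
    {C. C \<subseteq> P \<and> finite C \<and> Complete_Partial_Order.chain (\<le>) C \<and> int (card C) = k + 1}"

definition simplicial_chains :: "'p :: order set \<Rightarrow> int \<Rightarrow> ('p set \<Rightarrow>\<^sub>0 complex) set"
  where "simplicial_chains P k = {c. Poly_Mapping.keys c \<subseteq> simplices P k}"

definition boundary :: "('p :: order set \<Rightarrow>\<^sub>0 complex) \<Rightarrow> ('p set \<Rightarrow>\<^sub>0 complex)"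
  where "boundary = linear_extension
    (\<lambda>C. \<Sum>x\<in>C. Poly_Mapping.single (C - {x}) ((-1) ^ card {y\<in>C. y < x}))"

definition cycles :: "'p :: order set \<Rightarrow> int \<Rightarrow> ('p set \<Rightarrow>\<^sub>0 complex) set"
  where "cycles P k = {c \<in> simplicial_chains P k. boundary c = 0}"

definition boundaries :: "'p :: order set \<Rightarrow> int \<Rightarrow> ('p set \<Rightarrow>\<^sub>0 complex) set"
  where "boundaries P k = boundary ` simplicial_chains P (k + 1)"

text \<open>
  The chain map induced by an automorphism \<open>g\<close> of the poset. No signs occur, since \<open>g\<close>
  preserves the orientation of the simplices.
\<close>

definition chain_map :: "('p \<Rightarrow> 'p) \<Rightarrow> ('p set \<Rightarrow>\<^sub>0 complex) \<Rightarrow> ('p set \<Rightarrow>\<^sub>0 complex)"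
  where "chain_map g = linear_extension (\<lambda>C. Poly_Mapping.single (g ` C) 1)"

definition homology_trace :: "'p :: order set \<Rightarrow> int \<Rightarrow> ('p \<Rightarrow> 'p) \<Rightarrow> complex"
  where "homology_trace P k g = quotient_trace (cycles P k) (boundaries P k) (chain_map g)"


section \<open>The Segre square of the Boolean lattice\<close>

text \<open>
  The order on \<^typ>\<open>nat set \<times> nat set\<close> is the componentwise one of
  \<^theory>\<open>HOL-Library.Product_Order\<close>.
\<close>

definition segre_product :: "'p set \<Rightarrow> ('p \<Rightarrow> nat) \<Rightarrow> 'q set \<Rightarrow> ('q \<Rightarrow> nat) \<Rightarrow> ('p \<times> 'q) set"
  where "segre_product P \<rho> Q \<rho>' = {(p, q) \<in> P \<times> Q. \<rho> p = \<rho>' q}"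

definition proper_part :: "'p :: order set \<Rightarrow> 'p set"
  where "proper_part P = {p \<in> P. \<not> (\<forall>q\<in>P. p \<le> q) \<and> \<not> (\<forall>q\<in>P. q \<le> p)}"

definition boolean_segre :: "nat \<Rightarrow> (nat set \<times> nat set) set"
  where "boolean_segre i = proper_part (segre_product (Pow {1..i}) card (Pow {1..i}) card)"

definition perm_pair_action ::
    "(nat \<Rightarrow> nat) \<Rightarrow> (nat \<Rightarrow> nat) \<Rightarrow> nat set \<times> nat set \<Rightarrow> nat set \<times> nat set"
  where "perm_pair_action \<sigma> \<tau> = (\<lambda>(S, T). (\<sigma> ` S, \<tau> ` T))"

text \<open>
  The character of the representation on the reduced homology in degree \<open>i - 2\<close>. For \<open>i = 0\<close>
  that degree is \<open>-2\<close>, and the representation is by convention the trivial one. For \<open>i = 1\<close>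
  the poset is empty, and the homology in degree \<open>-1\<close> is spanned by the class of the empty chain.
\<close>

definition top_homology_character :: "nat \<Rightarrow> (nat \<Rightarrow> nat) \<Rightarrow> (nat \<Rightarrow> nat) \<Rightarrow> complex"
  where "top_homology_character i \<sigma> \<tau> =
    (if i = 0 then 1
     else homology_trace (boolean_segre i) (int i - 2) (perm_pair_action \<sigma> \<tau>))"

end

theory Submission
  imports Defs
begin

text \<open>
  Ordering the maximal chains of the Segre square by the sum of all elements of all their members
  gives a shelling, so the reduced homology of the proper part is concentrated in the top degree.
  The Hopf trace formula then writes the character at \<open>(\<sigma>, \<tau>)\<close> as an alternating count of the
  fixed chains, that is, as \<open>(-1)\<^sup>i\<close> times the value \<open>\<mu>(0, 1)\<close> of the Moebius function of the poset of
  pairs \<open>(S, T)\<close> with \<open>\<sigma>(S) = S\<close>, \<open>\<tau>(T) = T\<close> and \<open>|S| = |T|\<close>.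

  For fixed \<open>\<sigma>, \<tau> \<in> S\<^sub>n\<close> the values \<open>\<mu>(0, (S, T))\<close> sum to zero over all fixed pairs. Multiplying by
  the power sums of the cycle types of \<open>\<sigma>\<close> and \<open>\<tau>\<close>, summing over \<open>\<sigma>\<close> and \<open>\<tau>\<close>, and exchanging the
  order of summation, each pair \<open>(S, T)\<close> with \<open>|S| = i\<close> contributes a product over its stabilizer:
  the permutations of \<open>S\<close> and \<open>T\<close> give \<open>(-1)\<^sup>i i!\<^sup>2\<close> times the characteristic of the top homology,
  those of the complements give \<open>(n - i)!\<^sup>2 h\<^bsub>n-i\<^esub>(x) h\<^bsub>n-i\<^esub>(y)\<close>. There are \<open>(n choose i)\<^sup>2\<close> such pairs,
  so the total is \<open>n!\<^sup>2\<close> times the sum in question.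
\<close>

section \<open>Linear extensions\<close>

text \<open>The trace formula counts chains that are mapped to themselves as sets. The action
  preserves rank and a chain has at most one member of each rank, so such a chain is fixed member by
  member; this is what leads to the poset of fixed pairs. That poset can be far from graded (an
  n-cycle fixes no proper nonempty subset), so only its Moebius function is used, never its
  homology. The weight does not separate the facets: for n = 2 two of the four have the same weight.
  The shelling condition therefore also covers ties: every other facet of at most the weight of
  \<open>F\<close> must yield a strictly lighter facet next to \<open>F\<close>. This is enough to
  make the lightest facet above a simplex unique. The trace on homology is defined through chosen
  bases. It is evaluated by means of a contracting homotopy below the top degree, which also
  supplies a projection onto the top cycles. The characteristic is rewritten as an average over all
  permutations instead of a sum over cycle types, because the stabilizer of a pair of subsets is a
  product of symmetric groups and sums over it factor.\<close>

abbreviation single where "single \<equiv> Poly_Mapping.single"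
abbreviation lookup where "lookup \<equiv> Poly_Mapping.lookup"
abbreviation keys where "keys \<equiv> Poly_Mapping.keys"
abbreviation order_chain :: "'p :: order set \<Rightarrow> bool"
  where "order_chain \<equiv> Complete_Partial_Order.chain (\<le>)"

lemma fscale_1 [simp]: "fscale 1 v = v"
  by (rule poly_mapping_eqI) simp

lemma fscale_sum: "fscale c (\<Sum>i\<in>I. v i) = (\<Sum>i\<in>I. fscale c (v i))"
  by (rule poly_mapping_eqI) (simp add: lookup_sum sum_distrib_left)

lemma fscale_single [simp]: "fscale c (single b d) = single b (c * d)"
  by (rule poly_mapping_eqI) (simp add: lookup_single when_def)

lemma linear_extension_superset:
  assumes "finite X" "keys v \<subseteq> X"
  shows "linear_extension f v = (\<Sum>b\<in>X. fscale (lookup v b) (f b))"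
  unfolding linear_extension_def using assms
  by (intro sum.mono_neutral_left) (auto simp: in_keys_iff intro!: poly_mapping_eqI)

lemma linear_extension_single [simp]: "linear_extension f (single b c) = fscale c (f b)"
  by (subst linear_extension_superset[where X = "{b}"]) auto

lemma linear_extension_add:
  "linear_extension f (v + w) = linear_extension f v + linear_extension f w"
proof -
  let ?X = "keys v \<union> keys w"
  have "linear_extension f u = (\<Sum>b\<in>?X. fscale (lookup u b) (f b))"
    if "u \<in> {v, w, v + w}" for u
    using that by (intro linear_extension_superset) (auto dest!: set_mp[OF keys_add])
  then show ?thesis
    by (simp add: lookup_add free_space.scale_left_distrib sum.distrib)
qed

lemma linear_extension_fscale: "linear_extension f (fscale c v) = fscale c (linear_extension f v)"
proof -
  have "linear_extension f (fscale c v)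
      = (\<Sum>b\<in>keys v. fscale (lookup (fscale c v) b) (f b))"
    by (rule linear_extension_superset) (auto simp: in_keys_iff)
  then show ?thesis
    by (simp add: linear_extension_def fscale_sum)
qed

lemma linear_extension_0 [simp]: "linear_extension f 0 = 0"
  by (simp add: linear_extension_def)

lemma linear_extension_uminus: "linear_extension f (- v) = - linear_extension f v"
  using linear_extension_add[of f v "- v"] by (simp add: eq_neg_iff_add_eq_0 add.commute)

lemma linear_extension_diff:
  "linear_extension f (v - w) = linear_extension f v - linear_extension f w"
  using linear_extension_add[of f v "- w"] by (simp add: linear_extension_uminus)

lemma linear_extension_sum:
  "linear_extension f (\<Sum>i\<in>I. v i) = (\<Sum>i\<in>I. linear_extension f (v i))"
  by (induction I rule: infinite_finite_induct) (auto simp: linear_extension_add)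

lemma keys_sum_subset: "keys (\<Sum>i\<in>I. v i) \<subseteq> (\<Union>i\<in>I. keys (v i))"
  by (induction I rule: infinite_finite_induct) (auto dest!: set_mp[OF keys_add])

lemma keys_fscale: "keys (fscale c v) \<subseteq> keys v"
  by (auto simp: in_keys_iff)

lemma keys_linear_extension:
  "keys (linear_extension f v) \<subseteq> (\<Union>b\<in>keys v. keys (f b))"
  unfolding linear_extension_def
  by (rule order_trans[OF keys_sum_subset]) (intro UN_mono order_refl keys_fscale)

lemma poly_mapping_eq_sum_single:
  assumes "finite X" "keys v \<subseteq> X"
  shows "v = (\<Sum>b\<in>X. single b (lookup v b))"
proof (rule poly_mapping_eqI)
  fix e
  show "lookup v e = lookup (\<Sum>b\<in>X. single b (lookup v b)) e"
    using assms by (auto simp: lookup_sum lookup_single when_def in_keys_iff)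
qed

lemma linear_extension_eqI:
  assumes "\<And>b. b \<in> keys v \<Longrightarrow> f b = g b"
  shows "linear_extension f v = linear_extension g v"
  unfolding linear_extension_def using assms by (intro sum.cong) auto

section \<open>The simplicial chain complex\<close>

definition face_sign :: "'p :: order set \<Rightarrow> 'p \<Rightarrow> complex"
  where "face_sign C x = (-1) ^ card {y\<in>C. y < x}"

lemma face_sign_square [simp]: "face_sign C x * face_sign C x = 1"
  by (simp add: face_sign_def flip: power_mult_distrib)

lemma face_sign_nonzero [simp]: "face_sign C x \<noteq> 0"
  by (simp add: face_sign_def)

lemma boundary_single:
  "boundary (single C c) = (\<Sum>x\<in>C. single (C - {x}) (c * face_sign C x))"
  by (simp add: boundary_def face_sign_def fscale_sum)

lemma boundary_diff: "boundary (v - w) = boundary v - boundary w"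
  by (simp add: boundary_def linear_extension_diff)

lemma boundary_add: "boundary (v + w) = boundary v + boundary w"
  by (simp add: boundary_def linear_extension_add)

lemma boundary_fscale: "boundary (fscale c w) = fscale c (boundary w)"
  by (simp add: boundary_def linear_extension_fscale)

lemma boundary_sum: "boundary (\<Sum>i\<in>I. v i) = (\<Sum>i\<in>I. boundary (v i))"
  by (simp add: boundary_def linear_extension_sum)

lemma boundary_0 [simp]: "boundary 0 = 0"
  by (simp add: boundary_def)

lemma keys_boundary:
  "keys (boundary v) \<subseteq> {C - {x} | C x. C \<in> keys v \<and> x \<in> C}"
proof
  fix D assume "D \<in> keys (boundary v)"
  then obtain C where C: "C \<in> keys v"
      "D \<in> keys (\<Sum>x\<in>C. single (C - {x}) ((-1) ^ card {y\<in>C. y < x} :: complex))"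
    unfolding boundary_def by (blast dest: set_mp[OF keys_linear_extension])
  then obtain x where "x \<in> C" "D \<in> keys (single (C - {x}) ((-1) ^ card {y\<in>C. y < x} :: complex))"
    by (blast dest: set_mp[OF keys_sum_subset])
  then show "D \<in> {C - {x} | C x. C \<in> keys v \<and> x \<in> C}"
    using C(1) by (auto split: if_splits)
qed

lemma chain_subset: "order_chain C \<Longrightarrow> D \<subseteq> C \<Longrightarrow> order_chain D"
  by (auto simp: Complete_Partial_Order.chain_def)

text \<open>For x < y, deleting x lowers the number of vertices below y by one, while deleting y
  does not change the number below x. So the two orders of deletion differ by exactly one
  sign.\<close>

lemma face_sign_swap:
  assumes "order_chain C" "finite C" "x \<in> C" "y \<in> C" "x \<noteq> y"
  shows "face_sign C x * face_sign (C - {x}) y = - (face_sign C y * face_sign (C - {y}) x)"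
proof -
  have *: "face_sign C x * face_sign (C - {x}) y = - (face_sign C y * face_sign (C - {y}) x)"
    if "x \<in> C" "y \<in> C" "x < y" for x y
  proof -
    have "{z \<in> C. z < y} = insert x {z \<in> C - {x}. z < y}" using that by auto
    then have 1: "face_sign C y = - face_sign (C - {x}) y"
      using \<open>finite C\<close> by (simp add: face_sign_def)
    have "{z \<in> C - {y}. z < x} = {z \<in> C. z < x}" using that by auto
    then have "face_sign (C - {y}) x = face_sign C x"
      by (simp add: face_sign_def)
    then show ?thesis by (simp add: 1)
  qed
  have "x < y \<or> y < x"
    using assms by (metis Complete_Partial_Order.chainD order_le_less)
  then show ?thesis using *[of x y] *[of y x] assms by auto
qed

lemma poly_mapping_eq_uminus_imp_0:
  fixes v :: "'b \<Rightarrow>\<^sub>0 complex"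
  assumes "v = - v"
  shows "v = 0"
proof (rule poly_mapping_eqI)
  fix b
  show "lookup v b = lookup 0 b"
    using arg_cong[OF assms, of "\<lambda>v. lookup v b"] by simp
qed

lemma boundary_boundary_single:
  assumes "order_chain C" "finite C"
  shows "boundary (boundary (single C 1)) = 0"
proof -
  let ?t = "\<lambda>x y. single (C - {x} - {y}) (face_sign C x * face_sign (C - {x}) y)"
  let ?I = "Sigma C (\<lambda>x. C - {x})"
  have "boundary (boundary (single C 1)) = (\<Sum>x\<in>C. \<Sum>y\<in>C - {x}. ?t x y)"
    by (simp add: boundary_single boundary_sum)
  also have "\<dots> = (\<Sum>(x, y)\<in>?I. ?t x y)"
    using assms by (intro sum.Sigma) auto
  finally have 1: "boundary (boundary (single C 1)) = (\<Sum>(x, y)\<in>?I. ?t x y)" .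
  \<comment> \<open>Exchanging the two deleted vertices negates every term, so the double sum equals
    its own negative.\<close>
  have "(\<Sum>(x, y)\<in>?I. ?t x y) = (\<Sum>(x, y)\<in>?I. ?t y x)"
    by (rule sum.reindex_bij_witness[where i = prod.swap and j = prod.swap]) auto
  also have "\<dots> = (\<Sum>(x, y)\<in>?I. - ?t x y)"
  proof -
    have "?t y x = - ?t x y" if "x \<in> C" "y \<in> C" "y \<noteq> x" for x y
    proof -
      have "face_sign C y * face_sign (C - {y}) x = - (face_sign C x * face_sign (C - {x}) y)"
        using assms that by (intro face_sign_swap) auto
      moreover have "C - {y} - {x} = C - {x} - {y}" by blast
      ultimately show ?thesis by (simp add: single_uminus)
    qed
    then show ?thesis by (intro sum.cong refl) auto
  qed
  also have "\<dots> = - (\<Sum>(x, y)\<in>?I. ?t x y)"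
    by (simp add: sum_negf case_prod_beta)
  finally show ?thesis unfolding 1 by (rule poly_mapping_eq_uminus_imp_0)
qed

lemma simplicesD:
  assumes "C \<in> simplices P k"
  shows "C \<subseteq> P" "finite C" "order_chain C" "int (card C) = k + 1"
  using assms by (auto simp: simplices_def)

lemma finite_simplices: "finite P \<Longrightarrow> finite (simplices P k)"
  by (rule finite_subset[of _ "Pow P"]) (auto simp: simplices_def)

lemma simplicial_chains_single: "C \<in> simplices P k \<Longrightarrow> single C c \<in> simplicial_chains P k"
  by (auto simp: simplicial_chains_def)

lemma simplicial_chains_0 [simp]: "0 \<in> simplicial_chains P k"
  by (auto simp: simplicial_chains_def)

lemma simplicial_chains_add:
  "v \<in> simplicial_chains P k \<Longrightarrow> w \<in> simplicial_chains P k \<Longrightarrow> v + w \<in> simplicial_chains P k"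
  by (auto simp: simplicial_chains_def dest!: set_mp[OF keys_add])

lemma simplicial_chains_diff:
  "v \<in> simplicial_chains P k \<Longrightarrow> w \<in> simplicial_chains P k \<Longrightarrow> v - w \<in> simplicial_chains P k"
  by (auto simp: simplicial_chains_def dest!: set_mp[OF keys_diff])

lemma simplicial_chains_fscale: "v \<in> simplicial_chains P k \<Longrightarrow> fscale c v \<in> simplicial_chains P k"
  unfolding simplicial_chains_def mem_Collect_eq by (rule order_trans[OF keys_fscale])

lemma simplicial_chains_sum:
  "(\<And>i. i \<in> I \<Longrightarrow> v i \<in> simplicial_chains P k) \<Longrightarrow> (\<Sum>i\<in>I. v i) \<in> simplicial_chains P k"
  by (induction I rule: infinite_finite_induct) (auto intro: simplicial_chains_add)

lemma simplicial_chains_linear_extension: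
  assumes "v \<in> simplicial_chains P k" "\<And>C. C \<in> simplices P k \<Longrightarrow> f C \<in> simplicial_chains P' k'"
  shows "linear_extension f v \<in> simplicial_chains P' k'"
  unfolding linear_extension_def using assms
  by (intro simplicial_chains_sum simplicial_chains_fscale) (auto simp: simplicial_chains_def)

lemma simplices_Diff_singleton: "C \<in> simplices P (k + 1) \<Longrightarrow> x \<in> C \<Longrightarrow> C - {x} \<in> simplices P k"
  using card_Suc_Diff1[of C x] chain_subset[of C "C - {x}"] by (auto simp: simplices_def)

lemma boundary_in_simplicial_chains:
  assumes "v \<in> simplicial_chains P (k + 1)"
  shows "boundary v \<in> simplicial_chains P k"
proof -
  have "D \<in> simplices P k" if "D \<in> keys (boundary v)" for D
  proof -
    from set_mp[OF keys_boundary that] obtain C x where "C \<in> keys v" "x \<in> C" "D = C - {x}"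
      by blast
    then show ?thesis using assms by (auto simp: simplicial_chains_def intro!: simplices_Diff_singleton)
  qed
  then show ?thesis by (auto simp: simplicial_chains_def)
qed

lemma boundary_boundary:
  assumes "v \<in> simplicial_chains P k"
  shows "boundary (boundary v) = 0"
proof -
  have "boundary (boundary v)
      = (\<Sum>C\<in>keys v. fscale (lookup v C) (boundary (boundary (single C 1))))"
    by (subst poly_mapping_eq_sum_single[of "keys v" v])
      (simp_all add: boundary_sum flip: boundary_fscale)
  also have "\<dots> = 0"
  proof (rule sum.neutral, rule ballI)
    fix C assume "C \<in> keys v"
    then have "C \<in> simplices P k" using assms by (auto simp: simplicial_chains_def)
    then show "fscale (lookup v C) (boundary (boundary (single C 1))) = 0"
      using simplicesD(2,3) by (subst boundary_boundary_single) auto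
  qed
  finally show ?thesis .
qed

lemma lookup_boundary_single:
  "lookup (boundary (single C c)) D
    = (\<Sum>x\<in>C. if C - {x} = D then c * face_sign C x else 0)"
  by (simp add: boundary_single lookup_sum lookup_single when_def)

text \<open>The cofaces of \<open>D\<close> are listed by their extra vertex; sets that are not
  simplices have coefficient zero in \<open>v\<close>. In this form a vanishing boundary is a linear
  equation among the coefficients of the cofaces of \<open>D\<close>.\<close>

lemma lookup_boundary:
  assumes "finite P" "v \<in> simplicial_chains P k"
  shows "lookup (boundary v) D
    = (\<Sum>x\<in>P - D. lookup v (insert x D) * face_sign (insert x D) x)"
proof -
  let ?K = "keys v"
  have "lookup (boundary v) D
      = (\<Sum>C\<in>?K. \<Sum>x\<in>C. if C - {x} = D then lookup v C * face_sign C x else 0)"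
    by (subst poly_mapping_eq_sum_single[of ?K v])
      (simp_all add: boundary_sum lookup_sum lookup_boundary_single)
  also have "\<dots> = (\<Sum>C\<in>?K. \<Sum>x\<in>P - D. if C = insert x D then lookup v C * face_sign C x else 0)"
  proof (rule sum.cong[OF refl])
    fix C assume "C \<in> ?K"
    then have C: "finite C" "C \<subseteq> P"
      using assms by (auto simp: simplicial_chains_def simplices_def)
    show "(\<Sum>x\<in>C. if C - {x} = D then lookup v C * face_sign C x else 0)
        = (\<Sum>x\<in>P - D. if C = insert x D then lookup v C * face_sign C x else 0)"
      using C assms by (intro sum.mono_neutral_cong) auto
  qed
  also have "\<dots> = (\<Sum>x\<in>P - D. \<Sum>C\<in>?K. if C = insert x D then lookup v C * face_sign C x else 0)"
    by (rule sum.swap)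
  also have "\<dots> = (\<Sum>x\<in>P - D. lookup v (insert x D) * face_sign (insert x D) x)"
    by (intro sum.cong refl) (auto simp: in_keys_iff)
  finally show ?thesis .
qed

section \<open>Shellable complexes are acyclic below the top degree\<close>

text \<open>
  Every simplex \<open>C\<close> lies in a unique facet \<open>mF C\<close> of least weight, and the simplices with
  \<open>mF C = F\<close> form an interval in the face lattice of \<open>F\<close>. Unless this interval is \<open>{F}\<close>, it is a
  cone with some apex \<open>pt F\<close>, so the part of greatest weight of a cycle can be removed by
  subtracting a boundary.
\<close>

lemma shellable_imp_acyclic:
  fixes P :: "'p :: order set" and \<phi> :: "'p set \<Rightarrow> nat"
  assumes fin: "finite P"
    and facet: "\<And>F. F \<in> \<F> \<Longrightarrow> F \<subseteq> P \<and> order_chain F \<and> card F = d"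
    and ext: "\<And>C. C \<subseteq> P \<Longrightarrow> order_chain C \<Longrightarrow> \<exists>F\<in>\<F>. C \<subseteq> F"
    and shell: "\<And>F G. F \<in> \<F> \<Longrightarrow> G \<in> \<F> \<Longrightarrow> G \<noteq> F \<Longrightarrow> \<phi> G \<le> \<phi> F \<Longrightarrow>
      \<exists>x\<in>F - G. \<exists>H\<in>\<F>. \<phi> H < \<phi> F \<and> F - {x} \<subseteq> H"
    and c: "c \<in> cycles P k" and k: "k + 1 < int d"
  shows "c \<in> boundaries P k"
proof -
  define face where "face C \<longleftrightarrow> C \<subseteq> P \<and> order_chain C" for C
  have face_subset: "face D" if "D \<subseteq> C" "face C" for C D
    using that by (auto simp: face_def intro: chain_subset)
  have facet_face: "face F" if "F \<in> \<F>" for F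
    using facet[OF that] by (simp add: face_def)
  have "\<exists>F. F \<in> \<F> \<and> C \<subseteq> F \<and> (\<forall>G\<in>\<F>. C \<subseteq> G \<longrightarrow> \<phi> F \<le> \<phi> G)" if "face C" for C
    using ext[of C] that ex_has_least_nat[of "\<lambda>F. F \<in> \<F> \<and> C \<subseteq> F" _ \<phi>]
    unfolding face_def by (metis (no_types, lifting))
  then obtain mF where mF: "\<And>C. face C \<Longrightarrow> mF C \<in> \<F>" "\<And>C. face C \<Longrightarrow> C \<subseteq> mF C"
    and mF_least: "\<And>C G. face C \<Longrightarrow> G \<in> \<F> \<Longrightarrow> C \<subseteq> G \<Longrightarrow> \<phi> (mF C) \<le> \<phi> G"
    by metis
  \<comment> \<open>A second such facet \<open>G\<close> would give, by shelling, a vertex x outside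
    \<open>G\<close> and a lighter facet containing \<open>mF C - {x}\<close>. Since C lies in
    \<open>G\<close>, it avoids x and lies in that lighter facet, against minimality.\<close>
  have mF_unique: "G = mF C" if "face C" "G \<in> \<F>" "C \<subseteq> G" "\<phi> G \<le> \<phi> (mF C)" for C G
  proof (rule ccontr)
    assume "G \<noteq> mF C"
    with shell[OF mF(1)[OF that(1)] that(2)] that(4)
    obtain x H where "x \<in> mF C - G" "H \<in> \<F>" "\<phi> H < \<phi> (mF C)" "mF C - {x} \<subseteq> H" by blast
    moreover have "C \<subseteq> H" using calculation mF(2)[OF that(1)] that(3) by blast
    ultimately show False using mF_least[OF that(1), of H] by simp
  qed
  have mF_mono: "\<phi> (mF D) \<le> \<phi> (mF C)" if "D \<subseteq> C" "face C" for C D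
    using that mF mF_least face_subset by (meson order_trans subset_trans)
  define good where "good F \<longleftrightarrow> (\<exists>C. face C \<and> C \<noteq> F \<and> mF C = F)" for F
  have "\<exists>x\<in>F. \<forall>C. face C \<and> mF C = F \<longrightarrow> mF (C - {x}) = F \<and> mF (insert x C) = F" if "good F" for F
  proof -
    \<comment> \<open>The restriction of \<open>F\<close> in the sense of shellings: the vertices
      whose removal leaves a face of a lighter facet. It is the lower end of the interval of
      simplices assigned to \<open>F\<close>.\<close>
    define R where "R = {x\<in>F. \<exists>H\<in>\<F>. \<phi> H < \<phi> F \<and> F - {x} \<subseteq> H}"
    have R: "R \<subseteq> C" if "face C" "mF C = F" for C
    proof
      fix x assume "x \<in> R"
      then obtain H where H: "H \<in> \<F>" "\<phi> H < \<phi> F" "F - {x} \<subseteq> H" by (auto simp: R_def)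
      show "x \<in> C"
      proof (rule ccontr)
        assume "x \<notin> C"
        then have "C \<subseteq> H" using H mF(2)[OF that(1)] that(2) by blast
        then show False using mF_least[OF that(1) H(1)] H(2) that(2) by simp
      qed
    qed
    from \<open>good F\<close> obtain C0 where C0: "face C0" "C0 \<noteq> F" "mF C0 = F" by (auto simp: good_def)
    have F: "F \<in> \<F>" using mF(1)[OF C0(1)] C0(3) by simp
    \<comment> \<open>\<open>C0\<close> contains \<open>R\<close> and is a proper subset of
      \<open>F\<close>, so \<open>F\<close> has a vertex outside \<open>R\<close>; any such vertex
      serves as the apex.\<close>
    obtain x where x: "x \<in> F" "x \<notin> R"
      using R[OF C0(1,3)] C0 mF(2)[OF C0(1)] by blast
    have "mF (C - {x}) = F \<and> mF (insert x C) = F" if C: "face C" "mF C = F" for C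
    proof
      have "C \<subseteq> F" using mF(2)[OF C(1)] C(2) by simp
      then have f: "face (C - {x})" "face (insert x C)"
        using face_subset[of _ F] facet_face[OF F] x by blast+
      show "mF (insert x C) = F"
        using mF_mono[of C "insert x C"] f C \<open>C \<subseteq> F\<close> x F mF_unique[of "insert x C" F] by auto
      show "mF (C - {x}) = F"
      proof (rule ccontr)
        \<comment> \<open>If deleting x changed the assigned facet, shelling would produce a vertex
          of \<open>R\<close> outside the new facet. But \<open>R\<close> is contained in
          \<open>C - {x}\<close>, which lies in that facet.\<close>
        assume ne: "mF (C - {x}) \<noteq> F"
        have "\<phi> (mF (C - {x})) \<le> \<phi> F" using mF_mono[of "C - {x}" C] C by auto
        then obtain y where "y \<in> F - mF (C - {x})" "y \<in> R"
          using shell[OF F mF(1)[OF f(1)] ne] unfolding R_def by blast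
        moreover have "R \<subseteq> C - {x}" using R[OF C] x by blast
        ultimately show False using mF(2)[OF f(1)] by blast
      qed
    qed
    then show ?thesis using x by blast
  qed
  then obtain pt where pt: "\<And>F. good F \<Longrightarrow> pt F \<in> F"
      "\<And>F C. good F \<Longrightarrow> face C \<Longrightarrow> mF C = F \<Longrightarrow> mF (C - {pt F}) = F"
      "\<And>F C. good F \<Longrightarrow> face C \<Longrightarrow> mF C = F \<Longrightarrow> mF (insert (pt F) C) = F"
    by metis
  have simplex_face: "face C" if "C \<in> simplices P k" for C
    using simplicesD[OF that] by (simp add: face_def)
  have good: "good (mF C)" if "C \<in> simplices P k" for C
  proof -
    \<comment> \<open>C has k + 1 < d elements and its facet has d.\<close>
    have "C \<noteq> mF C" using simplicesD(4)[OF that] k facet mF(1) simplex_face[OF that] by fastforce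
    then show ?thesis using simplex_face[OF that] by (auto simp: good_def)
  qed
  \<comment> \<open>Induction on a strict bound for the weights that occur in the cycle; at bound 0
    the cycle is zero.\<close>
  have "c \<in> boundaries P k" if "c \<in> cycles P k" "\<forall>C\<in>keys c. \<phi> (mF C) < N" for c N
    using that
  proof (induction N arbitrary: c)
    case 0
    then have "c = boundary 0" by simp
    then show ?case unfolding boundaries_def by (intro image_eqI[of _ _ 0]) auto
  next
    case (Suc N)
    let ?pt = "\<lambda>C. pt (mF C)"
    have cc: "c \<in> simplicial_chains P k" "boundary c = 0"
      using Suc.prems by (auto simp: cycles_def)
    then have keys_c: "C \<in> simplices P k" if "C \<in> keys c" for C
      using that by (auto simp: simplicial_chains_def)
    define A where "A = {C \<in> keys c. \<phi> (mF C) = N \<and> ?pt C \<notin> C}"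
    have A: "C \<in> simplices P k" "face C" "?pt C \<notin> C" "\<phi> (mF C) = N" "good (mF C)" if "C \<in> A" for C
      using that keys_c simplex_face good by (auto simp: A_def)
    have "finite A" by (simp add: A_def)
    \<comment> \<open>Each simplex of weight N that lacks its apex is coned off. The face opposite
      to the apex carries the same sign once more, so the boundary of \<open>b\<close> has
      coefficient \<open>lookup c C\<close> there.\<close>
    define b where "b = (\<Sum>C\<in>A. single (insert (?pt C) C)
      (lookup c C * face_sign (insert (?pt C) C) (?pt C)))"
    have ins: "insert (?pt C) C \<subseteq> mF C" if "C \<in> A" for C
      using A[OF that] mF(2) pt(1) by auto
    have b: "b \<in> simplicial_chains P (k + 1)"
      unfolding b_def
    proof (intro simplicial_chains_sum simplicial_chains_single)
      fix C assume C: "C \<in> A"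
      have "face (insert (?pt C) C)"
        using ins[OF C] facet_face[OF mF(1)[OF A(2)[OF C]]] face_subset by blast
      then show "insert (?pt C) C \<in> simplices P (k + 1)"
        using simplicesD[OF A(1)[OF C]] A(3)[OF C] by (simp add: simplices_def face_def)
    qed
    define c' where "c' = c - boundary b"
    have c': "c' \<in> simplicial_chains P k" "boundary c' = 0"
      using cc b boundary_boundary[OF b]
      by (auto simp: c'_def boundary_diff intro: simplicial_chains_diff boundary_in_simplicial_chains)
    have keys_b: "\<exists>C\<in>A. E \<subseteq> insert (?pt C) C" if "E \<in> keys (boundary b)" for E
    proof -
      obtain D x where D: "D \<in> keys b" "E = D - {x}"
        using keys_boundary[of b] \<open>E \<in> keys (boundary b)\<close> by blast
      from D(1) obtain C where "C \<in> A" "D = insert (?pt C) C"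
        unfolding b_def by (auto dest!: set_mp[OF keys_sum_subset] split: if_splits)
      then show ?thesis using D by auto
    qed
    \<comment> \<open>All faces of a cone over C still lie in \<open>mF C\<close>, so subtracting
      the boundary introduces no weight above N.\<close>
    have le_N: "\<phi> (mF E) \<le> N" if "E \<in> keys c'" for E
    proof -
      have "E \<in> keys c \<or> E \<in> keys (boundary b)"
        using that unfolding c'_def by (auto dest!: set_mp[OF keys_diff])
      then show ?thesis
      proof
        assume "E \<in> keys c" then show ?thesis using Suc.prems(2) by auto
      next
        assume "E \<in> keys (boundary b)"
        from keys_b[OF this] obtain C where C: "C \<in> A" and "E \<subseteq> insert (?pt C) C" ..
        from this(2) ins[OF this(1)] have E: "E \<subseteq> mF C" by (rule order_trans)
        note F = mF(1)[OF A(2)[OF C]]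
        show ?thesis
          using mF_least[OF face_subset[OF E facet_face[OF F]] F E] A(4)[OF C] by simp
      qed
    qed
    \<comment> \<open>Any face of a cone over C other than C itself contains the apex. If it has
      weight N, uniqueness gives it the same facet as C, hence the same apex. So E can only arise
      from the cone over E.\<close>
    have zero1: "lookup c' E = 0" if E: "E \<in> simplices P k" "\<phi> (mF E) = N" "?pt E \<notin> E" for E
    proof -
      have "lookup (boundary b) E
          = (\<Sum>C\<in>A. \<Sum>x\<in>insert (?pt C) C. if insert (?pt C) C - {x} = E
              then lookup c C * face_sign (insert (?pt C) C) (?pt C)
                * face_sign (insert (?pt C) C) x else 0)"
        by (simp add: b_def boundary_sum lookup_sum lookup_boundary_single)
      also have "\<dots> = (\<Sum>C\<in>A. if C = E then lookup c E else 0)"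
      proof (rule sum.cong[OF refl])
        fix C assume C: "C \<in> A"
        have "insert (?pt C) C - {x} = E \<longleftrightarrow> x = ?pt C \<and> C = E" if "x \<in> insert (?pt C) C" for x
        proof
          assume eq: "insert (?pt C) C - {x} = E"
          have "x = ?pt C"
          proof (rule ccontr)
            assume "x \<noteq> ?pt C"
            then have "?pt C \<in> E" using eq by auto
            have "mF C = mF E"
              using mF_unique[OF simplex_face[OF E(1)] mF(1)[OF A(2)[OF C]]] ins[OF C] eq A(4)[OF C] E(2)
              by auto
            then show False using \<open>?pt C \<in> E\<close> E(3) by simp
          qed
          then show "x = ?pt C \<and> C = E" using eq A(3)[OF C] by auto
        next
          assume "x = ?pt C \<and> C = E" then show "insert (?pt C) C - {x} = E" using A(3)[OF C] by auto
        qed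
        then have "(\<Sum>x\<in>insert (?pt C) C. if insert (?pt C) C - {x} = E
              then lookup c C * face_sign (insert (?pt C) C) (?pt C)
                * face_sign (insert (?pt C) C) x else 0)
          = (\<Sum>x\<in>insert (?pt C) C. if x = ?pt C then (if C = E then lookup c E else 0) else 0)"
          by (intro sum.cong refl) (simp add: mult.assoc)
        also have "\<dots> = (if C = E then lookup c E else 0)"
          using simplicesD(2)[OF A(1)[OF C]] by (subst sum.delta) auto
        finally show "(\<Sum>x\<in>insert (?pt C) C. if insert (?pt C) C - {x} = E
              then lookup c C * face_sign (insert (?pt C) C) (?pt C)
                * face_sign (insert (?pt C) C) x else 0)
          = (if C = E then lookup c E else 0)" .
      qed
      also have "\<dots> = lookup c E"
        using \<open>finite A\<close> E by (auto simp: A_def in_keys_iff)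
      finally show ?thesis by (simp add: c'_def lookup_minus)
    qed
    \<comment> \<open>The boundary of \<open>c'\<close> is evaluated at E without its apex. Every
      other coface that occurs in \<open>c'\<close> has weight at most N, hence belongs to the same
      facet; it lacks the apex, so its coefficient vanishes by \<open>zero1\<close>. Only the term
      of E remains.\<close>
    have zero2: "lookup c' E = 0" if E: "E \<in> simplices P k" "\<phi> (mF E) = N" "?pt E \<in> E" for E
    proof -
      let ?p = "?pt E" and ?D = "E - {?pt E}"
      have fE: "face E" by (rule simplex_face[OF E(1)])
      have fD: "face ?D" by (rule face_subset[OF _ fE]) auto
      have mD: "mF ?D = mF E" using pt(2)[OF good[OF E(1)] fE] by simp
      have others: "lookup c' (insert z ?D) = 0" if z: "z \<in> P - ?D" "z \<noteq> ?p" for z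
      proof (rule ccontr)
        assume "lookup c' (insert z ?D) \<noteq> 0"
        then have key: "insert z ?D \<in> keys c'" by (simp add: in_keys_iff)
        then have s: "insert z ?D \<in> simplices P k" using c'(1) by (auto simp: simplicial_chains_def)
        note f = simplex_face[OF s]
        have le: "\<phi> (mF (insert z ?D)) \<le> N" by (rule le_N[OF key])
        then have eq: "mF (insert z ?D) = mF E"
          using mF_unique[OF fD mF(1)[OF f]] mF(2)[OF f] mD E(2) by auto
        then have "?pt (insert z ?D) \<notin> insert z ?D" using z by auto
        then show False using zero1[OF s] eq E(2) key by (simp add: in_keys_iff)
      qed
      have "0 = (\<Sum>z\<in>P - ?D. lookup c' (insert z ?D) * face_sign (insert z ?D) z)"
        using lookup_boundary[OF fin c'(1), of ?D] c'(2) by simp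
      also have "\<dots> = (\<Sum>z\<in>P - ?D. if z = ?p then lookup c' E * face_sign E ?p else 0)"
      proof (rule sum.cong[OF refl])
        fix z assume z: "z \<in> P - ?D"
        show "lookup c' (insert z ?D) * face_sign (insert z ?D) z
            = (if z = ?p then lookup c' E * face_sign E ?p else 0)"
          by (cases "z = ?p") (simp_all add: others[OF z] insert_absorb[OF E(3)])
      qed
      also have "\<dots> = lookup c' E * face_sign E ?p"
      proof -
        have "?p \<in> P - ?D" using E(3) simplicesD(1)[OF E(1)] by blast
        then show ?thesis using fin by (simp only: sum.delta finite_Diff if_True)
      qed
      finally show ?thesis by simp
    qed
    have "c' \<in> boundaries P k"
    proof (rule Suc.IH)
      show "c' \<in> cycles P k" using c' by (simp add: cycles_def)
      show "\<forall>C\<in>keys c'. \<phi> (mF C) < N"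
      proof
        fix C assume C: "C \<in> keys c'"
        then have "C \<in> simplices P k" using c'(1) by (auto simp: simplicial_chains_def)
        then have "\<phi> (mF C) \<noteq> N"
          using zero1[of C] zero2[of C] C by (auto simp: in_keys_iff)
        then show "\<phi> (mF C) < N"
          using le_N[OF C] by simp
      qed
    qed
    then obtain b' where "b' \<in> simplicial_chains P (k + 1)" "c' = boundary b'"
      by (auto simp: boundaries_def)
    then show ?case
      using b unfolding boundaries_def c'_def
      by (intro image_eqI[of _ _ "b' + b"]) (auto simp: boundary_add algebra_simps intro: simplicial_chains_add)
  qed
  moreover obtain N where "\<forall>C\<in>keys c. \<phi> (mF C) < N"
    using finite_nat_set_iff_bounded[of "(\<phi> \<circ> mF) ` keys c"] by auto
  ultimately show ?thesis using c by blast
qed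

section \<open>Traces\<close>

lemma linear_linear_extension: "Vector_Spaces.linear fscale fscale (linear_extension f)"
  by unfold_locales (simp_all add: linear_extension_add linear_extension_fscale)

lemma linear_boundary: "Vector_Spaces.linear fscale fscale boundary"
  unfolding boundary_def by (rule linear_linear_extension)

lemma linear_chain_map: "Vector_Spaces.linear fscale fscale (chain_map g)"
  unfolding chain_map_def by (rule linear_linear_extension)

lemma linear_eq_sum_single:
  assumes L: "Vector_Spaces.linear fscale fscale L" and X: "finite X" "keys v \<subseteq> X"
  shows "L v = (\<Sum>b\<in>X. fscale (lookup v b) (L (single b 1)))"
proof -
  interpret L: Vector_Spaces.linear fscale fscale L by (rule L)
  have "L v = L (\<Sum>b\<in>X. fscale (lookup v b) (single b 1))"
    using poly_mapping_eq_sum_single[OF X] by simp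
  then show ?thesis by (simp only: L.sum L.scale)
qed

lemma linear_eq_on_simplicial_chains:
  assumes "Vector_Spaces.linear fscale fscale L" "Vector_Spaces.linear fscale fscale M"
    and "v \<in> simplicial_chains P k"
    and "\<And>C. C \<in> simplices P k \<Longrightarrow> L (single C 1) = M (single C 1)"
  shows "L v = M v"
proof -
  have "C \<in> simplices P k" if "C \<in> keys v" for C
    using that assms(3) by (auto simp: simplicial_chains_def)
  then show ?thesis
    unfolding linear_eq_sum_single[OF assms(1) finite_keys order_refl, of v]
      linear_eq_sum_single[OF assms(2) finite_keys order_refl, of v]
    by (simp add: assms(4))
qed

text \<open>The trace of the compression of \<open>L\<close> to the span of the basis vectors
  indexed by \<open>X\<close>; \<open>L\<close> itself acts on the whole, possibly
  infinite-dimensional space.\<close>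

definition coord_trace :: "'b set \<Rightarrow> (('b \<Rightarrow>\<^sub>0 'k :: field) \<Rightarrow> ('b \<Rightarrow>\<^sub>0 'k)) \<Rightarrow> 'k"
  where "coord_trace X L = (\<Sum>e\<in>X. lookup (L (single e 1)) e)"

lemma coord_trace_cong:
  "(\<And>e. e \<in> X \<Longrightarrow> L (single e 1) = M (single e 1)) \<Longrightarrow> coord_trace X L = coord_trace X M"
  by (simp add: coord_trace_def)

lemma coord_trace_add: "coord_trace X (\<lambda>v. L v + M v) = coord_trace X L + coord_trace X M"
  by (simp add: coord_trace_def lookup_add sum.distrib)

lemma coord_trace_diff: "coord_trace X (\<lambda>v. L v - M v) = coord_trace X L - coord_trace X M"
  by (simp add: coord_trace_def lookup_minus sum_subtractf)

text \<open>Both sides are one double sum over matrix entries, read in two orders. The support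
  conditions ensure that no intermediate coordinate is cut off.\<close>

lemma coord_trace_cyclic:
  assumes L: "Vector_Spaces.linear fscale fscale L" and M: "Vector_Spaces.linear fscale fscale M"
    and fin: "finite X" "finite Y"
    and LX: "\<And>e. e \<in> X \<Longrightarrow> keys (L (single e 1)) \<subseteq> Y"
    and MY: "\<And>e. e \<in> Y \<Longrightarrow> keys (M (single e 1)) \<subseteq> X"
  shows "coord_trace X (\<lambda>v. M (L v)) = coord_trace Y (\<lambda>v. L (M v))"
proof -
  let ?l = "\<lambda>e y. lookup (L (single e 1)) y"
  let ?m = "\<lambda>e y. lookup (M (single e 1)) y"
  have "coord_trace X (\<lambda>v. M (L v)) = (\<Sum>e\<in>X. \<Sum>y\<in>Y. ?l e y * ?m y e)"
    unfolding coord_trace_def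
    by (intro sum.cong refl, subst linear_eq_sum_single[OF M fin(2) LX])
      (simp_all add: lookup_sum)
  also have "\<dots> = (\<Sum>y\<in>Y. \<Sum>e\<in>X. ?m y e * ?l e y)"
    by (subst sum.swap) (simp add: mult.commute)
  also have "\<dots> = coord_trace Y (\<lambda>v. L (M v))"
    unfolding coord_trace_def
    by (intro sum.cong refl, subst linear_eq_sum_single[OF L fin(1) MY])
      (simp_all add: lookup_sum)
  finally show ?thesis .
qed

section \<open>Traces on subspaces of a coordinate space\<close>

lemma quotient_basis_exists:
  fixes V :: "('b \<Rightarrow>\<^sub>0 'k :: field) set"
  assumes fin: "finite X" and V: "\<And>v. v \<in> V \<Longrightarrow> keys v \<subseteq> X"
  shows "\<exists>B. quotient_basis V {0} B"
proof -
  obtain B where B: "B \<subseteq> V" "free_space.independent B" "V \<subseteq> free_space.span B"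
    using free_space.maximal_independent_subset by blast
  let ?E = "(\<lambda>e. single e 1) ` X"
  have "v \<in> free_space.span ?E" if "v \<in> V" for v
  proof -
    have "v = (\<Sum>e\<in>X. fscale (lookup v e) (single e 1))"
      using poly_mapping_eq_sum_single[OF fin V[OF that]] by simp
    also have "\<dots> \<in> free_space.span ?E"
      by (intro free_space.span_sum free_space.span_scale free_space.span_base) auto
    finally show ?thesis .
  qed
  then have "finite B"
    using free_space.independent_span_bound[of ?E B] fin B by auto
  have "quotient_basis V {0} B"
    unfolding quotient_basis_def
  proof (intro conjI allI impI ballI)
    fix a b assume "(\<Sum>b\<in>B. fscale (a b) b) \<in> {0}" "b \<in> B"
    then show "a b = 0"
      using free_space.independentD[OF B(2) \<open>finite B\<close>] by auto
  next
    fix v assume "v \<in> V"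
    then have "v \<in> free_space.span B" using B by blast
    then show "\<exists>a. v - (\<Sum>b\<in>B. fscale (a b) b) \<in> {0}"
      unfolding free_space.span_finite[OF \<open>finite B\<close>] by auto
  qed (use B \<open>finite B\<close> in auto)
  then show ?thesis ..
qed

text \<open>
  The trace on a subspace \<open>V\<close> is the trace, on the ambient coordinate space, of the composition
  with any projection onto \<open>V\<close>; this makes it independent of the chosen basis.
\<close>

lemma quotient_trace_eq_coord_trace:
  fixes V :: "('b \<Rightarrow>\<^sub>0 'k :: field) set"
  assumes fin: "finite X" and V: "\<And>v. v \<in> V \<Longrightarrow> keys v \<subseteq> X"
    and f: "Vector_Spaces.linear fscale fscale f" and fV: "\<And>v. v \<in> V \<Longrightarrow> f v \<in> V"
    and p: "Vector_Spaces.linear fscale fscale p"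
    and pV: "\<And>e. e \<in> X \<Longrightarrow> p (single e 1) \<in> V" and p_id: "\<And>v. v \<in> V \<Longrightarrow> p v = v"
  shows "quotient_trace V {0} f = coord_trace X (\<lambda>v. f (p v))"
proof -
  interpret f: Vector_Spaces.linear fscale fscale f by (rule f)
  define B where "B = (SOME B. quotient_basis V {0} B)"
  have "quotient_basis V {0} B"
    unfolding B_def using someI_ex[OF quotient_basis_exists[OF fin V]] .
  then have B: "finite B" "B \<subseteq> V" "\<And>a b. (\<Sum>b\<in>B. fscale (a b) b) = 0 \<Longrightarrow> b \<in> B \<Longrightarrow> a b = 0"
    and span: "\<And>v. v \<in> V \<Longrightarrow> \<exists>a. v = (\<Sum>b\<in>B. fscale (a b) b)"
    unfolding quotient_basis_def by auto
  have unique: "a b = a' b"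
    if "(\<Sum>b\<in>B. fscale (a b) b) = (\<Sum>b\<in>B. fscale (a' b) b)" "b \<in> B" for a a' b
  proof -
    have "(\<Sum>b\<in>B. fscale (a b - a' b) b) = 0"
      using that(1) by (simp add: free_space.scale_left_diff_distrib sum_subtractf)
    from B(3)[OF this that(2)] show ?thesis by simp
  qed
  define A where "A = (SOME A. quotient_matrix {0} B f A)"
  have "\<exists>A. quotient_matrix {0} B f A"
  proof -
    have "\<forall>b\<in>B. \<exists>a. f b = (\<Sum>b'\<in>B. fscale (a b') b')" using span fV B(2) by blast
    then obtain a where "\<forall>b\<in>B. f b = (\<Sum>b'\<in>B. fscale (a b b') b')" by metis
    then show ?thesis by (intro exI[of _ "\<lambda>b' b. a b b'"]) (simp add: quotient_matrix_def)
  qed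
  then have "quotient_matrix {0} B f A" unfolding A_def by (rule someI_ex)
  then have A: "f b = (\<Sum>b'\<in>B. fscale (A b' b) b')" if "b \<in> B" for b
    using that by (simp add: quotient_matrix_def)
  have "\<forall>e\<in>X. \<exists>a. p (single e 1) = (\<Sum>b\<in>B. fscale (a b) b)" using span pV by blast
  then obtain a where a: "\<And>e. e \<in> X \<Longrightarrow> p (single e 1) = (\<Sum>b\<in>B. fscale (a e b) b)"
    by metis
  \<comment> \<open>Since p fixes \<open>f b\<close>, expanding \<open>f b\<close> in coordinates
    and applying p to each of them expresses \<open>f b\<close> in the basis again. Comparing
    coefficients gives the diagonal entry.\<close>
  have diag: "A b b = (\<Sum>e\<in>X. lookup (f b) e * a e b)" if b: "b \<in> B" for b
  proof -
    have fb: "f b \<in> V" using fV B(2) b by blast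
    have "(\<Sum>b'\<in>B. fscale (A b' b) b') = p (f b)" using p_id[OF fb] A[OF b] by simp
    also have "\<dots> = (\<Sum>e\<in>X. fscale (lookup (f b) e) (\<Sum>b'\<in>B. fscale (a e b') b'))"
      by (subst linear_eq_sum_single[OF p fin V[OF fb]]) (simp add: a)
    also have "\<dots> = (\<Sum>b'\<in>B. fscale (\<Sum>e\<in>X. lookup (f b) e * a e b') b')"
      by (simp add: fscale_sum free_space.scale_sum_left) (rule sum.swap)
    finally show ?thesis by (rule unique[OF _ b])
  qed
  have "quotient_trace V {0} f = (\<Sum>b\<in>B. A b b)"
    by (simp add: quotient_trace_def Let_def flip: B_def A_def)
  also have "\<dots> = (\<Sum>e\<in>X. \<Sum>b\<in>B. lookup (f b) e * a e b)"
    by (subst sum.swap) (simp add: diag)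
  also have "\<dots> = coord_trace X (\<lambda>v. f (p v))"
    unfolding coord_trace_def
    by (intro sum.cong refl) (simp add: a f.sum f.scale lookup_sum mult.commute)
  finally show ?thesis .
qed

text \<open>\<open>H\<close> is built by induction on the number of elements: if it is known on the
  faces of C, then C minus \<open>H\<close> of its boundary is a cycle, and by acyclicity
  \<open>H C\<close> can be any chain with this boundary. A simplex of degree k has k + 1 elements,
  so k + 1 < d means \<open>card C < d\<close>, and \<open>H C\<close> has degree
  \<open>card C\<close>.\<close>

lemma chain_homotopy_exists:
  assumes acyclic: "\<And>k c. k + 1 < int d \<Longrightarrow> c \<in> cycles P k \<Longrightarrow> c \<in> boundaries P k"
  obtains H where
    "\<And>C k. C \<in> simplices P k \<Longrightarrow> k + 1 < int d \<Longrightarrow> H C \<in> simplicial_chains P (k + 1)"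
    "\<And>v k. v \<in> simplicial_chains P k \<Longrightarrow> k + 1 < int d \<Longrightarrow>
      boundary (linear_extension H v) = v - linear_extension H (boundary v)"
proof -
  define hom where "hom H C \<longleftrightarrow> H C \<in> simplicial_chains P (int (card C)) \<and>
    boundary (H C) = single C 1 - linear_extension H (boundary (single C 1))" for H C
  have extend: "boundary (linear_extension H v) = v - linear_extension H (boundary v)"
    if v: "v \<in> simplicial_chains P k" and H: "\<And>C. C \<in> simplices P k \<Longrightarrow> hom H C" for H v k
  proof (rule linear_eq_on_simplicial_chains[OF _ _ v])
    show "Vector_Spaces.linear fscale fscale (\<lambda>v. boundary (linear_extension H v))"
      by unfold_locales
        (simp_all add: linear_extension_add linear_extension_fscale boundary_add boundary_fscale)
    show "Vector_Spaces.linear fscale fscale (\<lambda>v. v - linear_extension H (boundary v))"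
      by unfold_locales (simp_all add: linear_extension_add linear_extension_fscale boundary_add
          boundary_fscale free_space.scale_right_diff_distrib)
  qed (use H in \<open>auto simp: hom_def\<close>)
  have "\<exists>H. \<forall>C k. C \<in> simplices P k \<and> card C < j \<longrightarrow> hom H C" if "j \<le> d" for j
    using that
  proof (induction j)
    case 0
    then show ?case by simp
  next
    case (Suc j)
    then obtain H where H: "\<And>C k. C \<in> simplices P k \<Longrightarrow> card C < j \<Longrightarrow> hom H C"
      by (metis Suc_leD)
    let ?z = "\<lambda>C. single C 1 - linear_extension H (boundary (single C 1))"
    have ex: "\<exists>b. b \<in> simplicial_chains P (int j) \<and> boundary b = ?z C"
      if C: "C \<in> simplices P k" "card C = j" for C k
    proof -
      have k: "k = int j - 1" using simplicesD(4)[OF C(1)] C(2) by simp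
      have sC: "single C 1 \<in> simplicial_chains P k" by (rule simplicial_chains_single[OF C(1)])
      have bC: "boundary (single C 1) \<in> simplicial_chains P (k - 1)"
        using boundary_in_simplicial_chains[of _ P "k - 1"] sC by simp
      have H': "hom H D" if "D \<in> simplices P (k - 1)" for D
        using H[OF that] simplicesD(4)[OF that] k by simp
      have "linear_extension H (boundary (single C 1)) \<in> simplicial_chains P k"
      proof (rule simplicial_chains_linear_extension[OF bC])
        fix D assume D: "D \<in> simplices P (k - 1)"
        then show "H D \<in> simplicial_chains P k"
          using H'[OF D] simplicesD(4)[OF D] by (simp add: hom_def)
      qed
      then have z: "?z C \<in> simplicial_chains P k"
        using sC by (intro simplicial_chains_diff)
      \<comment> \<open>The homotopy identity one degree below replaces the boundary of
        \<open>H\<close> of the boundary of C by the boundary of C; the remaining term contains a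
        double boundary.\<close>
      have "boundary (?z C) = 0"
        by (simp add: boundary_diff extend[OF bC H'] boundary_boundary[OF sC])
      then have "?z C \<in> boundaries P k"
        using z k Suc.prems by (intro acyclic) (auto simp: cycles_def)
      then show ?thesis using k by (auto simp: boundaries_def)
    qed
    define H' where "H' = (\<lambda>C. if card C = j then SOME b. b \<in> simplicial_chains P (int j) \<and> boundary b = ?z C
      else H C)"
    have "hom H' C" if C: "C \<in> simplices P k" "card C < Suc j" for C k
    proof -
      \<comment> \<open>Proper faces have fewer than j elements, where the old and the new values
        agree.\<close>
      have eq: "linear_extension H' (boundary (single C 1))
          = linear_extension H (boundary (single C 1))"
      proof (rule linear_extension_eqI)
        fix D assume "D \<in> keys (boundary (single C (1 :: complex)))"
        from set_mp[OF keys_boundary this] obtain x where "x \<in> C" "D = C - {x}"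
          by (auto split: if_splits)
        then have "card D < card C" using simplicesD(2)[OF C(1)] by (metis card_Diff1_less)
        then show "H' D = H D" using C(2) by (simp add: H'_def)
      qed
      show ?thesis
      proof (cases "card C = j")
        case True
        then show ?thesis
          using someI_ex[OF ex[OF C(1) True]] by (simp add: hom_def eq) (simp add: H'_def)
      next
        case False
        then have "hom H C" using C H by simp
        then show ?thesis using False by (simp add: hom_def eq) (simp add: H'_def)
      qed
    qed
    then show ?case by blast
  qed
  then obtain H where H: "\<And>C k. C \<in> simplices P k \<Longrightarrow> card C < d \<Longrightarrow> hom H C"
    by blast
  have H': "hom H C" if "C \<in> simplices P k" "k + 1 < int d" for C k
    using H[OF that(1)] simplicesD(4)[OF that(1)] that(2) by simp
  show thesis
  proof (rule that)
    fix C k assume C: "C \<in> simplices P k" "k + 1 < int d"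
    show "H C \<in> simplicial_chains P (k + 1)"
      using H'[OF C] simplicesD(4)[OF C(1)] by (simp add: hom_def)
  next
    fix v k assume "v \<in> simplicial_chains P k" "k + 1 < int d"
    then show "boundary (linear_extension H v) = v - linear_extension H (boundary v)"
      using extend H' by blast
  qed
qed


section \<open>The Hopf trace formula\<close>

lemma chain_map_single: "chain_map g (single C c) = single (g ` C) c"
  by (simp add: chain_map_def)

lemma image_in_simplices:
  assumes g: "\<forall>x\<in>P. \<forall>y\<in>P. g x \<le> g y \<longleftrightarrow> x \<le> y" "g ` P \<subseteq> P" and C: "C \<in> simplices P k"
  shows "g ` C \<in> simplices P k"
proof -
  note C' = simplicesD[OF C]
  have "inj_on g C" using g(1) C'(1) by (intro inj_onI) (metis order_antisym order_refl subsetD)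
  moreover have "order_chain (g ` C)"
    using C'(3) g(1) C'(1) unfolding Complete_Partial_Order.chain_def by blast
  ultimately show ?thesis
    using C' g(2) by (auto simp: simplices_def card_image)
qed

lemma chain_map_in_simplicial_chains:
  assumes g: "\<forall>x\<in>P. \<forall>y\<in>P. g x \<le> g y \<longleftrightarrow> x \<le> y" "g ` P \<subseteq> P"
    and v: "v \<in> simplicial_chains P k"
  shows "chain_map g v \<in> simplicial_chains P k"
  unfolding chain_map_def
  by (rule simplicial_chains_linear_extension[OF v])
    (intro simplicial_chains_single image_in_simplices[OF g])

text \<open>An order embedding preserves the number of vertices below a given one, hence all face
  signs.\<close>

lemma boundary_chain_map:
  assumes g: "\<forall>x\<in>P. \<forall>y\<in>P. g x \<le> g y \<longleftrightarrow> x \<le> y"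
    and v: "v \<in> simplicial_chains P k"
  shows "boundary (chain_map g v) = chain_map g (boundary v)"
proof (rule linear_eq_on_simplicial_chains[OF _ _ v])
  show "Vector_Spaces.linear fscale fscale (\<lambda>v. boundary (chain_map g v))"
    "Vector_Spaces.linear fscale fscale (\<lambda>v. chain_map g (boundary v))"
    by (unfold_locales; simp add: chain_map_def linear_extension_add linear_extension_fscale
        boundary_add boundary_fscale)+
  fix C assume C: "C \<in> simplices P k"
  note C' = simplicesD[OF C]
  have inj: "inj_on g C" using g C'(1) by (intro inj_onI) (metis order_antisym order_refl subsetD)
  have less: "g x < g y \<longleftrightarrow> x < y" if "x \<in> C" "y \<in> C" for x y
    using g that C'(1) by (auto simp: less_le_not_le subset_iff)
  have sign: "face_sign (g ` C) (g x) = face_sign C x" if "x \<in> C" for x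
  proof -
    have "{y \<in> g ` C. y < g x} = g ` {y \<in> C. y < x}" using less that by auto
    moreover have "inj_on g {y \<in> C. y < x}" using inj by (rule inj_on_subset) auto
    ultimately show ?thesis by (simp add: face_sign_def card_image)
  qed
  have diff: "g ` C - {g x} = g ` (C - {x})" if "x \<in> C" for x
    using inj_on_image_set_diff[OF inj, of C "{x}"] that by auto
  show "boundary (chain_map g (single C 1)) = chain_map g (boundary (single C 1))"
    by (simp add: chain_map_single boundary_single sum.reindex[OF inj] sign diff)
      (simp add: chain_map_def linear_extension_sum)
qed

text \<open>Below the top degree the identity is the sum of boundary after homotopy and homotopy
  after boundary. Taking traces after composing with the chain map splits each \<open>t l\<close> as
  \<open>a l + s l\<close>, and cyclicity of the trace identifies \<open>a l\<close> with
  \<open>s (Suc l)\<close>. The sum telescopes, and the top homology contributes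
  \<open>t d - s d\<close>.\<close>

theorem hopf_trace_top_degree:
  fixes P :: "'p :: order set"
  assumes fin: "finite P"
    and acyclic: "\<And>k c. k + 1 < int d \<Longrightarrow> c \<in> cycles P k \<Longrightarrow> c \<in> boundaries P k"
    and dim: "\<And>C. C \<subseteq> P \<Longrightarrow> order_chain C \<Longrightarrow> card C \<le> d"
    and g: "\<forall>x\<in>P. \<forall>y\<in>P. g x \<le> g y \<longleftrightarrow> x \<le> y" "g ` P \<subseteq> P"
  shows "homology_trace P (int d - 1) g
    = (\<Sum>l\<le>d. (-1) ^ (d - l) * of_nat (card {C \<in> simplices P (int l - 1). g ` C = C}))"
proof -
  obtain H where H: "\<And>C k. C \<in> simplices P k \<Longrightarrow> k + 1 < int d \<Longrightarrow> H C \<in> simplicial_chains P (k + 1)"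
    and homotopy: "\<And>v k. v \<in> simplicial_chains P k \<Longrightarrow> k + 1 < int d \<Longrightarrow>
      boundary (linear_extension H v) = v - linear_extension H (boundary v)"
    using chain_homotopy_exists[OF acyclic] by metis
  let ?h = "linear_extension H" and ?f = "chain_map g"
  \<comment> \<open>The index l counts elements, so the empty simplex of degree -1 has index 0 and
    the top degree has index d.\<close>
  define X where "X l = simplices P (int l - 1)" for l :: nat
  have finX: "finite (X l)" for l by (simp add: X_def finite_simplices fin)
  have keysX: "keys v \<subseteq> X l" if "v \<in> simplicial_chains P (int l - 1)" for v l
    using that by (simp add: X_def simplicial_chains_def)
  have single: "single C 1 \<in> simplicial_chains P (int l - 1)" if "C \<in> X l" for C l
    using that by (simp add: X_def simplicial_chains_single)
  have h: "?h v \<in> simplicial_chains P (int l)" if "v \<in> simplicial_chains P (int l - 1)" "l < d" for v l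
    using simplicial_chains_linear_extension[OF that(1), of H P "int l"] H[of _ "int l - 1"] that(2) by simp
  have bd: "boundary v \<in> simplicial_chains P (int l - 1)" if "v \<in> simplicial_chains P (int l)" for v l
    using boundary_in_simplicial_chains[of v P "int l - 1"] that by simp
  note f = chain_map_in_simplicial_chains[OF g] and fb = boundary_chain_map[OF g(1)]
  have lin: "Vector_Spaces.linear fscale fscale (\<lambda>v. ?f (?h v))"
    by (unfold_locales; simp add: chain_map_def linear_extension_add linear_extension_fscale)
  define t where "t l = coord_trace (X l) ?f" for l
  define a where "a l = coord_trace (X l) (\<lambda>v. ?f (boundary (?h v)))" for l
  define s where "s l = coord_trace (X l) (\<lambda>v. ?f (?h (boundary v)))" for l
  have t: "t l = of_nat (card {C \<in> X l. g ` C = C})" for l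
    unfolding t_def coord_trace_def using finX
    by (simp add: chain_map_single lookup_single when_def sum.If_cases Int_def)
  have s_0: "s 0 = 0"
  proof -
    have "boundary (single C 1) = 0" if "C \<in> X 0" for C
      using simplicesD[of C P "-1"] that by (simp add: X_def boundary_single)
    then show ?thesis by (simp add: s_def coord_trace_def chain_map_def)
  qed
  have s_Suc: "s (Suc l) = a l" if "l < d" for l
  proof -
    have 1: "keys (boundary (single C 1)) \<subseteq> X l" if "C \<in> X (Suc l)" for C
      using bd[of "single C 1" l] single[OF that] keysX by simp
    have 2: "keys (?f (?h (single C 1))) \<subseteq> X (Suc l)" if "C \<in> X l" for C
      using f[OF h[OF single[OF that] \<open>l < d\<close>]] keysX[of _ "Suc l"] by simp
    \<comment> \<open>The boundary is moved from the right end to the left by cyclicity, which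
      lowers the index by one; it then passes through the chain map.\<close>
    have "s (Suc l) = coord_trace (X l) (\<lambda>v. boundary (?f (?h v)))"
      unfolding s_def by (rule coord_trace_cyclic[OF linear_boundary lin finX finX 1 2])
    also have "\<dots> = a l"
      unfolding a_def using fb h single that by (intro coord_trace_cong) blast
    finally show ?thesis .
  qed
  have ts: "t l = a l + s l" if "l < d" for l
    unfolding t_def a_def s_def coord_trace_add[symmetric]
  proof (rule coord_trace_cong)
    fix C assume C: "C \<in> X l"
    have "single C 1 = boundary (?h (single C 1)) + ?h (boundary (single C 1))"
      using homotopy[OF single[OF C]] that by simp
    then show "?f (single C 1) = ?f (boundary (?h (single C 1)))
        + ?f (?h (boundary (single C 1)))"
      unfolding chain_map_def by (metis linear_extension_add)
  qed
  have sd: "s l = - (\<Sum>m<l. (-1) ^ (l - m) * t m)" if "l \<le> d" for l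
    using that
  proof (induction l)
    case 0
    then show ?case by (simp add: s_0)
  next
    case (Suc l)
    have "s (Suc l) = t l - s l" using s_Suc ts Suc.prems by (simp add: algebra_simps)
    also have "\<dots> = t l + (\<Sum>m<l. (-1) ^ (l - m) * t m)" using Suc by simp
    also have "(\<Sum>m<l. (-1) ^ (l - m) * t m) = - (\<Sum>m<l. (-1) ^ (Suc l - m) * t m)"
      by (simp add: Suc_diff_le sum_negf)
    finally show ?case by simp
  qed
  \<comment> \<open>A projection onto the top cycles: the homotopy identity applied to a boundary
    shows that the subtracted term has the same boundary as v, and on cycles it vanishes.\<close>
  let ?p = "\<lambda>v. v - ?h (boundary v)"
  \<comment> \<open>For d = 0 the top degree is -1, where only the empty simplex lives; its boundary
    is zero, and there is no lower degree to which the homotopy identity could be applied.\<close>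
  have d_cases: "boundary v = 0 \<or> (0 < d \<and> boundary v \<in> simplicial_chains P (int (d - 1) - 1))"
    if v: "v \<in> simplicial_chains P (int d - 1)" for v
  proof (cases d)
    case 0
    have "boundary v = (\<lambda>v. 0) v"
    proof (rule linear_eq_on_simplicial_chains[OF linear_boundary _ v])
      show "Vector_Spaces.linear fscale fscale (\<lambda>v. 0)" by unfold_locales simp_all
      show "boundary (single C 1) = 0" if "C \<in> simplices P (int d - 1)" for C
        using simplicesD[OF that] 0 by (simp add: boundary_single)
    qed
    then show ?thesis by simp
  next
    case (Suc m)
    then show ?thesis using bd[of v m] v by simp
  qed
  \<comment> \<open>No chain of the poset has d + 1 elements, so the top homology is the space of
    cycles itself.\<close>
  have "boundaries P (int d - 1) = {0}"
  proof -
    have "C \<notin> simplices P (int d)" for C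
      using dim[of C] simplicesD[of C P "int d"] by force
    then have "simplices P (int d) = {}" by blast
    then have "simplicial_chains P (int d) = {0}" by (auto simp: simplicial_chains_def)
    then show ?thesis by (simp add: boundaries_def)
  qed
  then have "homology_trace P (int d - 1) g = quotient_trace (cycles P (int d - 1)) {0} ?f"
    by (simp add: homology_trace_def)
  also have "\<dots> = coord_trace (X d) (\<lambda>v. ?f (?p v))"
  proof (rule quotient_trace_eq_coord_trace[OF finX])
    fix v assume v: "v \<in> cycles P (int d - 1)"
    show "keys v \<subseteq> X d" using v by (intro keysX) (simp add: cycles_def)
    show "?f v \<in> cycles P (int d - 1)"
      using v f[of v "int d - 1"] fb[of v "int d - 1"] by (auto simp: cycles_def chain_map_def)
    show "?p v = v" using v by (simp add: cycles_def)
  next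
    show "Vector_Spaces.linear fscale fscale ?p"
      by unfold_locales (simp_all add: linear_extension_add linear_extension_fscale boundary_add
          boundary_fscale free_space.scale_right_diff_distrib)
  next
    fix C assume C: "C \<in> X d"
    let ?e = "single C 1"
    from d_cases[OF single[OF C]] show "?p ?e \<in> cycles P (int d - 1)"
    proof
      assume "boundary ?e = 0"
      then show ?thesis using single[OF C] by (simp add: cycles_def)
    next
      assume *: "0 < d \<and> boundary ?e \<in> simplicial_chains P (int (d - 1) - 1)"
      then have "?h (boundary ?e) \<in> simplicial_chains P (int d - 1)"
        using h[of "boundary ?e" "d - 1"] by (auto simp: of_nat_diff)
      moreover have "boundary (?h (boundary ?e)) = boundary ?e"
        using homotopy[of "boundary ?e" "int (d - 1) - 1"] * boundary_boundary[OF single[OF C]]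
        by (auto simp: of_nat_diff)
      ultimately show ?thesis
        using single[OF C] by (simp add: cycles_def boundary_diff simplicial_chains_diff)
    qed
  qed (rule linear_chain_map)
  also have "\<dots> = t d - s d"
    unfolding t_def s_def by (simp add: chain_map_def linear_extension_diff coord_trace_diff)
  also have "\<dots> = (\<Sum>l\<le>d. (-1) ^ (d - l) * t l)"
    by (simp add: sd lessThan_Suc_atMost[symmetric])
  finally show ?thesis by (simp add: t X_def)
qed

section \<open>The Segre square of the Boolean lattice is shellable\<close>

text \<open>A maximal chain of the whole square, indexed by rank. Both ends are forced; the facet of
  the proper part that belongs to it is the image of \<open>{1..<n}\<close>.\<close>

definition segre_flag :: "nat \<Rightarrow> (nat \<Rightarrow> nat set \<times> nat set) \<Rightarrow> bool"
  where "segre_flag n s \<longleftrightarrow>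
    (\<forall>j\<le>n. fst (s j) \<subseteq> {1..n} \<and> snd (s j) \<subseteq> {1..n} \<and> card (fst (s j)) = j \<and> card (snd (s j)) = j)
    \<and> (\<forall>j k. j \<le> k \<longrightarrow> k \<le> n \<longrightarrow> s j \<le> s k)"

definition boolean_square :: "nat \<Rightarrow> (nat set \<times> nat set) set"
  where "boolean_square n = segre_product (Pow {1..n}) card (Pow {1..n}) card"

lemma boolean_square_iff:
  "x \<in> boolean_square n \<longleftrightarrow> fst x \<subseteq> {1..n} \<and> snd x \<subseteq> {1..n} \<and> card (fst x) = card (snd x)"
  by (auto simp: boolean_square_def segre_product_def case_prod_beta)

lemma boolean_square_finite:
  assumes "x \<in> boolean_square n"
  shows "finite (fst x)" "finite (snd x)"
proof -
  have "fst x \<subseteq> {1..n}" "snd x \<subseteq> {1..n}" using assms by (simp_all add: boolean_square_iff)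
  then show "finite (fst x)" "finite (snd x)" by (auto intro: finite_subset)
qed

text \<open>The least element of the square is its only element of rank 0 and the greatest its only
  element of rank n, so the proper part is cut out by the rank.\<close>

lemma boolean_segre_iff:
  "x \<in> boolean_segre n \<longleftrightarrow> fst x \<subseteq> {1..n} \<and> snd x \<subseteq> {1..n} \<and> card (fst x) = card (snd x)
    \<and> 0 < card (fst x) \<and> card (fst x) < n"
proof -
  let ?L = "boolean_square n"
  have bot: "({}, {}) \<in> ?L" and top: "({1..n}, {1..n}) \<in> ?L"
    by (auto simp: boolean_square_iff)
  have min: "(\<forall>q\<in>?L. x \<le> q) \<longleftrightarrow> card (fst x) = 0" if x: "x \<in> ?L"
  proof
    assume "\<forall>q\<in>?L. x \<le> q"
    then have "x \<le> ({}, {})" using bot by blast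
    then show "card (fst x) = 0" by (simp add: less_eq_prod_def)
  next
    assume "card (fst x) = 0"
    moreover have "finite (fst x)" "finite (snd x)"
      using x by (simp_all add: boolean_square_finite)
    ultimately have "x = ({}, {})" using x by (auto simp: boolean_square_iff prod_eq_iff)
    then show "\<forall>q\<in>?L. x \<le> q" by (simp add: less_eq_prod_def)
  qed
  have max: "(\<forall>q\<in>?L. q \<le> x) \<longleftrightarrow> card (fst x) = n" if x: "x \<in> ?L"
  proof
    assume "\<forall>q\<in>?L. q \<le> x"
    then have "({1..n}, {1..n}) \<le> x" using top by blast
    then have "fst x = {1..n}" using x by (auto simp: boolean_square_iff less_eq_prod_def)
    then show "card (fst x) = n" by simp
  next
    assume "card (fst x) = n"
    then have "fst x = {1..n}" "snd x = {1..n}"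
      using x unfolding boolean_square_iff by (simp_all add: card_subset_eq)
    then show "\<forall>q\<in>?L. q \<le> x" by (auto simp: boolean_square_iff less_eq_prod_def)
  qed
  have le: "card (fst x) \<le> n" if "x \<in> ?L"
    using that card_mono[of "{1..n}" "fst x"] by (simp add: boolean_square_iff)
  have segre: "x \<in> boolean_segre n \<longleftrightarrow> x \<in> ?L \<and> \<not> (\<forall>q\<in>?L. x \<le> q) \<and> \<not> (\<forall>q\<in>?L. q \<le> x)"
    unfolding boolean_segre_def boolean_square_def[symmetric] proper_part_def mem_Collect_eq ..
  show ?thesis
  proof (cases "x \<in> ?L")
    case True
    then show ?thesis
      unfolding segre min[OF True] max[OF True] using le[OF True]
      unfolding boolean_square_iff by linarith
  next
    case False
    then show ?thesis unfolding segre unfolding boolean_square_iff by blast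
  qed
qed

lemma finite_boolean_square: "finite (boolean_square n)"
proof (rule finite_subset)
  show "boolean_square n \<subseteq> Pow {1..n} \<times> Pow {1..n}"
  proof
    fix x assume "x \<in> boolean_square n"
    then show "x \<in> Pow {1..n} \<times> Pow {1..n}" by (simp add: boolean_square_iff mem_Times_iff)
  qed
qed simp

lemma finite_boolean_segre: "finite (boolean_segre n)"
proof (rule finite_subset)
  show "boolean_segre n \<subseteq> boolean_square n"
  proof
    fix x assume "x \<in> boolean_segre n"
    then show "x \<in> boolean_square n" by (simp add: boolean_square_iff boolean_segre_iff)
  qed
qed (rule finite_boolean_square)

lemma pair_le_card_imp_eq:
  fixes x y :: "nat set \<times> nat set"
  assumes "x \<le> y" "finite (fst y)" "finite (snd y)"
    "card (fst x) = card (snd x)" "card (fst y) = card (snd y)" "card (fst y) \<le> card (fst x)"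
  shows "x = y"
proof -
  have "fst x = fst y" "snd x = snd y"
    using assms card_seteq[of "fst y" "fst x"] card_seteq[of "snd y" "snd x"]
    by (auto simp: less_eq_prod_def)
  then show ?thesis by (simp add: prod_eq_iff)
qed

section \<open>Flags and the extension of chains to maximal chains\<close>

lemma segre_flag_inj:
  assumes "segre_flag n s"
  shows "inj_on s {..n}"
proof (rule inj_onI)
  fix j k assume "j \<in> {..n}" "k \<in> {..n}" "s j = s k"
  moreover have "card (fst (s i)) = i" if "i \<le> n" for i
    using assms that unfolding segre_flag_def by blast
  ultimately show "j = k" by (metis atMost_iff)
qed

lemma segre_flag_facet:
  assumes "segre_flag n s"
  shows "s ` {1..<n} \<subseteq> boolean_segre n" "order_chain (s ` {1..<n})"
    "card (s ` {1..<n}) = n - 1"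
proof -
  show "s ` {1..<n} \<subseteq> boolean_segre n"
    using assms by (auto simp: segre_flag_def boolean_segre_iff)
  show "order_chain (s ` {1..<n})"
    unfolding Complete_Partial_Order.chain_def
  proof clarsimp
    fix j k assume "j < n" "k < n" "\<not> s k \<le> s j"
    then show "s j \<le> s k" using assms unfolding segre_flag_def by (meson le_cases less_imp_le)
  qed
  have "inj_on s {1..<n}" by (rule inj_on_subset[OF segre_flag_inj[OF assms]]) auto
  then show "card (s ` {1..<n}) = n - 1" by (simp add: card_image)
qed

text \<open>Comparable pairs of equal rank coincide, so inside a chain the rank alone decides the
  order.\<close>

lemma boolean_square_chain_le:
  assumes C: "C \<subseteq> boolean_square n" "order_chain C"
    and xy: "x \<in> C" "y \<in> C" "card (fst x) \<le> card (fst y)"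
  shows "x \<le> y"
proof (rule ccontr)
  assume n: "\<not> x \<le> y"
  then have "y \<le> x" using Complete_Partial_Order.chainD[OF C(2) xy(1,2)] by blast
  moreover have "x \<in> boolean_square n" "y \<in> boolean_square n" using xy C(1) by blast+
  ultimately have "y = x"
    using boolean_square_finite[of x n] xy(3) pair_le_card_imp_eq[of y x] unfolding boolean_square_iff by blast
  then show False using n by simp
qed

text \<open>Induction on the number of missing ranks. As both ends are present, a missing rank r has
  nearest neighbours a below and b above. The two coordinates of a new pair can be chosen
  independently as r-element sets between those of a and b, and every member of the chain lies below
  a or above b.\<close>

lemma segre_chain_extend:
  assumes "C \<subseteq> boolean_square n" "order_chain C"
    "({}, {}) \<in> C" "({1..n}, {1..n}) \<in> C"
  shows "\<exists>C'. C \<subseteq> C' \<and> C' \<subseteq> boolean_square n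
    \<and> order_chain C' \<and> {..n} \<subseteq> (card \<circ> fst) ` C'"
  using assms
proof (induction "card ({..n} - (card \<circ> fst) ` C)" arbitrary: C rule: less_induct)
  case less
  let ?L = "boolean_square n" and ?r = "card \<circ> fst"
  note L = boolean_square_iff
  note finL = boolean_square_finite[where n = n]
  show ?case
  proof (cases "{..n} \<subseteq> ?r ` C")
    case True
    then show ?thesis using less.prems by blast
  next
    case False
    then obtain r where r: "r \<le> n" "r \<notin> ?r ` C" by auto
    have finC: "finite C"
      by (rule finite_subset[OF less.prems(1) finite_boolean_square])
    let ?A = "{x\<in>C. ?r x < r}" and ?B = "{x\<in>C. r < ?r x}"
    have "r \<noteq> 0" "r \<noteq> n" using r less.prems(3,4) by force+
    then have "({}, {}) \<in> ?A" "({1..n}, {1..n}) \<in> ?B" using less.prems r by auto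
    then have ne: "?A \<noteq> {}" "?B \<noteq> {}" by blast+
    have "Max (?r ` ?A) \<in> ?r ` ?A" using ne finC by (intro Max_in) simp_all
    then obtain a where a: "Max (?r ` ?A) = ?r a" "a \<in> ?A" by (rule imageE)
    have "Min (?r ` ?B) \<in> ?r ` ?B" using ne finC by (intro Min_in) simp_all
    then obtain b where b: "Min (?r ` ?B) = ?r b" "b \<in> ?B" by (rule imageE)
    have a_max: "?r x \<le> ?r a" if "x \<in> ?A" for x
      unfolding a(1)[symmetric] using that finC by (intro Max_ge finite_imageI imageI) auto
    have b_min: "?r b \<le> ?r x" if "x \<in> ?B" for x
      unfolding b(1)[symmetric] using that finC by (intro Min_le finite_imageI imageI) auto
    have ab: "a \<in> C" "b \<in> C" "?r a < r" "r < ?r b" using a b by auto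
    have abL: "a \<in> ?L" "b \<in> ?L" using ab less.prems(1) by blast+
    note le = boolean_square_chain_le[OF less.prems(1,2)]
    have "a \<le> b" using le[of a b] ab by simp
    obtain S where S: "fst a \<subseteq> S" "S \<subseteq> fst b" "card S = r"
      using exists_subset_between[of "fst a" r "fst b"] ab \<open>a \<le> b\<close> finL[OF abL(2)]
      by (auto simp: less_eq_prod_def)
    obtain T where T: "snd a \<subseteq> T" "T \<subseteq> snd b" "card T = r"
      using exists_subset_between[of "snd a" r "snd b"] ab \<open>a \<le> b\<close> finL[OF abL(2)] abL
      by (auto simp: less_eq_prod_def L)
    let ?x = "(S, T)" and ?C = "insert (S, T) C"
    have x: "?x \<in> ?L" using S T abL by (auto simp: L)
    have "?x \<le> y \<or> y \<le> ?x" if "y \<in> C" for y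
    proof -
      have "?r y \<noteq> r" using r that by blast
      then consider "?r y < r" | "r < ?r y" by linarith
      then show ?thesis
      proof cases
        case 1
        then have "y \<le> a" using le[OF that ab(1)] a_max[of y] that by auto
        moreover have "a \<le> ?x" using S T by (simp add: less_eq_prod_def)
        ultimately show ?thesis by (meson order_trans)
      next
        case 2
        then have "b \<le> y" using le[OF ab(2) that] b_min[of y] that by auto
        moreover have "?x \<le> b" using S T by (simp add: less_eq_prod_def)
        ultimately show ?thesis by (meson order_trans)
      qed
    qed
    then have ch: "order_chain ?C"
      using less.prems(2) unfolding Complete_Partial_Order.chain_def by auto
    have "{..n} - ?r ` ?C \<subset> {..n} - ?r ` C"
      using r S(3) by auto
    then have "card ({..n} - ?r ` ?C) < card ({..n} - ?r ` C)"
      by (intro psubset_card_mono) auto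
    from less.hyps[OF this _ ch] x less.prems obtain C' where
      "?C \<subseteq> C'" "C' \<subseteq> ?L" "order_chain C'" "{..n} \<subseteq> ?r ` C'"
      by auto
    then show ?thesis by blast
  qed
qed

lemma chain_subset_segre_flag:
  assumes C: "C \<subseteq> boolean_segre n" "order_chain C"
  shows "\<exists>s. segre_flag n s \<and> C \<subseteq> s ` {1..<n}"
proof -
  let ?L = "boolean_square n" and ?r = "card \<circ> fst"
  let ?C = "insert ({}, {}) (insert ({1..n}, {1..n}) C)"
  note L = boolean_square_iff
  have CL: "?C \<subseteq> ?L" using C(1) by (auto simp: L boolean_segre_iff)
  have "({}, {}) \<le> x" "x \<le> ({1..n}, {1..n})" if "x \<in> ?L" for x :: "nat set \<times> nat set"
    using that by (auto simp: L less_eq_prod_def)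
  then have "order_chain ?C"
    using C(2) CL unfolding Complete_Partial_Order.chain_def by blast
  from segre_chain_extend[OF CL this] obtain D where D: "?C \<subseteq> D" "D \<subseteq> ?L"
    "order_chain D" "{..n} \<subseteq> ?r ` D" by blast
  note le = boolean_square_chain_le[OF D(2,3)]
  have "\<forall>j\<in>{..n}. \<exists>x\<in>D. ?r x = j" using D(4) by force
  then obtain s where s: "\<And>j. j \<le> n \<Longrightarrow> s j \<in> D \<and> ?r (s j) = j" by (metis atMost_iff)
  have "segre_flag n s"
    unfolding segre_flag_def
  proof (intro conjI allI impI)
    fix j assume "j \<le> n"
    then have "s j \<in> ?L" "?r (s j) = j" using s D(2) by blast+
    then show "fst (s j) \<subseteq> {1..n}" "snd (s j) \<subseteq> {1..n}" "card (fst (s j)) = j" "card (snd (s j)) = j"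
      by (auto simp: L)
  next
    fix j k assume "j \<le> k" "k \<le> n"
    then show "s j \<le> s k" using s[of j] s[of k] by (intro le) auto
  qed
  moreover have "C \<subseteq> s ` {1..<n}"
  proof
    fix x assume x: "x \<in> C"
    then have r: "0 < ?r x" "?r x < n" "x \<in> D" using C(1) D(1) by (auto simp: boolean_segre_iff)
    have "x \<le> s (?r x)" "s (?r x) \<le> x" using s[of "?r x"] r by (auto intro!: le)
    then have "x = s (?r x)" by simp
    then show "x \<in> s ` {1..<n}" using r by (metis Suc_leI One_nat_def atLeastLessThan_iff imageI)
  qed
  ultimately show ?thesis by blast
qed

text \<open>Between two common members of the flags, \<open>S\<close> adds the elements in increasing order, so
  \<open>S i\<close> consists of the smallest available elements.\<close>

lemma flag_elements_less:
  fixes S U :: "nat \<Rightarrow> nat set"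
  assumes fin: "\<And>j. j \<le> n \<Longrightarrow> finite (S j)"
    and S: "\<And>j. j \<le> n \<Longrightarrow> card (S j) = j" "\<And>j k. j \<le> k \<Longrightarrow> k \<le> n \<Longrightarrow> S j \<subseteq> S k"
    and U: "\<And>j k. j \<le> k \<Longrightarrow> k \<le> n \<Longrightarrow> U j \<subseteq> U k" and top: "S n = U n"
    and asc: "\<And>j x y. 0 < j \<Longrightarrow> j < n \<Longrightarrow> S j \<noteq> U j \<Longrightarrow> x \<in> S j - S (j - 1) \<Longrightarrow> y \<in> S (Suc j) - S j \<Longrightarrow> x < y"
    and i: "i \<le> n" and x: "x \<in> S i - U i" and y: "y \<in> U i - S i"
  shows "x < y"
proof -
  have S0: "S 0 = {}" using S(1)[of 0] fin[of 0] by simp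
  \<comment> \<open>p and q are the steps at which x and y enter \<open>S\<close>. Since x is in
    \<open>S i\<close> and y is not, p is at most i and i is less than q.\<close>
  define p where "p = (LEAST j. x \<in> S j)"
  have p: "x \<in> S p" "p \<le> i" unfolding p_def using x by (auto intro: LeastI Least_le)
  have "p > 0" using p S0 by (metis empty_iff gr0I)
  then have p': "x \<notin> S (p - 1)" unfolding p_def using not_less_Least[of "p - 1" "\<lambda>j. x \<in> S j"] p_def by auto
  have yn: "y \<in> S n" using y U[OF i] top by auto
  define q where "q = (LEAST j. y \<in> S j)"
  have q: "y \<in> S q" "q \<le> n" unfolding q_def using yn by (auto intro: LeastI Least_le)
  have "i < q"
  proof (rule ccontr)
    assume "\<not> i < q"
    then have "S q \<subseteq> S i" using S(2) i by auto
    then show False using q y by auto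
  qed
  have q': "y \<notin> S (q - 1)" unfolding q_def using not_less_Least[of "q - 1" "\<lambda>j. y \<in> S j"] \<open>i < q\<close> q_def by auto
  \<comment> \<open>The flags share no member between the two entries: up to rank i a common member
    would put x into \<open>U i\<close>, and after rank i it would contain y before step q.\<close>
  have ne: "S j \<noteq> U j" if j: "p \<le> j" "j < q" for j
  proof
    assume eq: "S j = U j"
    show False
    proof (cases "j \<le> i")
      case True
      have "x \<in> S j" using p S(2)[of p j] j q by auto
      then show False using eq U[OF True i] x by auto
    next
      case False
      then have "y \<in> S j" using y U[of i j] eq j q by auto
      moreover have "S j \<subseteq> S (q - 1)" using S(2)[of j "q - 1"] j q by auto
      ultimately show False using q' by blast
    qed
  qed
  \<comment> \<open>All ranks from p to q - 1 are therefore ascents of \<open>S\<close>, so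
    everything that enters after x, up to y, exceeds x.\<close>
  have "\<forall>z\<in>S j - S (j - 1). x < z" if "Suc p \<le> j" "j \<le> q" for j
    using that
  proof (induction j rule: dec_induct)
    case base
    then show ?case using asc[of p x] ne[of p] \<open>p > 0\<close> p p' q by auto
  next
    case (step j)
    then have j: "0 < j" "j < n" "j \<le> n" "j - 1 \<le> n" using q by auto
    have "card (S (j - 1)) < card (S j)" using S(1)[OF j(3)] S(1)[OF j(4)] j(1) by simp
    then have "\<not> S j \<subseteq> S (j - 1)"
      using card_mono[OF fin[OF j(4)]] by (meson leD)
    then obtain z' where z': "z' \<in> S j - S (j - 1)" by auto
    have "x < z'" using step z' by auto
    moreover have "z' < z" if "z \<in> S (Suc j) - S j" for z
      using asc[OF j(1,2) _ z' that] ne[of j] step by auto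
    ultimately show ?case by force
  qed
  from this[of q] show ?thesis using q q' p \<open>i < q\<close> by auto
qed

text \<open>The common part cancels. The two differences have the same size and are separated by the
  maximum m of the first: its elements are at most m, those of the second at least m + 1.\<close>

lemma sum_le_of_elements_less:
  fixes A B :: "nat set"
  assumes fin: "finite A" "finite B" and card: "card A = card B"
    and less: "\<And>x y. x \<in> A - B \<Longrightarrow> y \<in> B - A \<Longrightarrow> x < y"
  shows "\<Sum>A \<le> \<Sum>B" "\<Sum>A = \<Sum>B \<Longrightarrow> A = B"
proof -
  have split: "\<Sum>A = \<Sum>(A \<inter> B) + \<Sum>(A - B)" "\<Sum>B = \<Sum>(A \<inter> B) + \<Sum>(B - A)"
    using fin by (metis Int_commute sum.Int_Diff)+
  have cd: "card (A - B) = card (B - A)"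
    using card card_Int_Diff[OF fin(1), of B] card_Int_Diff[OF fin(2), of A] by (simp add: Int_commute)
  have *: "\<Sum>(A - B) < \<Sum>(B - A)" if "A - B \<noteq> {}"
  proof -
    have ne: "B - A \<noteq> {}" using that cd fin by (metis card_0_eq finite_Diff)
    define m where "m = Max (A - B)"
    have m: "m \<in> A - B" "\<And>x. x \<in> A - B \<Longrightarrow> x \<le> m" 
      unfolding m_def using that fin by (auto intro!: Max_in simp del: Diff_iff)
    have "\<Sum>(A - B) \<le> card (A - B) * m" using sum_bounded_above[of "A - B" id m] m(2) by simp
    also have "\<dots> < card (B - A) * Suc m" using cd ne fin by (simp add: card_gt_0_iff)
    also have "\<dots> \<le> \<Sum>(B - A)"
      using sum_bounded_below[of "B - A" "Suc m" id] less[OF m(1)] by (simp add: Suc_le_eq)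
    finally show ?thesis .
  qed
  have sub: "A = B" if "A - B = {}" using that card fin by (metis Diff_eq_empty_iff card_subset_eq)
  show "\<Sum>A \<le> \<Sum>B"
  proof (cases "A - B = {}")
    case False
    then show ?thesis using split *[OF False] by linarith
  qed (use sub in blast)
  show "A = B" if "\<Sum>A = \<Sum>B"
  proof (cases "A - B = {}")
    case False
    then show ?thesis using split *[OF False] that by linarith
  qed (use sub in blast)
qed


section \<open>The shelling condition for the weight of a flag\<close>

definition flag_weight :: "(nat set \<times> nat set) set \<Rightarrow> nat"
  where "flag_weight F = (\<Sum>x\<in>F. \<Sum>(fst x) + \<Sum>(snd x))"

lemma flag_weight_segre_flag:
  assumes "segre_flag n s"
  shows "flag_weight (s ` {1..<n}) = (\<Sum>j\<in>{1..<n}. \<Sum>(fst (s j)) + \<Sum>(snd (s j)))"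
proof -
  have "inj_on s {1..<n}" by (rule inj_on_subset[OF segre_flag_inj[OF assms]]) auto
  then show ?thesis by (simp add: flag_weight_def sum.reindex)
qed

lemma segre_flagD:
  assumes "segre_flag n s" "j \<le> n"
  shows "finite (fst (s j))" "finite (snd (s j))" "card (fst (s j)) = j" "card (snd (s j)) = j"
    "fst (s j) \<subseteq> {1..n}" "snd (s j) \<subseteq> {1..n}"
proof -
  show "fst (s j) \<subseteq> {1..n}" "snd (s j) \<subseteq> {1..n}" "card (fst (s j)) = j" "card (snd (s j)) = j"
    using assms unfolding segre_flag_def by blast+
  then show "finite (fst (s j))" "finite (snd (s j))" by (auto intro: finite_subset)
qed

lemma segre_flag_mono:
  assumes "segre_flag n s" "j \<le> k" "k \<le> n"
  shows "s j \<le> s k" "fst (s j) \<subseteq> fst (s k)" "snd (s j) \<subseteq> snd (s k)"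
  using assms unfolding segre_flag_def less_eq_prod_def by blast+

lemma segre_flag_top:
  assumes "segre_flag n s"
  shows "fst (s n) = {1..n}" "snd (s n) = {1..n}"
  using segre_flagD(3-6)[OF assms order_refl] by (simp_all add: card_subset_eq)

text \<open>A pair of rank j that fits between the two neighbours may replace \<open>s j\<close>
  without disturbing the other members; this supplies the lighter adjacent facet of the shelling
  condition.\<close>

lemma segre_flag_replace:
  assumes s: "segre_flag n s" and j: "0 < j" "j < n"
    and x: "s (j - 1) \<le> x" "x \<le> s (Suc j)" "card (fst x) = j" "card (snd x) = j"
    and less: "\<Sum>(fst x) + \<Sum>(snd x) < \<Sum>(fst (s j)) + \<Sum>(snd (s j))"
  shows "\<exists>t. segre_flag n t \<and> flag_weight (t ` {1..<n}) < flag_weight (s ` {1..<n})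
    \<and> s ` {1..<n} - {s j} \<subseteq> t ` {1..<n}"
proof (intro exI conjI)
  let ?t = "s(j := x)"
  show t: "segre_flag n ?t"
    unfolding segre_flag_def
  proof (intro conjI allI impI)
    fix k assume k: "k \<le> n"
    show "fst (?t k) \<subseteq> {1..n}" "snd (?t k) \<subseteq> {1..n}"
      using segre_flagD(5,6)[OF s k] segre_flagD(5,6)[OF s, of "Suc j"] j x(2)
      by (auto simp: less_eq_prod_def)
    show "card (fst (?t k)) = k" "card (snd (?t k)) = k"
      using segre_flagD(3,4)[OF s k] x by auto
  next
    fix k l assume kl: "k \<le> l" "l \<le> n"
    consider "k = l" | "k \<noteq> j" "l \<noteq> j" | "k = j" "j < l" | "l = j" "k < j" using kl by force
    then show "?t k \<le> ?t l"
    proof cases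
      case 3
      then show ?thesis using order_trans[OF x(2) segre_flag_mono(1)[OF s, of "Suc j" l]] kl by simp
    next
      case 4
      then show ?thesis using order_trans[OF segre_flag_mono(1)[OF s, of k "j - 1"] x(1)] kl j by simp
    qed (use segre_flag_mono(1)[OF s kl] in auto)
  qed
  show "flag_weight (?t ` {1..<n}) < flag_weight (s ` {1..<n})"
    unfolding flag_weight_segre_flag[OF s] flag_weight_segre_flag[OF t]
    using j less by (intro sum_strict_mono_ex1) auto
  show "s ` {1..<n} - {s j} \<subseteq> ?t ` {1..<n}"
  proof
    fix y assume "y \<in> s ` {1..<n} - {s j}"
    then obtain k where k: "k \<in> {1..<n}" "y = s k" "s k \<noteq> s j" by auto
    then have "k \<noteq> j" by auto
    then show "y \<in> ?t ` {1..<n}" using k by (intro image_eqI[of _ _ k]) auto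
  qed
qed

text \<open>At a descent x enters before the smaller y. Exchanging the two entries changes only the
  set of rank j, where x is replaced by y.\<close>

lemma exchange_sum_less:
  fixes S :: "nat \<Rightarrow> nat set"
  assumes "finite (S j)" "card (S j) = j" "S (j - 1) \<subseteq> S j" "S j \<subseteq> S (Suc j)"
    and x: "x \<in> S j - S (j - 1)" and y: "y \<in> S (Suc j) - S j" and "\<not> x < y"
  shows "S (j - 1) \<subseteq> insert y (S j - {x})" "insert y (S j - {x}) \<subseteq> S (Suc j)"
    "card (insert y (S j - {x})) = j" "\<Sum>(insert y (S j - {x})) < \<Sum>(S j)"
proof -
  have "y < x" using x y \<open>\<not> x < y\<close> by (metis Diff_iff nat_neq_iff)
  show "S (j - 1) \<subseteq> insert y (S j - {x})" "insert y (S j - {x}) \<subseteq> S (Suc j)"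
    using assms by auto
  show "card (insert y (S j - {x})) = j"
    using assms by (metis DiffE card_insert_disjoint card_Suc_Diff1 finite_Diff)
  have "\<Sum>(S j) = x + \<Sum>(S j - {x})" using assms by (intro sum.remove) auto
  then show "\<Sum>(insert y (S j - {x})) < \<Sum>(S j)"
    using assms \<open>y < x\<close> by (subst sum.insert) auto
qed

text \<open>If no member of s outside u can be exchanged, then s has no descent, in either
  coordinate, at a rank where it differs from u. Between common members it hence adds elements in
  increasing order and at every rank has the smallest possible sums. As u is not heavier in total,
  the sums agree at every rank, and so do the flags.\<close>

lemma segre_flag_shelling:
  assumes s: "segre_flag n s" and u: "segre_flag n u"
    and ne: "u ` {1..<n} \<noteq> s ` {1..<n}"
    and le: "flag_weight (u ` {1..<n}) \<le> flag_weight (s ` {1..<n})"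
  shows "\<exists>x \<in> s ` {1..<n} - u ` {1..<n}. \<exists>t. segre_flag n t
    \<and> flag_weight (t ` {1..<n}) < flag_weight (s ` {1..<n}) \<and> s ` {1..<n} - {x} \<subseteq> t ` {1..<n}"
proof (rule ccontr)
  assume no: "\<not> ?thesis"
  \<comment> \<open>An exchange that is possible at \<open>s j\<close> forces \<open>s j\<close>
    into the other flag, and there its rank can only be j.\<close>
  have stay: "s j = u j" if j: "0 < j" "j < n"
    and t: "\<exists>t. segre_flag n t \<and> flag_weight (t ` {1..<n}) < flag_weight (s ` {1..<n}) \<and> s ` {1..<n} - {s j} \<subseteq> t ` {1..<n}" for j
  proof -
    have "s j \<in> s ` {1..<n}" using j by auto
    then have "s j \<in> u ` {1..<n}" using no t by blast
    then obtain k where k: "k < n" "s j = u k" by auto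
    then have "k = j" using segre_flagD(3)[OF s, of j] segre_flagD(3)[OF u, of k] j by simp
    then show ?thesis using k by simp
  qed
  have fin: "finite (fst (s j))" "finite (snd (s j))" "finite (fst (u j))" "finite (snd (u j))" if "j \<le> n" for j
    using that s u by (auto intro: segre_flagD)
  have lt1: "x < y" if "i \<le> n" "x \<in> fst (s i) - fst (u i)" "y \<in> fst (u i) - fst (s i)" for i x y
  proof (rule flag_elements_less[where S = "\<lambda>j. fst (s j)" and U = "\<lambda>j. fst (u j)" and n = n and i = i])
    fix j x y assume j: "0 < j" "j < n" "fst (s j) \<noteq> fst (u j)"
      and xy: "x \<in> fst (s j) - fst (s (j - 1))" "y \<in> fst (s (Suc j)) - fst (s j)"
    show "x < y"
    proof (rule ccontr)
      assume "\<not> x < y"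
      note ex = exchange_sum_less[of "\<lambda>j. fst (s j)", OF _ _ _ _ xy this]
      have "s j = u j"
        using j segre_flagD[OF s, of j] segre_flag_mono[OF s, of "j - 1" j]
          segre_flag_mono[OF s, of j "Suc j"] ex
        by (intro stay segre_flag_replace[OF s, where x = "(insert y (fst (s j) - {x}), snd (s j))"])
          (auto simp: less_eq_prod_def)
      then show False using j by simp
    qed
  qed (use that segre_flagD[OF s] segre_flag_mono[OF s] segre_flag_mono[OF u] segre_flag_top[OF s] segre_flag_top[OF u] in auto)
  have lt2: "x < y" if "i \<le> n" "x \<in> snd (s i) - snd (u i)" "y \<in> snd (u i) - snd (s i)" for i x y
  proof (rule flag_elements_less[where S = "\<lambda>j. snd (s j)" and U = "\<lambda>j. snd (u j)" and n = n and i = i])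
    fix j x y assume j: "0 < j" "j < n" "snd (s j) \<noteq> snd (u j)"
      and xy: "x \<in> snd (s j) - snd (s (j - 1))" "y \<in> snd (s (Suc j)) - snd (s j)"
    show "x < y"
    proof (rule ccontr)
      assume "\<not> x < y"
      note ex = exchange_sum_less[of "\<lambda>j. snd (s j)", OF _ _ _ _ xy this]
      have "s j = u j"
        using j segre_flagD[OF s, of j] segre_flag_mono[OF s, of "j - 1" j]
          segre_flag_mono[OF s, of j "Suc j"] ex
        by (intro stay segre_flag_replace[OF s, where x = "(fst (s j), insert y (snd (s j) - {x}))"])
          (auto simp: less_eq_prod_def)
      then show False using j by simp
    qed
  qed (use that segre_flagD[OF s] segre_flag_mono[OF s] segre_flag_mono[OF u] segre_flag_top[OF s] segre_flag_top[OF u] in auto)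
  have card_eq: "card (fst (s j)) = card (fst (u j))" "card (snd (s j)) = card (snd (u j))" if "j \<le> n" for j
    using that segre_flagD(3,4)[OF s] segre_flagD(3,4)[OF u] by auto
  have cmp1: "\<Sum>(fst (s j)) \<le> \<Sum>(fst (u j))" "\<Sum>(fst (s j)) = \<Sum>(fst (u j)) \<Longrightarrow> fst (s j) = fst (u j)"
    and cmp2: "\<Sum>(snd (s j)) \<le> \<Sum>(snd (u j))" "\<Sum>(snd (s j)) = \<Sum>(snd (u j)) \<Longrightarrow> snd (s j) = snd (u j)"
    if j: "j \<le> n" for j
    using sum_le_of_elements_less[of "fst (s j)" "fst (u j)"] lt1[OF j]
      sum_le_of_elements_less[of "snd (s j)" "snd (u j)"] lt2[OF j] fin[OF j] card_eq[OF j]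
    by blast+
  let ?w = "\<lambda>s j. \<Sum>(fst (s j)) + \<Sum>(snd (s j) :: nat set)"
  have wle: "?w s j \<le> ?w u j" if "j \<in> {1..<n}" for j
    using cmp1(1)[of j] cmp2(1)[of j] that by (intro add_mono) auto
  have "(\<Sum>j\<in>{1..<n}. ?w u j) \<le> (\<Sum>j\<in>{1..<n}. ?w s j)"
    using le unfolding flag_weight_segre_flag[OF s] flag_weight_segre_flag[OF u] .
  \<comment> \<open>The inequality at each rank points one way and the inequality of the totals the
    other.\<close>
  then have weq: "?w s j = ?w u j" if "j \<in> {1..<n}" for j
    using sum_mono_inv[of "?w s" "{1..<n}" "?w u" j] wle that sum_mono[of "{1..<n}" "?w s" "?w u"]
    by (simp add: order_antisym)
  have "s j = u j" if "j \<in> {1..<n}" for j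
  proof -
    have j: "j \<le> n" using that by simp
    have "\<Sum>(fst (s j)) = \<Sum>(fst (u j))" "\<Sum>(snd (s j)) = \<Sum>(snd (u j))"
      using cmp1(1)[OF j] cmp2(1)[OF j] weq[OF that] by linarith+
    then show ?thesis using cmp1(2)[of j] cmp2(2)[of j] j by (auto simp: prod_eq_iff)
  qed
  then have "s ` {1..<n} = u ` {1..<n}" by (intro image_cong) auto
  then show False using ne by simp
qed

lemma boolean_segre_acyclic:
  assumes "k + 1 < int (n - 1)" "c \<in> cycles (boolean_segre n) k"
  shows "c \<in> boundaries (boolean_segre n) k"
proof (rule shellable_imp_acyclic[where \<F> = "{s ` {1..<n} | s. segre_flag n s}" and \<phi> = flag_weight])
  show "\<exists>F\<in>{s ` {1..<n} | s. segre_flag n s}. C \<subseteq> F"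
    if "C \<subseteq> boolean_segre n" "order_chain C" for C
    using chain_subset_segre_flag[OF that] by blast
  fix F assume F: "F \<in> {s ` {1..<n} | s. segre_flag n s}"
  then show "F \<subseteq> boolean_segre n \<and> order_chain F \<and> card F = n - 1"
    using segre_flag_facet by auto
  fix G assume "G \<in> {s ` {1..<n} | s. segre_flag n s}" "G \<noteq> F" "flag_weight G \<le> flag_weight F"
  with F obtain s u where su: "F = s ` {1..<n}" "segre_flag n s" "G = u ` {1..<n}" "segre_flag n u" by blast
  show "\<exists>x\<in>F - G. \<exists>H\<in>{s ` {1..<n} | s. segre_flag n s}. flag_weight H < flag_weight F \<and> F - {x} \<subseteq> H"
    using segre_flag_shelling[OF su(2,4)] \<open>G \<noteq> F\<close> \<open>flag_weight G \<le> flag_weight F\<close> unfolding su(1,3) by blast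
qed (use assms finite_boolean_segre in auto)

section \<open>Alternating sums over chains\<close>

text \<open>With the empty chain counted, this is the negative of the reduced Euler characteristic
  of the order complex. By Philip Hall's theorem it is the negative of the Moebius number of
  \<open>Q\<close> with a bottom and a top adjoined.\<close>

definition chain_sum :: "'p :: order set \<Rightarrow> complex"
  where "chain_sum Q = (\<Sum>C | C \<subseteq> Q \<and> order_chain C. (-1) ^ card C)"

lemma finite_chains: "finite Q \<Longrightarrow> finite {C. C \<subseteq> Q \<and> order_chain C}"
  by (rule finite_subset[of _ "Pow Q"]) auto

lemma finite_chain_has_greatest:
  assumes "finite C" "C \<noteq> {}" "order_chain (C :: 'p :: order set)"
  shows "\<exists>x\<in>C. \<forall>y\<in>C. y \<le> x"
  using assms
proof (induction C rule: finite_ne_induct)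
  case (insert x C)
  then obtain z where z: "z \<in> C" "\<forall>y\<in>C. y \<le> z" using chain_subset[of "insert x C" C] by blast
  then have "x \<le> z \<or> z \<le> x" using Complete_Partial_Order.chainD[OF insert.prems, of x z] by simp
  then show ?case
  proof
    assume "x \<le> z"
    then show ?thesis using z by auto
  next
    assume "z \<le> x"
    then have "\<forall>y\<in>insert x C. y \<le> x" using z order_trans by auto
    then show ?thesis by blast
  qed
qed simp

text \<open>Sorting the nonempty chains by their greatest element.\<close>

lemma chain_sum_recursion:
  fixes Q :: "'p :: order set"
  assumes fin: "finite Q"
  shows "chain_sum Q = 1 - (\<Sum>x\<in>Q. chain_sum {y\<in>Q. y < x})"
proof -
  let ?ch = "\<lambda>Q. {C. C \<subseteq> Q \<and> order_chain C}"
  let ?below = "\<lambda>x. {y\<in>Q. y < x}"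
  define top where "top C = (SOME x. x \<in> C \<and> (\<forall>y\<in>C. y \<le> x))" for C :: "'p set"
  have top: "top C \<in> C" "\<forall>y\<in>C. y \<le> top C" if "C \<in> ?ch Q - {{}}" for C
  proof -
    have "\<exists>x\<in>C. \<forall>y\<in>C. y \<le> x"
      using that fin by (intro finite_chain_has_greatest) (auto intro: finite_subset)
    then have "\<exists>x. x \<in> C \<and> (\<forall>y\<in>C. y \<le> x)" by blast
    from someI_ex[OF this] show "top C \<in> C" "\<forall>y\<in>C. y \<le> top C" unfolding top_def by blast+
  qed
  have top_insert: "top (insert x C) = x" if "\<forall>y\<in>C. y < x" for x C
    unfolding top_def
  proof (rule some_equality)
    show "x \<in> insert x C \<and> (\<forall>y\<in>insert x C. y \<le> x)" using that by auto
    show "z = x" if "z \<in> insert x C \<and> (\<forall>y\<in>insert x C. y \<le> z)" for z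
      using that \<open>\<forall>y\<in>C. y < x\<close> by (meson insert_iff leD)
  qed
  have "(\<Sum>x\<in>Q. chain_sum (?below x)) = (\<Sum>(x, C)\<in>Sigma Q (\<lambda>x. ?ch (?below x)). (-1) ^ card C)"
    unfolding chain_sum_def using fin finite_chains by (intro sum.Sigma) auto
  also have "\<dots> = (\<Sum>C\<in>?ch Q - {{}}. - ((-1) ^ card C))"
  proof (rule sum.reindex_bij_witness[where i = "\<lambda>C. (top C, C - {top C})" and j = "\<lambda>(x, C). insert x C"])
    fix C assume C: "C \<in> ?ch Q - {{}}"
    note t = top[OF C]
    show "(case (top C, C - {top C}) of (x, C) \<Rightarrow> insert x C) = C" using t by auto
    have "\<forall>y\<in>C - {top C}. y < top C" using t by (auto simp: order_less_le)
    then show "(top C, C - {top C}) \<in> Sigma Q (\<lambda>x. ?ch (?below x))"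
      using C t chain_subset[of C "C - {top C}"] by auto
  next
    fix p assume "p \<in> Sigma Q (\<lambda>x. ?ch (?below x))"
    then obtain x C where p: "p = (x, C)" "x \<in> Q" "C \<subseteq> ?below x" "order_chain C" by auto
    have lt: "\<forall>y\<in>C. y < x" using p by auto
    then have x: "x \<notin> C" by auto
    have f: "finite C" using p fin by (auto intro: finite_subset)
    show "(top (case p of (x, C) \<Rightarrow> insert x C), (case p of (x, C) \<Rightarrow> insert x C) - {top (case p of (x, C) \<Rightarrow> insert x C)}) = p"
      using top_insert[OF lt] x p by auto
    have "order_chain (insert x C)"
      using p(4) lt unfolding Complete_Partial_Order.chain_def by (auto simp: order_less_le)
    then show "(case p of (x, C) \<Rightarrow> insert x C) \<in> ?ch Q - {{}}" using p by auto
    show "- ((- 1) ^ card (case p of (x, C) \<Rightarrow> insert x C) :: complex) = (case p of (x, C) \<Rightarrow> (- 1) ^ card C)"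
      using p x f by simp
  qed
  also have "\<dots> = - (chain_sum Q - 1)"
  proof -
    have "{} \<in> ?ch Q" by (simp add: Complete_Partial_Order.chain_def)
    from sum.remove[OF finite_chains[OF fin] this, of "\<lambda>C. (- 1) ^ card C :: complex"]
    show ?thesis by (simp add: chain_sum_def sum_negf)
  qed
  finally show ?thesis by simp
qed

lemma chain_sum_order_embedding:
  fixes Q :: "'p :: order set" and g :: "'p \<Rightarrow> 'q :: order"
  assumes g: "\<forall>x\<in>Q. \<forall>y\<in>Q. g x \<le> g y \<longleftrightarrow> x \<le> y"
  shows "chain_sum (g ` Q) = chain_sum Q"
proof -
  have inj: "inj_on g Q" using g by (intro inj_onI) (metis order_antisym order_refl)
  have ch: "order_chain (g ` C) \<longleftrightarrow> order_chain C" if "C \<subseteq> Q" for C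
    using g that unfolding Complete_Partial_Order.chain_def by blast
  have "chain_sum Q = (\<Sum>C\<in>{C. C \<subseteq> Q \<and> order_chain C}. (-1) ^ card (g ` C))"
    unfolding chain_sum_def
    by (intro sum.cong refl) (auto simp: card_image inj_on_subset[OF inj])
  also have "\<dots> = chain_sum (g ` Q)"
    unfolding chain_sum_def
  proof (rule sum.reindex_bij_betw)
    have "inj_on ((`) g) (Pow Q)" using inj by (rule inj_on_image_Pow)
    moreover have "(`) g ` {C. C \<subseteq> Q \<and> order_chain C}
        = {C. C \<subseteq> g ` Q \<and> order_chain C}"
    proof (intro set_eqI iffI)
      fix D assume "D \<in> {C. C \<subseteq> g ` Q \<and> order_chain C}"
      then obtain C where "C \<subseteq> Q" "D = g ` C" "order_chain D"
        by (auto simp: subset_image_iff)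
      then show "D \<in> (`) g ` {C. C \<subseteq> Q \<and> order_chain C}" using ch by blast
    next
      fix D assume "D \<in> (`) g ` {C. C \<subseteq> Q \<and> order_chain C}"
      then show "D \<in> {C. C \<subseteq> g ` Q \<and> order_chain C}" using ch by blast
    qed
    ultimately show "bij_betw ((`) g) {C. C \<subseteq> Q \<and> order_chain C}
        {C. C \<subseteq> g ` Q \<and> order_chain C}"
      unfolding bij_betw_def by (auto elim!: inj_on_subset)
  qed
  finally show ?thesis by simp
qed

section \<open>The Moebius function of the poset of fixed pairs\<close>

definition fixed_pairs :: "('a \<Rightarrow> 'a) \<Rightarrow> ('b \<Rightarrow> 'b) \<Rightarrow> 'a set \<Rightarrow> 'b set \<Rightarrow> ('a set \<times> 'b set) set"
  where "fixed_pairs \<sigma> \<tau> S T =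
    {(A, B). A \<subseteq> S \<and> B \<subseteq> T \<and> card A = card B \<and> \<sigma> ` A = A \<and> \<tau> ` B = B}"

definition proper_fixed_pairs :: "('a \<Rightarrow> 'a) \<Rightarrow> ('b \<Rightarrow> 'b) \<Rightarrow> 'a set \<Rightarrow> 'b set \<Rightarrow> ('a set \<times> 'b set) set"
  where "proper_fixed_pairs \<sigma> \<tau> S T =
    {(A, B) \<in> fixed_pairs \<sigma> \<tau> S T. 0 < card A \<and> card A < card S}"

text \<open>By Hall's theorem this is the Moebius function from the bottom to (S, T), for S and T of
  equal size. For empty S bottom and top coincide and the value is 1, whereas the chain formula
  would give -1. Arbitrary sets are allowed, because every pair of subsets takes its turn as the
  top.\<close>

definition fixed_moebius :: "('a \<Rightarrow> 'a) \<Rightarrow> ('b \<Rightarrow> 'b) \<Rightarrow> 'a set \<Rightarrow> 'b set \<Rightarrow> complex"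
  where "fixed_moebius \<sigma> \<tau> S T =
    (if S = {} then 1 else - chain_sum (proper_fixed_pairs \<sigma> \<tau> S T))"

lemma finite_fixed_pairs: "finite S \<Longrightarrow> finite T \<Longrightarrow> finite (fixed_pairs \<sigma> \<tau> S T)"
  by (rule finite_subset[of _ "Pow S \<times> Pow T"]) (auto simp: fixed_pairs_def)

text \<open>A smaller pair of equal-sized sets has strictly smaller rank, so lower intervals are
  again posets of proper fixed pairs, and the chain sums below a pair are Moebius values.\<close>

lemma proper_fixed_pairs_below:
  assumes "finite S" "finite T" "(A, B) \<in> proper_fixed_pairs \<sigma> \<tau> S T"
  shows "{y \<in> proper_fixed_pairs \<sigma> \<tau> S T. y < (A, B)} = proper_fixed_pairs \<sigma> \<tau> A B"
proof -
  have AB: "A \<subseteq> S" "B \<subseteq> T" "card A = card B" "card A < card S" "finite A" "finite B"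
    using assms finite_subset by (auto simp: proper_fixed_pairs_def fixed_pairs_def)
  show ?thesis
  proof (intro set_eqI iffI)
    fix x assume x: "x \<in> {y \<in> proper_fixed_pairs \<sigma> \<tau> S T. y < (A, B)}"
    obtain C D where CD: "x = (C, D)" by force
    have le: "C \<subseteq> A" "D \<subseteq> B" and ne: "C \<noteq> A \<or> D \<noteq> B"
      using x CD by (auto simp: less_le_not_le less_eq_prod_def)
    have eq: "card C = card D" using x CD by (auto simp: proper_fixed_pairs_def fixed_pairs_def)
    have "card C < card A"
    proof (rule ccontr)
      assume "\<not> card C < card A"
      then have "C = A" "D = B"
        using AB eq le card_seteq[of A C] card_seteq[of B D] by auto
      then show False using ne by simp
    qed
    then show "x \<in> proper_fixed_pairs \<sigma> \<tau> A B"
      using x CD le by (simp add: proper_fixed_pairs_def fixed_pairs_def)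
  next
    fix x assume x: "x \<in> proper_fixed_pairs \<sigma> \<tau> A B"
    obtain C D where CD: "x = (C, D)" by force
    have sub: "C \<subseteq> A" "D \<subseteq> B" "card C < card A"
      using x CD by (auto simp: proper_fixed_pairs_def fixed_pairs_def)
    then have "C \<noteq> A" by auto
    then have "x < (A, B)" using sub CD by (auto simp: less_le_not_le less_eq_prod_def)
    moreover have "x \<in> proper_fixed_pairs \<sigma> \<tau> S T"
      using x CD AB sub by (simp add: proper_fixed_pairs_def fixed_pairs_def subset_trans[OF sub(1)] subset_trans[OF sub(2)])
    ultimately show "x \<in> {y \<in> proper_fixed_pairs \<sigma> \<tau> S T. y < (A, B)}" by simp
  qed
qed

text \<open>This is the recurrence that defines a Moebius function, obtained from the recursion for
  chain sums. Nonempty S makes bottom and top distinct summands.\<close>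

lemma sum_fixed_moebius:
  assumes S: "finite S" "S \<noteq> {}" "\<sigma> ` S = S" and T: "finite T" "\<tau> ` T = T" and card: "card S = card T"
  shows "(\<Sum>(A, B)\<in>fixed_pairs \<sigma> \<tau> S T. fixed_moebius \<sigma> \<tau> A B) = 0"
proof -
  let ?Q = "proper_fixed_pairs \<sigma> \<tau> S T"
  have finQ: "finite ?Q"
    by (rule finite_subset[OF _ finite_fixed_pairs[OF S(1) T(1)]]) (auto simp: proper_fixed_pairs_def)
  have pairs: "fixed_pairs \<sigma> \<tau> S T = insert ({}, {}) (insert (S, T) ?Q)"
  proof (intro set_eqI iffI)
    fix p assume p: "p \<in> fixed_pairs \<sigma> \<tau> S T"
    obtain A B where AB: "p = (A, B)" "A \<subseteq> S" "B \<subseteq> T" "card A = card B"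
      using p by (auto simp: fixed_pairs_def)
    have f: "finite A" "finite B" using AB S(1) T(1) by (auto intro: finite_subset)
    consider "card A = 0" | "card A = card S" | "0 < card A" "card A < card S"
      using card_mono[OF S(1) AB(2)] by linarith
    then show "p \<in> insert ({}, {}) (insert (S, T) ?Q)"
    proof cases
      case 1
      then show ?thesis using AB f by simp
    next
      case 2
      then have "A = S" "B = T"
        using card_subset_eq[OF S(1) AB(2)] card_subset_eq[OF T(1) AB(3)] AB(4) card by simp_all
      then show ?thesis using AB by simp
    next
      case 3
      then show ?thesis using AB p by (simp add: proper_fixed_pairs_def)
    qed
  qed (use S T card in \<open>auto simp: fixed_pairs_def proper_fixed_pairs_def\<close>)
  have "(\<Sum>p\<in>?Q. chain_sum {y \<in> ?Q. y < p}) = (\<Sum>(A, B)\<in>?Q. - fixed_moebius \<sigma> \<tau> A B)"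
  proof (intro sum.cong refl)
    fix p assume p: "p \<in> ?Q"
    obtain A B where AB: "p = (A, B)" by force
    then have "A \<noteq> {}" using p by (auto simp: proper_fixed_pairs_def)
    then show "chain_sum {y \<in> ?Q. y < p} = (case p of (A, B) \<Rightarrow> - fixed_moebius \<sigma> \<tau> A B)"
      using proper_fixed_pairs_below[OF S(1) T(1), of A B] p AB by (simp add: fixed_moebius_def)
  qed
  then have "fixed_moebius \<sigma> \<tau> S T = - 1 - (\<Sum>(A, B)\<in>?Q. fixed_moebius \<sigma> \<tau> A B)"
    using S(2) chain_sum_recursion[OF finQ] by (simp add: fixed_moebius_def[of _ _ S] sum_negf case_prod_beta)
  moreover have "({}, {}) \<notin> insert (S, T) ?Q" "(S, T) \<notin> ?Q"
    using S by (auto simp: proper_fixed_pairs_def)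
  ultimately show ?thesis
    unfolding pairs using finQ by (simp add: fixed_moebius_def[of _ _ "{}"])
qed

text \<open>Relabelling by p and q is an isomorphism of the posets of fixed pairs. Bijections give
  invariance under conjugation and transport between index sets; with identities it says that only
  the restrictions of the maps to S and T matter.\<close>

lemma fixed_moebius_conjugate:
  assumes p: "inj_on p S" "\<sigma> ` S \<subseteq> S" "\<forall>x\<in>S. \<sigma>' (p x) = p (\<sigma> x)"
    and q: "inj_on q T" "\<tau> ` T \<subseteq> T" "\<forall>x\<in>T. \<tau>' (q x) = q (\<tau> x)"
  shows "fixed_moebius \<sigma>' \<tau>' (p ` S) (q ` T) = fixed_moebius \<sigma> \<tau> S T"
proof -
  let ?g = "\<lambda>(A, B). (p ` A, q ` B)"
  have fp: "\<sigma>' ` p ` A = p ` A \<longleftrightarrow> \<sigma> ` A = A" if "A \<subseteq> S" for A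
  proof -
    have "\<sigma>' ` p ` A = p ` \<sigma> ` A" using p(3) that by (force simp: image_iff)
    moreover have "\<sigma> ` A \<subseteq> S" using p(2) that by blast
    ultimately show ?thesis using inj_on_image_eq_iff[OF p(1), of "\<sigma> ` A" A] that by simp
  qed
  have fq: "\<tau>' ` q ` A = q ` A \<longleftrightarrow> \<tau> ` A = A" if "A \<subseteq> T" for A
  proof -
    have "\<tau>' ` q ` A = q ` \<tau> ` A" using q(3) that by (force simp: image_iff)
    moreover have "\<tau> ` A \<subseteq> T" using q(2) that by blast
    ultimately show ?thesis using inj_on_image_eq_iff[OF q(1), of "\<tau> ` A" A] that by simp
  qed
  have cp: "card (p ` A) = card A" if "A \<subseteq> S" for A using that p(1) by (meson card_image inj_on_subset)
  have cq: "card (q ` A) = card A" if "A \<subseteq> T" for A using that q(1) by (meson card_image inj_on_subset)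
  have sp: "p ` A \<subseteq> p ` B \<longleftrightarrow> A \<subseteq> B" if "A \<subseteq> S" "B \<subseteq> S" for A B
    using that inj_onD[OF p(1)] by blast
  have sq: "q ` A \<subseteq> q ` B \<longleftrightarrow> A \<subseteq> B" if "A \<subseteq> T" "B \<subseteq> T" for A B
    using that inj_onD[OF q(1)] by blast
  have img: "?g ` proper_fixed_pairs \<sigma> \<tau> S T = proper_fixed_pairs \<sigma>' \<tau>' (p ` S) (q ` T)"
  proof (intro set_eqI iffI)
    fix x assume "x \<in> ?g ` proper_fixed_pairs \<sigma> \<tau> S T"
    then obtain A B where x: "x = (p ` A, q ` B)" and AB: "(A, B) \<in> proper_fixed_pairs \<sigma> \<tau> S T" by auto
    then have "A \<subseteq> S" "B \<subseteq> T" by (auto simp: proper_fixed_pairs_def fixed_pairs_def)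
    then show "x \<in> proper_fixed_pairs \<sigma>' \<tau>' (p ` S) (q ` T)"
      using AB x by (simp add: proper_fixed_pairs_def fixed_pairs_def fp fq cp cq image_mono)
  next
    fix x assume x: "x \<in> proper_fixed_pairs \<sigma>' \<tau>' (p ` S) (q ` T)"
    then obtain A B where AB: "x = ?g (A, B)" "A \<subseteq> S" "B \<subseteq> T"
      by (auto simp: proper_fixed_pairs_def fixed_pairs_def subset_image_iff)
    have "(A, B) \<in> proper_fixed_pairs \<sigma> \<tau> S T"
      using x AB by (simp add: proper_fixed_pairs_def fixed_pairs_def fp fq cp cq)
    then show "x \<in> ?g ` proper_fixed_pairs \<sigma> \<tau> S T" using AB(1) by (rule rev_image_eqI)
  qed
  have "chain_sum (?g ` proper_fixed_pairs \<sigma> \<tau> S T) = chain_sum (proper_fixed_pairs \<sigma> \<tau> S T)"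
  proof (rule chain_sum_order_embedding, intro ballI)
    fix x y assume "x \<in> proper_fixed_pairs \<sigma> \<tau> S T" "y \<in> proper_fixed_pairs \<sigma> \<tau> S T"
    then show "?g x \<le> ?g y \<longleftrightarrow> x \<le> y"
      by (cases x; cases y) (simp add: proper_fixed_pairs_def fixed_pairs_def less_eq_prod_def sp sq)
  qed
  then show ?thesis by (simp add: fixed_moebius_def img)
qed

text \<open>The Hopf trace formula counts chains that are invariant as sets. Rank preservation makes
  their members fixed, so these are precisely the chains of proper fixed pairs.\<close>

lemma top_homology_character_eq_moebius:
  assumes \<sigma>: "\<sigma> permutes {1..n}" and \<tau>: "\<tau> permutes {1..n}"
  shows "top_homology_character n \<sigma> \<tau> = (-1) ^ n * fixed_moebius \<sigma> \<tau> {1..n} {1..n}"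
proof (cases "n = 0")
  case True
  then show ?thesis by (simp add: top_homology_character_def fixed_moebius_def)
next
  case False
  let ?P = "boolean_segre n" and ?g = "perm_pair_action \<sigma> \<tau>"
  have inj: "inj \<sigma>" "inj \<tau>" using \<sigma> \<tau> by (auto intro: permutes_inj)
  have g_le: "\<forall>x\<in>?P. \<forall>y\<in>?P. ?g x \<le> ?g y \<longleftrightarrow> x \<le> y"
    by (auto simp: perm_pair_action_def case_prod_beta less_eq_prod_def inj_image_subset_iff inj)
  have g_im: "?g ` ?P \<subseteq> ?P"
  proof
    fix y assume "y \<in> ?g ` ?P"
    then obtain A B where y: "y = (\<sigma> ` A, \<tau> ` B)" and AB: "(A, B) \<in> ?P"
      by (auto simp: perm_pair_action_def)
    have "\<sigma> ` A \<subseteq> {1..n}" "\<tau> ` B \<subseteq> {1..n}"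
      using AB image_mono[of A "{1..n}" \<sigma>] image_mono[of B "{1..n}" \<tau>]
      unfolding boolean_segre_iff permutes_image[OF \<sigma>] permutes_image[OF \<tau>] by simp_all
    then show "y \<in> ?P" using AB y inj by (simp add: boolean_segre_iff card_image inj_on_subset)
  qed
  have dim: "card C \<le> n - 1" if C: "C \<subseteq> ?P" "order_chain C" for C
  proof -
    obtain s where s: "segre_flag n s" "C \<subseteq> s ` {1..<n}" using chain_subset_segre_flag[OF C] by blast
    then show ?thesis using card_mono[OF _ s(2)] segre_flag_facet(3)[OF s(1)] by simp
  qed
  let ?F = "{C. C \<subseteq> ?P \<and> order_chain C \<and> ?g ` C = C}"
  have F: "?F = {C. C \<subseteq> proper_fixed_pairs \<sigma> \<tau> {1..n} {1..n} \<and> order_chain C}"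
  proof (intro set_eqI iffI)
    fix C assume "C \<in> ?F"
    then have C: "C \<subseteq> ?P" "order_chain C" "?g ` C = C" by auto
    have "x \<in> proper_fixed_pairs \<sigma> \<tau> {1..n} {1..n}" if x: "x \<in> C" for x
    proof -
      have gx: "?g x \<in> C" using C(3) x by blast
      have c: "card (fst (?g x)) = card (fst x)"
        using inj by (simp add: perm_pair_action_def case_prod_beta card_image inj_on_subset)
      have sq: "C \<subseteq> boolean_square n" using C(1) by (auto simp: boolean_segre_iff boolean_square_iff)
      \<comment> \<open>x and its image belong to the same chain and have the same rank.\<close>
      have "?g x \<le> x" "x \<le> ?g x" using boolean_square_chain_le[OF sq C(2)] gx x c by auto
      then have "?g x = x" by simp
      moreover have "x \<in> ?P" using C x by blast
      ultimately show ?thesis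
        by (cases x) (auto simp: proper_fixed_pairs_def fixed_pairs_def boolean_segre_iff perm_pair_action_def)
    qed
    then show "C \<in> {C. C \<subseteq> proper_fixed_pairs \<sigma> \<tau> {1..n} {1..n} \<and> order_chain C}"
      using C by auto
  next
    fix C assume C: "C \<in> {C. C \<subseteq> proper_fixed_pairs \<sigma> \<tau> {1..n} {1..n} \<and> order_chain C}"
    have "x \<in> ?P \<and> ?g x = x" if "x \<in> C" for x
    proof -
      have "x \<in> proper_fixed_pairs \<sigma> \<tau> {1..n} {1..n}" using C that by blast
      then show ?thesis
        by (cases x) (simp add: proper_fixed_pairs_def fixed_pairs_def boolean_segre_iff perm_pair_action_def)
    qed
    then have "C \<subseteq> ?P" "?g ` C = C" by force+
    then show "C \<in> ?F" using C by simp
  qed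
  have finF: "finite ?F" by (rule finite_subset[of _ "Pow ?P"]) (auto simp: finite_boolean_segre)
  \<comment> \<open>Facets have d = n - 1 elements, so n - 2 is the top degree d - 1.\<close>
  have "top_homology_character n \<sigma> \<tau> = homology_trace ?P (int (n - 1) - 1) ?g"
    using False by (simp add: top_homology_character_def of_nat_diff)
  also have "\<dots> = (\<Sum>l\<le>n - 1. (-1) ^ (n - 1 - l) * of_nat (card {C \<in> simplices ?P (int l - 1). ?g ` C = C}))"
    by (rule hopf_trace_top_degree[OF finite_boolean_segre boolean_segre_acyclic dim g_le g_im])
  also have "\<dots> = (\<Sum>l\<le>n - 1. \<Sum>C | C \<in> ?F \<and> card C = l. (-1) ^ (n - 1 - card C))"
  proof (rule sum.cong[OF refl])
    fix l
    have "{C \<in> simplices ?P (int l - 1). ?g ` C = C} = {C. C \<in> ?F \<and> card C = l}"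
      using finite_subset[OF _ finite_boolean_segre[of n]] by (auto simp: simplices_def)
    then show "(-1) ^ (n - 1 - l) * of_nat (card {C \<in> simplices ?P (int l - 1). ?g ` C = C})
        = (\<Sum>C | C \<in> ?F \<and> card C = l. (-1) ^ (n - 1 - card C) :: complex)" by simp
  qed
  also have "\<dots> = (\<Sum>C\<in>?F. (-1) ^ (n - 1 - card C))"
    using dim finF by (subst sum.group[of ?F "{..n - 1}" card, symmetric]) (auto intro!: sum.cong)
  also have "\<dots> = (\<Sum>C\<in>?F. (-1) ^ (n - 1) * (-1) ^ card C)"
  proof (rule sum.cong[OF refl])
    fix C assume "C \<in> ?F"
    then have "card C \<le> n - 1" using dim by blast
    then obtain m where "n - 1 = card C + m" using le_Suc_ex by blast
    then show "(-1) ^ (n - 1 - card C) = (-1) ^ (n - 1) * (-1 :: complex) ^ card C"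
      by (simp add: power_add mult.commute)
  qed
  also have "\<dots> = (-1) ^ (n - 1) * chain_sum (proper_fixed_pairs \<sigma> \<tau> {1..n} {1..n})"
    by (simp add: chain_sum_def F sum_distrib_left)
  \<comment> \<open>The minus sign in the Moebius value accounts for the shift from n - 1 to
    n.\<close>
  also have "\<dots> = (-1) ^ n * fixed_moebius \<sigma> \<tau> {1..n} {1..n}"
    using False by (cases n) (auto simp: fixed_moebius_def)
  finally show ?thesis .
qed

section \<open>Complete homogeneous symmetric functions as averages over permutations\<close>

lemma mcoeff_sum: "mcoeff (\<Sum>i\<in>I. f i) m = (\<Sum>i\<in>I. mcoeff (f i) m)"
  by (induction I rule: infinite_finite_induct) (simp_all add: zero_mpowser.rep_eq plus_mpowser.rep_eq)

lemma mcoeff_mconst_times: "mcoeff (mconst c * f) m = c * mcoeff f m"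
proof -
  have "mcoeff (mconst c * f) m
      = (\<Sum>p\<in>{(a, b). a + b = m}. if p = (0, m) then c * mcoeff f m else 0)"
    unfolding times_mpowser.rep_eq mconst.rep_eq by (rule sum.cong) (auto split: if_splits)
  also have "\<dots> = c * mcoeff f m"
    using finite_monomial_splits[of m] by (subst sum.delta) auto
  finally show ?thesis .
qed

lemma mconst_mult: "mconst (c * d) = mconst c * mconst d"
  by (rule mpowser_eqI) (simp add: mcoeff_mconst_times mconst.rep_eq)

lemma mconst_1 [simp]: "mconst 1 = 1"
  by (rule mpowser_eqI) (simp add: mconst.rep_eq one_mpowser.rep_eq)

lemma mconst_sum: "mconst (\<Sum>i\<in>I. c i) = (\<Sum>i\<in>I. mconst (c i :: 'a :: comm_ring_1))"
  by (rule mpowser_eqI) (simp add: mcoeff_sum mconst.rep_eq)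

lemma mconst_of_nat: "(mconst (of_nat n) :: ('v, 'a :: comm_ring_1) mpowser) = of_nat n"
proof (induction n)
  case 0
  show ?case by (rule mpowser_eqI) (simp add: mconst.rep_eq zero_mpowser.rep_eq)
next
  case (Suc n)
  have "(mconst (of_nat (Suc n)) :: ('v, 'a) mpowser) = 1 + mconst (of_nat n)"
    by (rule mpowser_eqI) (simp add: mconst.rep_eq plus_mpowser.rep_eq one_mpowser.rep_eq)
  then show ?case using Suc by simp
qed

lemma mcoeff_of_nat_times: "mcoeff (of_nat n * f) m = of_nat n * mcoeff f m"
  by (simp add: mcoeff_mconst_times flip: mconst_of_nat)

lemma mconst_uminus: "mconst (- c) = - mconst (c :: 'a :: comm_ring_1)"
  by (rule mpowser_eqI) (simp add: mconst.rep_eq uminus_mpowser.rep_eq)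

lemma mconst_power: "mconst (c ^ n) = mconst (c :: 'a :: comm_ring_1) ^ n"
  by (induction n) (simp_all add: mconst_mult)

text \<open>For k > 0 and injective x the monomials \<open>single (x i) k\<close> are pairwise
  distinct, so each index i whose monomial divides m contributes exactly one splitting of m.\<close>

lemma mcoeff_power_sum_times:
  fixes f :: "('v, 'a :: comm_ring_1) mpowser"
  assumes x: "inj x" and k: "0 < k"
  shows "mcoeff (power_sum x k * f) m
    = (\<Sum>i | \<exists>b. single (x i) k + b = m. mcoeff f (m - single (x i) k))"
proof -
  let ?s = "\<lambda>i. single (x i) k"
  have inj: "i = j" if "?s i = ?s j" for i j
    using that k x by (metis injD lookup_single_eq lookup_single_not_eq less_irrefl)
  have the: "(THE j. ?s i = ?s j) = i" for i
    using inj by (intro the_equality) auto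
  have "mcoeff (power_sum x k * f) m
      = (\<Sum>(a, b)\<in>{(a, b). a + b = m}. if \<exists>i. a = ?s i then mcoeff f b else 0)"
    unfolding times_mpowser.rep_eq power_sum.rep_eq by (intro sum.cong refl) auto
  also have "\<dots> = (\<Sum>(a, b)\<in>{(a, b). a + b = m \<and> (\<exists>i. a = ?s i)}. mcoeff f b)"
    using finite_monomial_splits[of m] by (intro sum.mono_neutral_cong_right) (auto split: if_splits)
  also have "\<dots> = (\<Sum>i | \<exists>b. ?s i + b = m. mcoeff f (m - ?s i))"
    by (rule sum.reindex_bij_witness[where i = "\<lambda>i. (?s i, m - ?s i)" and j = "\<lambda>(a, b). THE i. a = ?s i"])
      (auto simp: the)
  finally show ?thesis .
qed

lemma finite_power_sum_indices:
  fixes k :: nat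
  assumes "inj x" "0 < k"
  shows "finite {i. \<exists>b. single (x i) k + b = m}"
proof (rule finite_subset)
  show "{i. \<exists>b. single (x i) k + b = m} \<subseteq> x -` keys m"
    using assms(2) by (auto simp: in_keys_iff lookup_add)
  show "finite (x -` keys m)"
    by (intro finite_vimageI assms finite_keys)
qed

section \<open>Words and their contents\<close>

definition word_content :: "(nat \<Rightarrow> 'v) \<Rightarrow> 'b set \<Rightarrow> ('b \<Rightarrow> nat) \<Rightarrow> ('v \<Rightarrow>\<^sub>0 nat)"
  where "word_content x A w = (\<Sum>a\<in>A. single (x (w a)) 1)"

text \<open>A word picks a variable for every element of A. Words are undefined outside A, so that
  they can be counted.\<close>

definition words :: "(nat \<Rightarrow> 'v) \<Rightarrow> 'b set \<Rightarrow> ('v \<Rightarrow>\<^sub>0 nat) \<Rightarrow> ('b \<Rightarrow> nat) set"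
  where "words x A m = {w \<in> A \<rightarrow>\<^sub>E UNIV. word_content x A w = m}"

lemma word_content_cong: "(\<And>a. a \<in> A \<Longrightarrow> w a = w' a) \<Longrightarrow> word_content x A w = word_content x A w'"
  by (simp add: word_content_def)

lemma finite_words:
  assumes "inj x" "finite A"
  shows "finite (words x A m)"
proof (rule finite_subset)
  show "words x A m \<subseteq> A \<rightarrow>\<^sub>E (x -` keys m)"
  proof
    fix w assume w: "w \<in> words x A m"
    have "x (w a) \<in> keys m" if "a \<in> A" for a
    proof -
      have "lookup m (x (w a)) = (\<Sum>b\<in>A. lookup (single (x (w b)) 1) (x (w a)))"
        using w by (auto simp: words_def word_content_def lookup_sum)
      also have "\<dots> \<ge> lookup (single (x (w a)) 1) (x (w a))"
        using that assms(2) by (intro member_le_sum) auto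
      finally show ?thesis by (simp add: in_keys_iff)
    qed
    then show "w \<in> A \<rightarrow>\<^sub>E (x -` keys m)" using w by (auto simp: words_def PiE_iff)
  qed
  show "finite (A \<rightarrow>\<^sub>E (x -` keys m))"
    using assms by (intro finite_PiE finite_vimageI) auto
qed

lemma sum_single_const: "(\<Sum>a\<in>A. single v (1 :: nat)) = single v (card A)"
  by (induction A rule: infinite_finite_induct) (simp_all flip: single_add)

definition const_on :: "('a \<Rightarrow> 'c) \<Rightarrow> 'a set \<Rightarrow> bool"
  where "const_on w B \<longleftrightarrow> (\<forall>a\<in>B. \<forall>b\<in>B. w a = w b)"

lemma const_onD: "const_on w B \<Longrightarrow> a \<in> B \<Longrightarrow> b \<in> B \<Longrightarrow> w a = w b"
  unfolding const_on_def by blast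

lemma const_on_cong: "(\<And>a. a \<in> B \<Longrightarrow> w a = w' a) \<Longrightarrow> const_on w B \<longleftrightarrow> const_on w' B"
  by (simp add: const_on_def)

text \<open>Expanding the product means choosing one variable for each block, that is, a word that
  is constant on every block; a block of size k with variable i contributes the k-th power of that
  variable.\<close>

lemma mcoeff_prod_power_sum:
  fixes x :: "nat \<Rightarrow> 'v" and \<O> :: "'b set set"
  assumes x: "inj x" and fin: "finite \<O>"
    and parts: "\<And>B. B \<in> \<O> \<Longrightarrow> finite B \<and> B \<noteq> {}" and disj: "disjoint \<O>"
  shows "mcoeff (\<Prod>B\<in>\<O>. power_sum x (card B) :: ('v, 'a :: comm_ring_1) mpowser) m
    = of_nat (card {w \<in> words x (\<Union>\<O>) m. \<forall>B\<in>\<O>. const_on w B})"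
  using fin parts disj
proof (induction \<O> arbitrary: m rule: finite_induct)
  case empty
  have "words x ({} :: 'b set) m = (if m = 0 then {\<lambda>_. undefined} else {})"
    by (auto simp: words_def word_content_def)
  then show ?case by (cases "m = 0") (simp_all add: one_mpowser.rep_eq)
next
  case (insert B \<O>)
  let ?A = "\<Union>\<O>"
  let ?W = "\<lambda>m. {w \<in> words x ?A m. \<forall>B\<in>\<O>. const_on w B}"
  let ?W' = "{w \<in> words x (\<Union>(insert B \<O>)) m. \<forall>B\<in>insert B \<O>. const_on w B}"
  let ?k = "card B"
  let ?I = "{i. \<exists>b. single (x i) ?k + b = m}"
  have B: "finite B" "B \<noteq> {}" using insert.prems(1) by auto
  then obtain b0 where b0: "b0 \<in> B" by blast
  have k: "0 < ?k" using B by (simp add: card_gt_0_iff)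
  have BA: "B \<inter> ?A = {}"
    using insert.prems(2) insert.hyps(2) by (auto simp: pairwise_def disjnt_def)
  have finA: "finite ?A" using insert by auto
  have content: "word_content x (B \<union> ?A) w = single (x i) ?k + word_content x ?A w"
    if "\<forall>a\<in>B. w a = i" for w i
    unfolding word_content_def using that BA finA B(1)
    by (simp add: sum.union_disjoint sum_single_const[unfolded One_nat_def])
  have "finite ?W'"
    by (rule finite_subset[OF _ finite_words[OF x, of "\<Union>(insert B \<O>)" m]]) (use B finA in auto)
  have W'_eq: "?W' = (\<Union>i\<in>?I. {w \<in> ?W'. w b0 = i})"
  proof -
    have "w b0 \<in> ?I" if "w \<in> ?W'" for w
    proof -
      have "const_on w B" using that by simp
      then have "\<forall>a\<in>B. w a = w b0" using const_onD b0 by metis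
      from content[OF this] that have "single (x (w b0)) ?k + word_content x ?A w = m"
        by (simp add: words_def)
      then show ?thesis by blast
    qed
    then show ?thesis by blast
  qed
  \<comment> \<open>With the value i on \<open>B\<close> prescribed, the rest is any admissible word
    on the remaining blocks whose content is m divided by the contribution of
    \<open>B\<close>.\<close>
  have fiber: "card {w \<in> ?W'. w b0 = i} = card (?W (m - single (x i) ?k))" if i: "i \<in> ?I" for i
  proof (rule bij_betw_same_card)
    let ?m = "m - single (x i) ?k"
    have m: "single (x i) ?k + ?m = m" using i by auto
    show "bij_betw (\<lambda>w. restrict w ?A) {w \<in> ?W'. w b0 = i} (?W ?m)"
    proof (rule bij_betw_byWitness[where f' = "\<lambda>w a. if a \<in> B then i else w a"])
      show "\<forall>w\<in>{w \<in> ?W'. w b0 = i}. (\<lambda>a. if a \<in> B then i else restrict w ?A a) = w"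
      proof (intro ballI ext)
        fix w a assume w: "w \<in> {w \<in> ?W'. w b0 = i}"
        show "(if a \<in> B then i else restrict w ?A a) = w a"
        proof (cases "a \<in> B")
          case True
          moreover have "const_on w B" using w by simp
          ultimately have "w a = w b0" using const_onD b0 by metis
          then show ?thesis using True w by simp
        next
          case False
          then show ?thesis
            using w by (cases "a \<in> ?A") (simp_all add: words_def PiE_iff extensional_def)
        qed
      qed
      show "\<forall>w\<in>?W ?m. restrict (\<lambda>a. if a \<in> B then i else w a) ?A = w"
      proof (intro ballI ext)
        fix w a assume w: "w \<in> ?W ?m"
        show "restrict (\<lambda>a. if a \<in> B then i else w a) ?A a = w a"
        proof (cases "a \<in> ?A")
          case True
          then have "a \<notin> B" using BA by blast
          then show ?thesis using True by simp
        next
          case False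
          then show ?thesis using w by (simp add: words_def PiE_iff extensional_def)
        qed
      qed
      show "(\<lambda>w. restrict w ?A) ` {w \<in> ?W'. w b0 = i} \<subseteq> ?W ?m"
      proof clarify
        fix w assume w: "w \<in> words x (\<Union>(insert B \<O>)) m" "\<forall>B\<in>insert B \<O>. const_on w B" "i = w b0"
        from w(2) have "const_on w B" by simp
        then have "\<forall>a\<in>B. w a = w b0" using const_onD b0 by metis
        from content[OF this] w(1,3) have "m = single (x i) ?k + word_content x ?A w"
          by (simp add: words_def)
        then have "word_content x ?A w = ?m" by (simp only: add_diff_cancel_left')
        then have "word_content x ?A (restrict w ?A) = ?m"
          using word_content_cong[of ?A "restrict w ?A" w x] by simp
        moreover have "\<forall>C\<in>\<O>. const_on (restrict w ?A) C"
        proof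
          fix C assume C: "C \<in> \<O>"
          then have "const_on (restrict w ?A) C \<longleftrightarrow> const_on w C" by (intro const_on_cong) auto
          then show "const_on (restrict w ?A) C" using w(2) C by simp
        qed
        ultimately show "restrict w ?A \<in> words x ?A (m - single (x (w b0)) ?k)
            \<and> (\<forall>C\<in>\<O>. const_on (restrict w ?A) C)"
          using w(3) by (simp add: words_def)
      qed
      show "(\<lambda>w a. if a \<in> B then i else w a) ` ?W ?m \<subseteq> {w \<in> ?W'. w b0 = i}"
      proof
        fix w' assume "w' \<in> (\<lambda>w a. if a \<in> B then i else w a) ` ?W ?m"
        then obtain w where w: "w \<in> ?W ?m" "w' = (\<lambda>a. if a \<in> B then i else w a)" by blast
        have "word_content x (B \<union> ?A) w' = single (x i) ?k + word_content x ?A w'"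
          using w(2) by (intro content) auto
        also have "word_content x ?A w' = word_content x ?A w"
          using w(2) BA by (intro word_content_cong) auto
        finally have "word_content x (B \<union> ?A) w' = m" using w(1) m by (simp add: words_def)
        moreover have "w' \<in> (B \<union> ?A) \<rightarrow>\<^sub>E UNIV" using w by (auto simp: words_def PiE_iff extensional_def)
        moreover have "\<forall>C\<in>insert B \<O>. const_on w' C"
        proof
          fix C assume C: "C \<in> insert B \<O>"
          show "const_on w' C"
          proof (cases "C = B")
            case True
            then show ?thesis using w(2) by (simp add: const_on_def)
          next
            case False
            then have "C \<in> \<O>" "C \<inter> B = {}" using C BA by auto
            then have "const_on w' C \<longleftrightarrow> const_on w C" using w(2) by (intro const_on_cong) auto
            then show ?thesis using w(1) \<open>C \<in> \<O>\<close> by simp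
          qed
        qed
        ultimately show "w' \<in> {w \<in> ?W'. w b0 = i}" using w(2) b0 by (simp add: words_def)
      qed
    qed
  qed
  have "mcoeff (\<Prod>B\<in>insert B \<O>. power_sum x (card B) :: ('v, 'a) mpowser) m
      = (\<Sum>i\<in>?I. of_nat (card (?W (m - single (x i) ?k))))"
    using insert.hyps insert.prems
    by (simp add: mcoeff_power_sum_times[OF x k] insert.IH pairwise_insert)
  also have "\<dots> = of_nat (\<Sum>i\<in>?I. card {w \<in> ?W'. w b0 = i})"
    unfolding of_nat_sum by (intro sum.cong refl) (simp only: fiber)
  also have "(\<Sum>i\<in>?I. card {w \<in> ?W'. w b0 = i}) = card (\<Union>i\<in>?I. {w \<in> ?W'. w b0 = i})"
  proof (rule card_UN_disjoint[symmetric])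
    show "finite ?I" by (rule finite_power_sum_indices[OF x k])
    show "\<forall>i\<in>?I. finite {w \<in> ?W'. w b0 = i}"
      by (intro ballI finite_subset[OF Collect_restrict \<open>finite ?W'\<close>])
    show "\<forall>i\<in>?I. \<forall>j\<in>?I. i \<noteq> j \<longrightarrow> {w \<in> ?W'. w b0 = i} \<inter> {w \<in> ?W'. w b0 = j} = {}"
      by (intro ballI impI equals0I) (elim IntE CollectE conjE, simp)
  qed
  also have "\<dots> = card ?W'" by (rule arg_cong[OF W'_eq[symmetric]])
  finally show ?case .
qed

text \<open>This matching serves twice: it turns words of equal content into each other by a
  permutation, and it pairs the orbits of two permutations of equal cycle type.\<close>

lemma image_mset_eq_imp_bij:
  assumes "finite X" "finite Y" "image_mset f (mset_set X) = image_mset g (mset_set Y)"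
  shows "\<exists>p. bij_betw p X Y \<and> (\<forall>x\<in>X. g (p x) = f x)"
  using assms
proof (induction X arbitrary: Y rule: finite_induct)
  case empty
  then show ?case by (auto simp: mset_set_empty_iff bij_betw_def)
next
  case (insert a X)
  then have "f a \<in># image_mset g (mset_set Y)" by (metis image_mset_add_mset mset_set.insert union_single_eq_member)
  then obtain b where b: "b \<in> Y" "g b = f a" using insert.prems(1) by auto
  have "mset_set Y = add_mset b (mset_set (Y - {b}))"
    using b insert.prems(1) by (metis mset_set.remove)
  then have "image_mset f (mset_set X) = image_mset g (mset_set (Y - {b}))"
    using insert b by simp
  from insert.IH[OF _ this] insert.prems(1) obtain p where p: "bij_betw p X (Y - {b})" "\<forall>x\<in>X. g (p x) = f x"
    by auto
  have "bij_betw (p(a := b)) X (Y - {b})"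
    using p(1) insert.hyps(2) by (subst bij_betw_cong[of _ _ p]) auto
  then have "bij_betw (p(a := b)) (X \<union> {a}) ((Y - {b}) \<union> {b})"
    by (rule bij_betw_combine) (auto simp: bij_betw_def)
  moreover have "(Y - {b}) \<union> {b} = Y" "X \<union> {a} = insert a X" using b by auto
  ultimately have "bij_betw (p(a := b)) (insert a X) Y" by metis
  moreover have "\<forall>x\<in>insert a X. g ((p(a := b)) x) = f x" using p(2) b insert.hyps(2) by auto
  ultimately show ?case by blast
qed


lemma image_mset_eq_imp_permutes:
  assumes "finite A" "image_mset f (mset_set A) = image_mset g (mset_set A)"
  shows "\<exists>p. p permutes A \<and> (\<forall>a\<in>A. g (p a) = f a)"
proof -
  obtain p where p: "bij_betw p A A" "\<forall>a\<in>A. g (p a) = f a"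
    using image_mset_eq_imp_bij[OF assms(1,1,2)] by blast
  have "restrict_id p A permutes A" by (rule permutes_restrict_id[OF p(1)])
  then show ?thesis using p(2) by (intro exI[of _ "restrict_id p A"]) (simp add: restrict_id_def)
qed

lemma lookup_word_content:
  assumes "inj x" "finite A"
  shows "lookup (word_content x A w) (x i) = count (image_mset w (mset_set A)) i"
proof -
  have "lookup (word_content x A w) (x i) = (\<Sum>a\<in>A. if w a = i then 1 else 0)"
    unfolding word_content_def lookup_sum
    using assms(1) by (intro sum.cong refl) (auto simp: lookup_single when_def inj_eq)
  also have "\<dots> = card {a \<in> A. w a = i}"
    using assms(2) by (simp add: sum.If_cases Int_def)
  finally show ?thesis using assms(2) by (simp add: count_image_mset_eq_card_vimage)
qed

lemma monomial_degree_add: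
  fixes a b :: "'v \<Rightarrow>\<^sub>0 nat"
  shows "(\<Sum>v\<in>keys (a + b). lookup (a + b) v)
    = (\<Sum>v\<in>keys a. lookup a v) + (\<Sum>v\<in>keys b. lookup b v)"
proof -
  let ?K = "keys a \<union> keys b"
  have K: "(\<Sum>v\<in>keys c. lookup c v) = (\<Sum>v\<in>?K. lookup c v)"
    if "keys c \<subseteq> ?K" for c :: "'v \<Rightarrow>\<^sub>0 nat"
    using that by (intro sum.mono_neutral_left) (auto simp: in_keys_iff)
  show ?thesis
    using K[OF keys_add] K[of a] K[of b] by (simp add: lookup_add flip: sum.distrib)
qed

text \<open>The right-hand side is the support of \<open>complete_hom x (card A)\<close>, so a
  monomial occurs there exactly when some word has it as content. Each induction step splits off one
  variable.\<close>

lemma ex_word_content_iff: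
  assumes "finite A"
  shows "(\<exists>w. word_content x A w = m) \<longleftrightarrow> keys m \<subseteq> range x
    \<and> (\<Sum>v\<in>keys m. lookup m v) = card A"
  using assms
proof (induction A arbitrary: m rule: finite_induct)
  case empty
  have "m = 0" if "(\<Sum>v\<in>keys m. lookup m v) = 0"
    using that by (auto simp: in_keys_iff intro!: poly_mapping_eqI)
  then show ?case by (auto simp: word_content_def)
next
  case (insert a A)
  have content: "word_content x (insert a A) w = single (x (w a)) 1 + word_content x A w" for w
    using insert.hyps by (simp add: word_content_def)
  show ?case
  proof
    assume "\<exists>w. word_content x (insert a A) w = m"
    then obtain w where w: "m = single (x (w a)) 1 + word_content x A w"
      using content by metis
    have IH: "keys (word_content x A w) \<subseteq> range x"
      "(\<Sum>v\<in>keys (word_content x A w). lookup (word_content x A w) v) = card A"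
      using insert.IH[of "word_content x A w"] by blast+
    have "keys m \<subseteq> range x"
      using IH(1) keys_add[of "single (x (w a)) 1" "word_content x A w"] w by auto
    moreover have "(\<Sum>v\<in>keys m. lookup m v) = card (insert a A)"
      unfolding w monomial_degree_add IH(2) using insert.hyps by simp
    ultimately show "keys m \<subseteq> range x
      \<and> (\<Sum>v\<in>keys m. lookup m v) = card (insert a A)" by simp
  next
    assume m: "keys m \<subseteq> range x
      \<and> (\<Sum>v\<in>keys m. lookup m v) = card (insert a A)"
    then have "keys m \<noteq> {}" using insert.hyps by auto
    then obtain i where i: "x i \<in> keys m" using m by blast
    define m' where "m' = m - single (x i) 1"
    have mm': "m = single (x i) 1 + m'"
      using i by (intro poly_mapping_eqI) (auto simp: m'_def lookup_add lookup_minus lookup_single when_def in_keys_iff)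
    have "keys m' \<subseteq> keys m"
      by (auto simp: m'_def in_keys_iff lookup_minus)
    moreover have "(\<Sum>v\<in>keys m'. lookup m' v) = card A"
      using m insert.hyps monomial_degree_add[of "single (x i) 1" m'] mm' by simp
    ultimately obtain w where w: "word_content x A w = m'" using insert.IH[of m'] m by blast
    have "word_content x A (w(a := i)) = m'"
      unfolding w[symmetric] using insert.hyps by (intro word_content_cong) auto
    then have "word_content x (insert a A) (w(a := i)) = m" unfolding content using mm' by simp
    then show "\<exists>w. word_content x (insert a A) w = m" by blast
  qed
qed

section \<open>Orbits of a permutation and the Burnside count\<close>

lemma orbit_permutes:
  assumes \<sigma>: "\<sigma> permutes A" and fin: "finite A"
  shows "disjoint (orbit \<sigma> ` A)" "\<Union>(orbit \<sigma> ` A) = A"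
    "\<And>B. B \<in> orbit \<sigma> ` A \<Longrightarrow> finite B \<and> B \<noteq> {}"
    "\<And>a b. b \<in> orbit \<sigma> a \<Longrightarrow> orbit \<sigma> b = orbit \<sigma> a"
proof -
  have perm: "permutation \<sigma>" using assms by (auto simp: permutation_permutes)
  show eq: "orbit \<sigma> b = orbit \<sigma> a" if "b \<in> orbit \<sigma> a" for a b
    using orbit_cyclic_eq3[OF cyclic_on_orbit[OF \<sigma> fin] that] .
  show "disjoint (orbit \<sigma> ` A)"
  proof (clarsimp simp: pairwise_def disjnt_def)
    fix a b assume "orbit \<sigma> a \<noteq> orbit \<sigma> b"
    then show "orbit \<sigma> a \<inter> orbit \<sigma> b = {}" using eq by blast
  qed
  show "\<Union>(orbit \<sigma> ` A) = A"
    using permutes_orbit_subset[OF \<sigma>] permutation_self_in_orbit[OF perm] by blast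
  show "finite B \<and> B \<noteq> {}" if "B \<in> orbit \<sigma> ` A" for B
    using that permutes_orbit_subset[OF \<sigma>] permutation_self_in_orbit[OF perm] fin
    by (auto intro: finite_subset)
qed

lemma constant_on_orbits_iff:
  assumes \<sigma>: "\<sigma> permutes A" and fin: "finite A"
  shows "(\<forall>B\<in>orbit \<sigma> ` A. const_on w B) \<longleftrightarrow> (\<forall>a\<in>A. w (\<sigma> a) = w a)"
proof
  have perm: "permutation \<sigma>" using assms by (auto simp: permutation_permutes)
  assume const: "\<forall>B\<in>orbit \<sigma> ` A. const_on w B"
  show "\<forall>a\<in>A. w (\<sigma> a) = w a"
  proof
    fix a assume "a \<in> A"
    then show "w (\<sigma> a) = w a"
      using const const_onD[of w "orbit \<sigma> a"] orbit.base[of \<sigma> a] permutation_self_in_orbit[OF perm, of a]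
      by blast
  qed
next
  assume inv: "\<forall>a\<in>A. w (\<sigma> a) = w a"
  have "w b = w a" if "a \<in> A" "b \<in> orbit \<sigma> a" for a b
    using that(2)
  proof induction
    case base
    then show ?case using inv that(1) by simp
  next
    case (step b)
    then have "b \<in> A" using permutes_orbit_subset[OF \<sigma> that(1)] by blast
    then show ?case using inv step by simp
  qed
  then show "\<forall>B\<in>orbit \<sigma> ` A. const_on w B" unfolding const_on_def by (metis imageE)
qed

text \<open>
  A Burnside count: the coefficient of a monomial in the summand of \<open>\<sigma>\<close> is the number of words on
  \<open>A\<close> with that content that are fixed by \<open>\<sigma>\<close>, and the permutations of \<open>A\<close> act transitively on the
  words of a given content.
\<close>

theorem sum_permutes_prod_power_sum:
  fixes x :: "nat \<Rightarrow> 'v" and A :: "'b set"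
  assumes x: "inj x" and fin: "finite A"
  shows "(\<Sum>\<sigma> | \<sigma> permutes A. \<Prod>B\<in>orbit \<sigma> ` A. power_sum x (card B))
    = of_nat (fact (card A)) * (complete_hom x (card A) :: ('v, 'a :: comm_ring_1) mpowser)"
proof (rule mpowser_eqI)
  fix m
  let ?S = "{\<sigma>. \<sigma> permutes A}" and ?W = "words x A m"
  have finS: "finite ?S" by (rule finite_permutations[OF fin])
  have finW: "finite ?W" by (rule finite_words[OF x fin])
  have count: "(\<Sum>\<sigma>\<in>?S. card {w \<in> ?W. \<forall>a\<in>A. w (\<sigma> a) = w a}) = (if ?W = {} then 0 else fact (card A))"
  proof (cases "?W = {}")
    case False
    then obtain w0 where w0: "w0 \<in> ?W" by blast
    have "(\<Sum>\<sigma>\<in>?S. card {w \<in> ?W. \<forall>a\<in>A. w (\<sigma> a) = w a})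
        = (\<Sum>w\<in>?W. card {\<sigma> \<in> ?S. \<forall>a\<in>A. w (\<sigma> a) = w a})"
      using sum.swap_restrict[OF finS finW, of "\<lambda>_ _. 1 :: nat" "\<lambda>\<sigma> w. \<forall>a\<in>A. w (\<sigma> a) = w a"] by simp
    \<comment> \<open>A fixed word \<open>w0\<close> replaces w on the left: composing with a
      permutation p that turns \<open>w0\<close> into w maps the stabilizer of w onto a coset of the
      same size.\<close>
    also have "\<dots> = (\<Sum>w\<in>?W. card {\<sigma> \<in> ?S. \<forall>a\<in>A. w0 (\<sigma> a) = w a})"
    proof (rule sum.cong[OF refl])
      fix w assume w: "w \<in> ?W"
      have "image_mset w (mset_set A) = image_mset w0 (mset_set A)"
      proof (rule multiset_eqI)
        fix i
        show "count (image_mset w (mset_set A)) i = count (image_mset w0 (mset_set A)) i"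
          using lookup_word_content[OF x fin, of w i] lookup_word_content[OF x fin, of w0 i] w w0
          by (simp add: words_def)
      qed
      then obtain p where p: "p permutes A" "\<forall>a\<in>A. w0 (p a) = w a"
        using image_mset_eq_imp_permutes[OF fin] by blast
      have "bij_betw ((\<circ>) p) {\<sigma> \<in> ?S. \<forall>a\<in>A. w (\<sigma> a) = w a} {\<sigma> \<in> ?S. \<forall>a\<in>A. w0 (\<sigma> a) = w a}"
      proof (rule bij_betw_byWitness[where f' = "(\<circ>) (inv p)"])
        show "\<forall>\<sigma>\<in>{\<sigma> \<in> ?S. \<forall>a\<in>A. w (\<sigma> a) = w a}. inv p \<circ> (p \<circ> \<sigma>) = \<sigma>"
          "\<forall>\<sigma>\<in>{\<sigma> \<in> ?S. \<forall>a\<in>A. w0 (\<sigma> a) = w a}. p \<circ> (inv p \<circ> \<sigma>) = \<sigma>"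
          using permutes_inv_o[OF p(1)] by (simp_all flip: o_assoc add: o_assoc)
        show "(\<circ>) p ` {\<sigma> \<in> ?S. \<forall>a\<in>A. w (\<sigma> a) = w a} \<subseteq> {\<sigma> \<in> ?S. \<forall>a\<in>A. w0 (\<sigma> a) = w a}"
          using p by (auto simp: permutes_in_image intro: permutes_compose)
        show "(\<circ>) (inv p) ` {\<sigma> \<in> ?S. \<forall>a\<in>A. w0 (\<sigma> a) = w a} \<subseteq> {\<sigma> \<in> ?S. \<forall>a\<in>A. w (\<sigma> a) = w a}"
        proof clarify
          fix \<sigma> assume \<sigma>: "\<sigma> permutes A" "\<forall>a\<in>A. w0 (\<sigma> a) = w a"
          have "w (inv p (\<sigma> a)) = w a" if "a \<in> A" for a
          proof -
            have "inv p (\<sigma> a) \<in> A" using that \<sigma>(1) p(1) by (simp add: permutes_in_image permutes_inv)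
            then have "w (inv p (\<sigma> a)) = w0 (p (inv p (\<sigma> a)))" using p(2) by simp
            also have "\<dots> = w a" using \<sigma>(2) that permutes_inverses(1)[OF p(1)] by simp
            finally show ?thesis .
          qed
          then show "inv p \<circ> \<sigma> \<in> ?S \<and> (\<forall>a\<in>A. w ((inv p \<circ> \<sigma>) a) = w a)"
            using permutes_compose[OF \<sigma>(1) permutes_inv[OF p(1)]] by simp
        qed
      qed
      then show "card {\<sigma> \<in> ?S. \<forall>a\<in>A. w (\<sigma> a) = w a} = card {\<sigma> \<in> ?S. \<forall>a\<in>A. w0 (\<sigma> a) = w a}"
        by (rule bij_betw_same_card)
    qed
    also have "\<dots> = (\<Sum>\<sigma>\<in>?S. card {w \<in> ?W. \<forall>a\<in>A. w0 (\<sigma> a) = w a})"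
      using sum.swap_restrict[OF finS finW, of "\<lambda>_ _. 1 :: nat" "\<lambda>\<sigma> w. \<forall>a\<in>A. w0 (\<sigma> a) = w a"] by simp
    \<comment> \<open>Counted from the other side, each \<sigma> determines its word, namely
      \<open>w0\<close> after \<sigma>, whose content is unchanged. The total is therefore the
      number of permutations.\<close>
    also have "\<dots> = (\<Sum>\<sigma>\<in>?S. 1)"
    proof (rule sum.cong[OF refl])
      fix \<sigma> assume "\<sigma> \<in> ?S"
      then have \<sigma>: "\<sigma> permutes A" by simp
      let ?w = "restrict (w0 \<circ> \<sigma>) A"
      have "word_content x A ?w = (\<Sum>a\<in>A. single (x (w0 (\<sigma> a))) 1)"
        unfolding word_content_def by (intro sum.cong refl) simp
      also have "\<dots> = word_content x A w0"
        using sum.permute[OF \<sigma>, of "\<lambda>a. single (x (w0 a)) (1 :: nat)"]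
        by (simp add: word_content_def comp_def)
      finally have w: "?w \<in> ?W" using w0 by (simp add: words_def)
      have "{w \<in> ?W. \<forall>a\<in>A. w0 (\<sigma> a) = w a} = {?w}"
      proof (intro set_eqI iffI)
        fix w assume "w \<in> {w \<in> ?W. \<forall>a\<in>A. w0 (\<sigma> a) = w a}"
        then have "w a = ?w a" for a by (cases "a \<in> A") (auto simp: words_def PiE_iff extensional_def)
        then show "w \<in> {?w}" by auto
      qed (use w in auto)
      then show "card {w \<in> ?W. \<forall>a\<in>A. w0 (\<sigma> a) = w a} = 1" by simp
    qed
    also have "\<dots> = fact (card A)" using card_permutations[OF refl fin] by simp
    finally show ?thesis using False by simp
  qed simp
  have empty: "?W = {} \<longleftrightarrow> \<not> (keys m \<subseteq> range x
      \<and> (\<Sum>v\<in>keys m. lookup m v) = card A)"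
  proof -
    have "?W \<noteq> {} \<longleftrightarrow> (\<exists>w. word_content x A w = m)"
    proof
      assume "\<exists>w. word_content x A w = m"
      then obtain w where "word_content x A w = m" by blast
      then have "restrict w A \<in> ?W" using word_content_cong[of A "restrict w A" w x] by (simp add: words_def)
      then show "?W \<noteq> {}" by blast
    qed (auto simp: words_def)
    then show ?thesis using ex_word_content_iff[OF fin, of x m] by blast
  qed
  have "mcoeff (\<Sum>\<sigma>\<in>?S. \<Prod>B\<in>orbit \<sigma> ` A. power_sum x (card B) :: ('v, 'a) mpowser) m
      = (\<Sum>\<sigma>\<in>?S. of_nat (card {w \<in> ?W. \<forall>a\<in>A. w (\<sigma> a) = w a}))"
    unfolding mcoeff_sum
  proof (rule sum.cong[OF refl])
    fix \<sigma> assume "\<sigma> \<in> ?S"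
    then have \<sigma>: "\<sigma> permutes A" by simp
    note o = orbit_permutes[OF \<sigma> fin]
    show "mcoeff (\<Prod>B\<in>orbit \<sigma> ` A. power_sum x (card B) :: ('v, 'a) mpowser) m
        = of_nat (card {w \<in> ?W. \<forall>a\<in>A. w (\<sigma> a) = w a})"
      using mcoeff_prod_power_sum[OF x _ o(3,1), of m] fin
      unfolding o(2) constant_on_orbits_iff[OF \<sigma> fin] by blast
  qed
  also have "\<dots> = of_nat (if ?W = {} then 0 else fact (card A))"
    unfolding count[symmetric] by simp
  also have "\<dots> = mcoeff (of_nat (fact (card A)) * (complete_hom x (card A) :: ('v, 'a) mpowser)) m"
    unfolding mcoeff_of_nat_times complete_hom.rep_eq using empty by simp
  finally show "mcoeff (\<Sum>\<sigma>\<in>?S. \<Prod>B\<in>orbit \<sigma> ` A. power_sum x (card B) :: ('v, 'a) mpowser) m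
      = mcoeff (of_nat (fact (card A)) * (complete_hom x (card A) :: ('v, 'a) mpowser)) m" .
qed

section \<open>Cycle types and conjugacy classes\<close>

text \<open>The cycle type on an arbitrary set, needed for S, T and their complements. It also
  applies to maps that merely preserve A, such as permutations of a larger set.\<close>

definition orbit_type :: "'a set \<Rightarrow> ('a \<Rightarrow> 'a) \<Rightarrow> nat multiset"
  where "orbit_type A \<sigma> = image_mset card (mset_set (orbit \<sigma> ` A))"

lemma cycle_type_eq_orbit_type: "cycle_type n \<sigma> = orbit_type {1..n} \<sigma>"
  by (simp add: cycle_type_def orbit_type_def)

lemma orbit_subset_invariant:
  assumes "\<sigma> ` A \<subseteq> A" "a \<in> A"
  shows "orbit \<sigma> a \<subseteq> A"
proof
  fix b assume "b \<in> orbit \<sigma> a"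
  then show "b \<in> A" using assms by induction auto
qed

lemma funpow_conjugate:
  assumes "\<sigma> ` A \<subseteq> A" "\<forall>a\<in>A. \<sigma>' (p a) = p (\<sigma> a)" "a \<in> A"
  shows "(\<sigma>' ^^ k) (p a) = p ((\<sigma> ^^ k) a) \<and> (\<sigma> ^^ k) a \<in> A"
  using assms by (induction k) auto

lemma orbit_conjugate:
  assumes "\<sigma> ` A \<subseteq> A" "\<forall>a\<in>A. \<sigma>' (p a) = p (\<sigma> a)" "a \<in> A"
  shows "orbit \<sigma>' (p a) = p ` orbit \<sigma> a"
  unfolding orbit_altdef using funpow_conjugate[OF assms] by auto

lemma orbit_type_conjugate:
  assumes inj: "inj_on p A" and \<sigma>: "\<sigma> ` A \<subseteq> A" "\<forall>a\<in>A. \<sigma>' (p a) = p (\<sigma> a)"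
  shows "orbit_type (p ` A) \<sigma>' = orbit_type A \<sigma>"
proof -
  have sub: "B \<subseteq> A" if "B \<in> orbit \<sigma> ` A" for B
    using that orbit_subset_invariant[OF \<sigma>(1)] by blast
  have eq: "orbit \<sigma>' ` p ` A = (`) p ` (orbit \<sigma> ` A)"
    using orbit_conjugate[OF \<sigma>] by (force simp: image_iff)
  have "inj_on ((`) p) (orbit \<sigma> ` A)"
    by (rule inj_on_subset[OF inj_on_image_Pow[OF inj]]) (use sub in blast)
  then have "orbit_type (p ` A) \<sigma>' = image_mset (card \<circ> (`) p) (mset_set (orbit \<sigma> ` A))"
    unfolding orbit_type_def eq by (simp add: image_mset_mset_set[symmetric] multiset.map_comp)
  also have "\<dots> = orbit_type A \<sigma>"
    unfolding orbit_type_def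
  proof (rule image_mset_cong)
    fix B assume "B \<in># mset_set (orbit \<sigma> ` A)"
    then have "B \<subseteq> A" using sub by (metis elem_mset_set empty_iff mset_set.infinite set_mset_empty)
    then show "(card \<circ> (`) p) B = card B" using inj by (simp add: card_image inj_on_subset)
  qed
  finally show ?thesis .
qed

lemma orbit_type_cong:
  assumes "\<sigma> ` A \<subseteq> A" "\<forall>a\<in>A. \<sigma>' a = \<sigma> a"
  shows "orbit_type A \<sigma>' = orbit_type A \<sigma>"
  using orbit_type_conjugate[of id A \<sigma> \<sigma>'] assms by simp

lemma orbit_type_Un:
  assumes fin: "finite A" "finite B" and disj: "A \<inter> B = {}"
    and \<sigma>: "\<sigma> ` A \<subseteq> A" "\<sigma> ` B \<subseteq> B"
  shows "orbit_type (A \<union> B) \<sigma> = orbit_type A \<sigma> + orbit_type B \<sigma>"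
proof -
  have "orbit \<sigma> ` A \<inter> orbit \<sigma> ` B = {}"
  proof (rule equals0I)
    fix C assume "C \<in> orbit \<sigma> ` A \<inter> orbit \<sigma> ` B"
    then obtain a b where ab: "a \<in> A" "b \<in> B" "C = orbit \<sigma> a" "C = orbit \<sigma> b" by blast
    then have "C \<subseteq> A" "C \<subseteq> B"
      using orbit_subset_invariant[OF \<sigma>(1), of a] orbit_subset_invariant[OF \<sigma>(2), of b] by simp_all
    moreover have "C \<noteq> {}" using ab by (simp add: orbit_nonempty)
    ultimately show False using disj by blast
  qed
  then show ?thesis using fin by (simp add: orbit_type_def image_Un mset_set_Union)
qed

text \<open>Iteration from a is periodic, and the first return time is the size of the
  orbit.\<close>

lemma funpow_eq_iff_mod_card_orbit:
  assumes "permutation \<sigma>"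
  shows "(\<sigma> ^^ k) a = (\<sigma> ^^ l) a \<longleftrightarrow> k mod card (orbit \<sigma> a) = l mod card (orbit \<sigma> a)"
proof -
  let ?c = "funpow_dist1 \<sigma> a a"
  have self: "a \<in> orbit \<sigma> a" by (rule permutation_self_in_orbit[OF assms])
  note inj = inj_on_funpow_dist1[OF self]
  have c: "card (orbit \<sigma> a) = ?c"
    using orbit_conv_funpow_dist1[OF self] card_image[OF inj] by simp
  have "(\<sigma> ^^ ?c) a = a" by (rule funpow_dist1_prop[OF self])
  then have mod: "(\<sigma> ^^ (k mod ?c)) a = (\<sigma> ^^ k) a" for k by (rule funpow_mod_eq)
  have "(\<sigma> ^^ k) a = (\<sigma> ^^ l) a \<longleftrightarrow> (\<sigma> ^^ (k mod ?c)) a = (\<sigma> ^^ (l mod ?c)) a"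
    unfolding mod ..
  also have "\<dots> \<longleftrightarrow> k mod ?c = l mod ?c"
    using inj_on_eq_iff[OF inj, of "k mod ?c" "l mod ?c"] by simp
  finally show ?thesis unfolding c .
qed

text \<open>The orbits are paired by a size-preserving bijection \<beta>, with a base point in each
  orbit. The point reached after e steps of \<sigma> is sent to the point reached after e steps of
  \<tau> from the corresponding base point.\<close>

lemma conjugate_if_orbit_type_eq:
  assumes fin: "finite A" and \<sigma>: "\<sigma> permutes A" and \<tau>: "\<tau> permutes A"
    and type: "orbit_type A \<sigma> = orbit_type A \<tau>"
  shows "\<exists>p. p permutes A \<and> p \<circ> \<sigma> = \<tau> \<circ> p"
proof -
  have perm: "permutation \<sigma>" "permutation \<tau>" using \<sigma> \<tau> fin by (auto simp: permutation_permutes)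
  obtain \<beta> where \<beta>: "bij_betw \<beta> (orbit \<sigma> ` A) (orbit \<tau> ` A)" "\<forall>B\<in>orbit \<sigma> ` A. card (\<beta> B) = card B"
    using image_mset_eq_imp_bij[of "orbit \<sigma> ` A" "orbit \<tau> ` A" card card] type fin
    unfolding orbit_type_def by auto
  have "\<exists>a'. a' \<in> A \<and> \<beta> B = orbit \<tau> a'" if "B \<in> orbit \<sigma> ` A" for B
    using that bij_betwE[OF \<beta>(1)] by blast
  then obtain r' where r': "\<And>B. B \<in> orbit \<sigma> ` A \<Longrightarrow> r' B \<in> A \<and> \<beta> B = orbit \<tau> (r' B)" by metis
  define r where "r B = (SOME a. a \<in> B)" for B :: "'a set"
  have r: "r (orbit \<sigma> a) \<in> orbit \<sigma> a" for a
    unfolding r_def using permutation_self_in_orbit[OF perm(1)] by (rule someI)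
  have orbit_r: "orbit \<sigma> (r (orbit \<sigma> a)) = orbit \<sigma> a" for a
    using orbit_permutes(4)[OF \<sigma> fin r] .
  define e where "e a = funpow_dist \<sigma> (r (orbit \<sigma> a)) a" for a
  have e: "(\<sigma> ^^ e a) (r (orbit \<sigma> a)) = a" for a
    unfolding e_def using permutation_self_in_orbit[OF perm(1), of a]
    by (intro funpow_dist_prop) (simp add: orbit_r)
  define p where "p a = (if a \<in> A then (\<tau> ^^ e a) (r' (orbit \<sigma> a)) else a)" for a
  have mem: "orbit \<sigma> a \<in> orbit \<sigma> ` A" if "a \<in> A" for a using that by blast
  have pA: "p a \<in> A" if "a \<in> A" for a
    using that r'[OF mem[OF that]] permutes_in_funpow_image[OF \<tau>] by (simp add: p_def)
  have orbit_p: "orbit \<tau> (p a) = \<beta> (orbit \<sigma> a)" if "a \<in> A" for a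
  proof -
    have "p a \<in> orbit \<tau> (r' (orbit \<sigma> a))"
      using that permutation_self_in_orbit[OF perm(2)] by (simp add: p_def funpow_in_orbit)
    then show ?thesis using orbit_permutes(4)[OF \<tau> fin] r'[OF mem[OF that]] by simp
  qed
  have step: "p (\<sigma> a) = \<tau> (p a)" if a: "a \<in> A" for a
  proof -
    let ?r = "r (orbit \<sigma> a)" and ?r' = "r' (orbit \<sigma> a)"
    have \<sigma>a: "\<sigma> a \<in> A" using a \<sigma> by (simp add: permutes_in_image)
    have o: "orbit \<sigma> (\<sigma> a) = orbit \<sigma> a" by (rule orbit_permutes(4)[OF \<sigma> fin orbit.base])
    \<comment> \<open>The exponent of \<open>\<sigma> a\<close> is one more than that of a only
      modulo the orbit size, because of the return to the base point. Paired orbits have equal size,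
      so the wrap-around agrees on both sides.\<close>
    have "(\<sigma> ^^ e (\<sigma> a)) ?r = (\<sigma> ^^ Suc (e a)) ?r" using e[of "\<sigma> a"] e[of a] o by simp
    then have "e (\<sigma> a) mod card (orbit \<sigma> a) = Suc (e a) mod card (orbit \<sigma> a)"
      unfolding funpow_eq_iff_mod_card_orbit[OF perm(1)] orbit_r .
    moreover have "card (orbit \<sigma> a) = card (orbit \<tau> ?r')"
      using \<beta>(2) r'[OF mem[OF a]] mem[OF a] by metis
    ultimately have "(\<tau> ^^ e (\<sigma> a)) ?r' = (\<tau> ^^ Suc (e a)) ?r'"
      unfolding funpow_eq_iff_mod_card_orbit[OF perm(2)] by simp
    then show ?thesis using a \<sigma>a o by (simp add: p_def)
  qed
  have "inj_on p A"
  proof (rule inj_onI)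
    fix a b assume ab: "a \<in> A" "b \<in> A" "p a = p b"
    then have "\<beta> (orbit \<sigma> a) = \<beta> (orbit \<sigma> b)" using orbit_p by metis
    then have o: "orbit \<sigma> a = orbit \<sigma> b"
      using bij_betw_imp_inj_on[OF \<beta>(1)] mem ab by (metis inj_onD)
    have "(\<tau> ^^ e a) (r' (orbit \<sigma> a)) = (\<tau> ^^ e b) (r' (orbit \<sigma> a))" using ab o by (simp add: p_def)
    then have "e a mod card (orbit \<sigma> a) = e b mod card (orbit \<sigma> a)"
      unfolding funpow_eq_iff_mod_card_orbit[OF perm(2)]
      using \<beta>(2) r'[OF mem[OF ab(1)]] mem[OF ab(1)] by metis
    then have "(\<sigma> ^^ e a) (r (orbit \<sigma> a)) = (\<sigma> ^^ e b) (r (orbit \<sigma> a))"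
      unfolding funpow_eq_iff_mod_card_orbit[OF perm(1)] orbit_r .
    then show "a = b" unfolding e unfolding o e .
  qed
  moreover have "p ` A \<subseteq> A" using pA by blast
  ultimately have "p permutes A"
    using fin by (intro inj_imp_permutes) (auto simp: p_def)
  moreover have "p (\<sigma> a) = \<tau> (p a)" for a
    using step[of a] \<sigma> \<tau> by (cases "a \<in> A") (simp_all add: p_def permutes_not_in)
  ultimately show ?thesis by (intro exI[of _ p]) (auto simp: fun_eq_iff)
qed

section \<open>Permutations of a given type and the sizes of conjugacy classes\<close>

lemma cyclic_permutation_exists:
  assumes "finite B" "B \<noteq> {}"
  shows "\<exists>\<gamma>. \<gamma> permutes B \<and> (\<forall>b\<in>B. orbit \<gamma> b = B)"
proof -
  define k where "k = card B"
  have k: "0 < k" using assms by (simp add: k_def card_gt_0_iff)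
  obtain h where h: "bij_betw h {0..<k} B" using ex_bij_betw_nat_finite[OF assms(1)] k_def by blast
  define s where "s = (\<lambda>i. if i \<in> {0..<k} then Suc i mod k else i)"
  have "inj_on s {0..<k}"
  proof (rule inj_onI)
    fix i j assume "i \<in> {0..<k}" "j \<in> {0..<k}" "s i = s j"
    then show "i = j" by (auto simp: s_def mod_Suc split: if_splits)
  qed
  then have s: "s permutes {0..<k}" using k by (intro inj_imp_permutes) (auto simp: s_def)
  define \<gamma> where "\<gamma> = (\<lambda>x. if x \<in> B then h (s (inv_into {0..<k} h x)) else x)"
  have \<gamma>: "\<gamma> permutes B" unfolding \<gamma>_def by (rule permutes_bij_inv_into[OF s h])
  have \<gamma>h: "\<gamma> (h i) = h (Suc i mod k)" if "i < k" for i
    using that h bij_betwE[OF h] by (simp add: \<gamma>_def s_def bij_betw_inv_into_left)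
  have pow: "(\<gamma> ^^ j) (h i) = h ((i + j) mod k)" if "i < k" for i j
    using that k by (induction j) (simp_all add: \<gamma>h mod_Suc_eq)
  have "orbit \<gamma> b = B" if "b \<in> B" for b
  proof (rule antisym)
    show "orbit \<gamma> b \<subseteq> B" by (rule permutes_orbit_subset[OF \<gamma> that])
    show "B \<subseteq> orbit \<gamma> b"
    proof
      fix c assume "c \<in> B"
      obtain i j where i: "i < k" "b = h i" and j: "j < k" "c = h j"
        using \<open>b \<in> B\<close> \<open>c \<in> B\<close> h unfolding bij_betw_def by (metis atLeastLessThan_iff imageE)
      \<comment> \<open>The full turn k - i back to index 0 keeps the exponent positive, as the
        description of orbits by iterates demands, even for j < i or j = i.\<close>
      have "(\<gamma> ^^ (k - i + j)) b = c" using i j by (simp add: pow)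
      moreover have "0 < k - i + j" using i by simp
      ultimately show "c \<in> orbit \<gamma> b" unfolding orbit_altdef by blast
    qed
  qed
  then show ?thesis using \<gamma> by blast
qed

text \<open>Each part splits off a block of that size with a full cycle on it. Consequently the
  choice in \<open>perm_of_type\<close> is meaningful for every partition.\<close>

lemma permutation_of_type_exists:
  assumes "finite A" "0 \<notin># \<mu>" "sum_mset \<mu> = card A"
  shows "\<exists>\<sigma>. \<sigma> permutes A \<and> orbit_type A \<sigma> = \<mu>"
  using assms
proof (induction \<mu> arbitrary: A)
  case empty
  then have "A = {}" by simp
  then show ?case by (intro exI[of _ id]) (auto simp: orbit_type_def id_def)
next
  case (add k \<mu>)
  then have k: "0 < k" "k \<le> card A" by auto
  obtain B where B: "B \<subseteq> A" "card B = k" using obtain_subset_with_card_n[OF k(2)] by metis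
  have fin: "finite B" "finite (A - B)" using add.prems(1) B finite_subset by auto
  have "card (A - B) = sum_mset \<mu>" using add.prems B fin by (simp add: card_Diff_subset)
  then obtain \<sigma> where \<sigma>: "\<sigma> permutes (A - B)" "orbit_type (A - B) \<sigma> = \<mu>"
    using add.IH[of "A - B"] add.prems fin by auto
  have "B \<noteq> {}" using B k by auto
  then obtain \<gamma> where \<gamma>: "\<gamma> permutes B" "\<forall>b\<in>B. orbit \<gamma> b = B"
    using cyclic_permutation_exists[OF fin(1)] by blast
  define \<rho> where "\<rho> = \<gamma> \<circ> \<sigma>"
  have \<rho>B: "\<forall>a\<in>B. \<rho> a = \<gamma> a" using \<sigma>(1) by (auto simp: \<rho>_def permutes_not_in)
  have \<rho>A: "\<forall>a\<in>A - B. \<rho> a = \<sigma> a"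
  proof
    fix a assume "a \<in> A - B"
    then have "\<sigma> a \<in> A - B" using permutes_in_image[OF \<sigma>(1)] by blast
    then show "\<rho> a = \<sigma> a" using \<gamma>(1) by (simp add: \<rho>_def permutes_not_in)
  qed
  have im: "\<gamma> ` B \<subseteq> B" "\<sigma> ` (A - B) \<subseteq> A - B" using permutes_image \<sigma>(1) \<gamma>(1) by blast+
  have A: "A = B \<union> (A - B)" using B by blast
  have "orbit_type A \<rho> = orbit_type B \<rho> + orbit_type (A - B) \<rho>"
    using \<rho>A \<rho>B im fin by (subst A, intro orbit_type_Un) (auto simp: image_subset_iff)
  also have "orbit_type B \<rho> = orbit_type B \<gamma>" by (rule orbit_type_cong[OF im(1) \<rho>B])
  also have "orbit_type B \<gamma> = {#k#}"
  proof -
    have "orbit \<gamma> ` B = {B}" using \<gamma>(2) \<open>B \<noteq> {}\<close> by auto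
    then show ?thesis by (simp add: orbit_type_def B)
  qed
  also have "orbit_type (A - B) \<rho> = \<mu>" using orbit_type_cong[OF im(2) \<rho>A] \<sigma>(2) by simp
  finally have "orbit_type A \<rho> = add_mset k \<mu>" by simp
  moreover have "\<rho> permutes A"
    unfolding \<rho>_def using \<sigma>(1) \<gamma>(1) B(1)
    by (intro permutes_compose) (auto intro: permutes_subset)
  ultimately show ?case by blast
qed

lemma orbit_type_partition:
  assumes "\<sigma> permutes A" "finite A"
  shows "0 \<notin># orbit_type A \<sigma>" "sum_mset (orbit_type A \<sigma>) = card A"
proof -
  note o = orbit_permutes[OF assms]
  show "0 \<notin># orbit_type A \<sigma>"
    using o(3) assms(2) by (auto simp: orbit_type_def)
  have "sum_mset (orbit_type A \<sigma>) = sum card (orbit \<sigma> ` A)"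
    by (simp add: orbit_type_def sum_unfold_sum_mset)
  also have "\<dots> = card (\<Union>(orbit \<sigma> ` A))"
    using o(1,3) assms(2) by (intro card_Union_disjoint[symmetric]) auto
  finally show "sum_mset (orbit_type A \<sigma>) = card A" using o(2) by simp
qed

lemma partitions_eq_cycle_types: "partitions n = cycle_type n ` {\<sigma>. \<sigma> permutes {1..n}}"
proof (intro set_eqI iffI)
  fix \<mu> assume "\<mu> \<in> partitions n"
  then show "\<mu> \<in> cycle_type n ` {\<sigma>. \<sigma> permutes {1..n}}"
    using permutation_of_type_exists[of "{1..n}" \<mu>] unfolding image_iff cycle_type_eq_orbit_type
    by (auto simp: partitions_def)
next
  fix \<mu> assume "\<mu> \<in> cycle_type n ` {\<sigma>. \<sigma> permutes {1..n}}"
  then show "\<mu> \<in> partitions n"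
    using orbit_type_partition[of _ "{1..n}"] by (auto simp: partitions_def cycle_type_eq_orbit_type)
qed

lemma perm_of_type:
  assumes "\<mu> \<in> partitions n"
  shows "perm_of_type n \<mu> permutes {1..n}" "cycle_type n (perm_of_type n \<mu>) = \<mu>"
proof -
  have "\<exists>\<sigma>. \<sigma> permutes {1..n} \<and> cycle_type n \<sigma> = \<mu>"
    using assms unfolding partitions_eq_cycle_types by auto
  from someI_ex[OF this]
  show "perm_of_type n \<mu> permutes {1..n}" "cycle_type n (perm_of_type n \<mu>) = \<mu>"
    unfolding perm_of_type_def by blast+
qed

text \<open>Pairs (\<sigma>, p) such that p conjugates the chosen representative to \<sigma> are
  counted twice. Each p determines \<sigma>, which gives n!; for each \<sigma> in the class the
  possible p form a coset of the centralizer.\<close>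

lemma card_class_times_centralizer_size:
  assumes \<mu>: "\<mu> \<in> partitions n"
  shows "card {\<sigma>. \<sigma> permutes {1..n} \<and> cycle_type n \<sigma> = \<mu>} * centralizer_size n \<mu> = fact n"
proof -
  let ?A = "{1..n}" and ?s = "perm_of_type n \<mu>"
  let ?S = "{p. p permutes ?A}" and ?K = "{\<sigma>. \<sigma> permutes ?A \<and> cycle_type n \<sigma> = \<mu>}"
  note s = perm_of_type[OF \<mu>]
  have finS: "finite ?S" by (rule finite_permutations) simp
  have finK: "finite ?K" by (rule finite_subset[OF _ finS]) auto
  have "card {p \<in> ?S. p \<circ> ?s = \<sigma> \<circ> p} = centralizer_size n \<mu>" if \<sigma>: "\<sigma> \<in> ?K" for \<sigma>
  proof -
    obtain q where q: "q permutes ?A" "q \<circ> ?s = \<sigma> \<circ> q"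
      using conjugate_if_orbit_type_eq[of ?A ?s \<sigma>] s \<sigma> by (auto simp: cycle_type_eq_orbit_type)
    have qi: "inv q \<circ> q = id" "q \<circ> inv q = id" using permutes_inv_o[OF q(1)] by auto
    have "bij_betw ((\<circ>) q) {p. p permutes ?A \<and> p \<circ> ?s = ?s \<circ> p} {p \<in> ?S. p \<circ> ?s = \<sigma> \<circ> p}"
    proof (rule bij_betw_byWitness[where f' = "(\<circ>) (inv q)"])
      show "\<forall>p\<in>{p. p permutes ?A \<and> p \<circ> ?s = ?s \<circ> p}. inv q \<circ> (q \<circ> p) = p"
        "\<forall>p\<in>{p \<in> ?S. p \<circ> ?s = \<sigma> \<circ> p}. q \<circ> (inv q \<circ> p) = p"
        using qi by (simp_all add: o_assoc)
      show "(\<circ>) q ` {p. p permutes ?A \<and> p \<circ> ?s = ?s \<circ> p} \<subseteq> {p \<in> ?S. p \<circ> ?s = \<sigma> \<circ> p}"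
      proof clarify
        fix p assume p: "p permutes ?A" "p \<circ> ?s = ?s \<circ> p"
        have "(q \<circ> p) \<circ> ?s = (q \<circ> ?s) \<circ> p" using p(2) by (simp add: o_assoc[symmetric])
        then show "q \<circ> p \<in> ?S \<and> (q \<circ> p) \<circ> ?s = \<sigma> \<circ> (q \<circ> p)"
          using q p(1) by (simp add: permutes_compose o_assoc)
      qed
      show "(\<circ>) (inv q) ` {p \<in> ?S. p \<circ> ?s = \<sigma> \<circ> p} \<subseteq> {p. p permutes ?A \<and> p \<circ> ?s = ?s \<circ> p}"
      proof clarify
        fix p assume p: "p permutes ?A" "p \<circ> ?s = \<sigma> \<circ> p"
        have "inv q \<circ> \<sigma> = inv q \<circ> \<sigma> \<circ> (q \<circ> inv q)" using qi by simp
        also have "\<dots> = inv q \<circ> (\<sigma> \<circ> q) \<circ> inv q" by (simp add: o_assoc)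
        also have "\<dots> = (inv q \<circ> q) \<circ> ?s \<circ> inv q" unfolding q(2)[symmetric] by (simp add: o_assoc)
        finally have "inv q \<circ> \<sigma> = ?s \<circ> inv q" using qi by simp
        then have "(inv q \<circ> p) \<circ> ?s = ?s \<circ> (inv q \<circ> p)"
          using p(2) by (metis o_assoc)
        then show "inv q \<circ> p permutes ?A \<and> (inv q \<circ> p) \<circ> ?s = ?s \<circ> (inv q \<circ> p)"
          using permutes_compose[OF p(1) permutes_inv[OF q(1)]] by simp
      qed
    qed
    from bij_betw_same_card[OF this] show ?thesis unfolding centralizer_size_def by (rule sym)
  qed
  then have "card ?K * centralizer_size n \<mu> = (\<Sum>\<sigma>\<in>?K. card {p \<in> ?S. p \<circ> ?s = \<sigma> \<circ> p})"
    by simp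
  also have "\<dots> = (\<Sum>p\<in>?S. card {\<sigma> \<in> ?K. p \<circ> ?s = \<sigma> \<circ> p})"
    using sum.swap_restrict[OF finK finS, of "\<lambda>_ _. 1 :: nat" "\<lambda>\<sigma> p. p \<circ> ?s = \<sigma> \<circ> p"] by simp
  also have "\<dots> = (\<Sum>p\<in>?S. 1)"
  proof (rule sum.cong[OF refl])
    fix p assume "p \<in> ?S"
    then have p: "p permutes ?A" by simp
    have pi: "inv p \<circ> p = id" "p \<circ> inv p = id" using permutes_inv_o[OF p] by auto
    let ?t = "p \<circ> ?s \<circ> inv p"
    have t: "?t permutes ?A" using p s(1) by (intro permutes_compose permutes_inv)
    have ptp: "p \<circ> ?s = ?t \<circ> p" using pi by (simp add: o_assoc[symmetric])
    have "orbit_type (p ` ?A) ?t = orbit_type ?A ?s"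
    proof (rule orbit_type_conjugate)
      show "inj_on p ?A" using p by (rule permutes_inj_on)
      show "?s ` ?A \<subseteq> ?A" using permutes_image[OF s(1)] by simp
      show "\<forall>a\<in>?A. ?t (p a) = p (?s a)" using ptp by (metis o_apply)
    qed
    then have "?t \<in> ?K" using t s(2) permutes_image[OF p] by (simp add: cycle_type_eq_orbit_type)
    moreover have "\<sigma> = ?t" if "p \<circ> ?s = \<sigma> \<circ> p" for \<sigma>
      unfolding that using pi by (simp add: o_assoc[symmetric])
    ultimately have "{\<sigma> \<in> ?K. p \<circ> ?s = \<sigma> \<circ> p} = {?t}" using ptp by blast
    then show "card {\<sigma> \<in> ?K. p \<circ> ?s = \<sigma> \<circ> p} = 1" by simp
  qed
  also have "\<dots> = fact n" using card_permutations[of ?A n] by simp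
  finally show ?thesis .
qed

text \<open>Grouping permutations by cycle type, each class has relative size one over the order of
  the centralizer.\<close>

lemma sum_partitions_eq_sum_permutes:
  fixes G :: "nat multiset \<Rightarrow> ('v, complex) mpowser"
  shows "(\<Sum>\<mu>\<in>partitions n. mconst (inverse (of_nat (centralizer_size n \<mu>))) * G \<mu>)
    = mconst (inverse (fact n)) * (\<Sum>\<sigma> | \<sigma> permutes {1..n}. G (cycle_type n \<sigma>))"
proof -
  let ?S = "{\<sigma>. \<sigma> permutes {1..n}}"
  have finS: "finite ?S" by (rule finite_permutations) simp
  have "(\<Sum>\<sigma>\<in>?S. G (cycle_type n \<sigma>)) = (\<Sum>\<mu>\<in>partitions n. \<Sum>\<sigma> | \<sigma> \<in> ?S \<and> cycle_type n \<sigma> = \<mu>. G (cycle_type n \<sigma>))"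
    unfolding partitions_eq_cycle_types using finS by (intro sum.image_gen)
  also have "\<dots> = (\<Sum>\<mu>\<in>partitions n. of_nat (card {\<sigma>. \<sigma> permutes {1..n} \<and> cycle_type n \<sigma> = \<mu>}) * G \<mu>)"
    by (intro sum.cong refl) simp
  finally have "mconst (inverse (fact n)) * (\<Sum>\<sigma>\<in>?S. G (cycle_type n \<sigma>))
      = (\<Sum>\<mu>\<in>partitions n. mconst (inverse (fact n) * of_nat (card {\<sigma>. \<sigma> permutes {1..n} \<and> cycle_type n \<sigma> = \<mu>})) * G \<mu>)"
    by (simp add: sum_distrib_left mconst_mult mconst_of_nat mult.assoc)
  also have "\<dots> = (\<Sum>\<mu>\<in>partitions n. mconst (inverse (of_nat (centralizer_size n \<mu>))) * G \<mu>)"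
  proof (rule sum.cong[OF refl])
    fix \<mu> assume "\<mu> \<in> partitions n"
    from card_class_times_centralizer_size[OF this]
    have eq: "of_nat (card {\<sigma>. \<sigma> permutes {1..n} \<and> cycle_type n \<sigma> = \<mu>}) * of_nat (centralizer_size n \<mu>) = (fact n :: complex)"
      (is "?c * ?z = _")
      by (metis of_nat_mult of_nat_fact)
    have "?c * ?z \<noteq> 0" unfolding eq by simp
    then have "?c \<noteq> 0" "?z \<noteq> 0" by auto
    then have "inverse (fact n) * ?c = inverse ?z"
      unfolding eq[symmetric] by (simp add: field_simps)
    then show "mconst (inverse (fact n) * of_nat (card {\<sigma>. \<sigma> permutes {1..n} \<and> cycle_type n \<sigma> = \<mu>})) * G \<mu>
        = mconst (inverse (of_nat (centralizer_size n \<mu>))) * G \<mu>" by simp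
  qed
  finally show ?thesis ..
qed

section \<open>The product Frobenius characteristic as an average over permutations\<close>

lemma power_sum_part_add: "power_sum_part x (\<mu> + \<nu>) = power_sum_part x \<mu> * power_sum_part x \<nu>"
  by (simp add: power_sum_part_def)

lemma power_sum_part_orbit_type:
  "power_sum_part x (orbit_type A \<sigma>) = (\<Prod>B\<in>orbit \<sigma> ` A. power_sum x (card B))"
  by (simp add: power_sum_part_def orbit_type_def prod_unfold_prod_mset multiset.map_comp comp_def)

lemma sum_permutes_power_sum_part:
  assumes "inj x" "finite A"
  shows "(\<Sum>\<sigma> | \<sigma> permutes A. power_sum_part x (orbit_type A \<sigma>))
    = of_nat (fact (card A)) * complete_hom x (card A)"
  unfolding power_sum_part_orbit_type by (rule sum_permutes_prod_power_sum[OF assms])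

text \<open>Being a class function lets the value at the chosen representative be replaced by the
  value at every permutation of that type.\<close>

lemma product_frobenius_eq_average:
  assumes class_function: "\<And>\<sigma> \<tau> \<sigma>' \<tau>'. \<sigma> permutes {1..m} \<Longrightarrow> \<sigma>' permutes {1..m} \<Longrightarrow>
      \<tau> permutes {1..n} \<Longrightarrow> \<tau>' permutes {1..n} \<Longrightarrow>
      cycle_type m \<sigma> = cycle_type m \<sigma>' \<Longrightarrow> cycle_type n \<tau> = cycle_type n \<tau>' \<Longrightarrow> \<chi> \<sigma> \<tau> = \<chi> \<sigma>' \<tau>'"
  shows "product_frobenius m n \<chi> = mconst (inverse (fact m)) * mconst (inverse (fact n)) *
    (\<Sum>\<sigma> | \<sigma> permutes {1..m}. \<Sum>\<tau> | \<tau> permutes {1..n}.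
      mconst (\<chi> \<sigma> \<tau>) * power_sum_part Inl (cycle_type m \<sigma>) * power_sum_part Inr (cycle_type n \<tau>))"
proof -
  let ?c = "\<lambda>\<mu> \<nu>. mconst (\<chi> (perm_of_type m \<mu>) (perm_of_type n \<nu>)) * power_sum_part Inl \<mu> * power_sum_part Inr \<nu>"
  let ?z = "\<lambda>n \<mu>. mconst (inverse (of_nat (centralizer_size n \<mu>)) :: complex)"
  have "product_frobenius m n \<chi> = (\<Sum>\<mu>\<in>partitions m. ?z m \<mu> * (\<Sum>\<nu>\<in>partitions n. ?z n \<nu> * ?c \<mu> \<nu>))"
    unfolding product_frobenius_def by (simp add: mconst_mult sum_distrib_left mult.assoc)
  also have "\<dots> = mconst (inverse (fact m)) * (\<Sum>\<sigma> | \<sigma> permutes {1..m}.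
      mconst (inverse (fact n)) * (\<Sum>\<tau> | \<tau> permutes {1..n}. ?c (cycle_type m \<sigma>) (cycle_type n \<tau>)))"
    unfolding sum_partitions_eq_sum_permutes ..
  also have "\<dots> = mconst (inverse (fact m)) * mconst (inverse (fact n)) *
      (\<Sum>\<sigma> | \<sigma> permutes {1..m}. \<Sum>\<tau> | \<tau> permutes {1..n}. ?c (cycle_type m \<sigma>) (cycle_type n \<tau>))"
    by (simp add: sum_distrib_left mult.assoc)
  also have "(\<Sum>\<sigma> | \<sigma> permutes {1..m}. \<Sum>\<tau> | \<tau> permutes {1..n}. ?c (cycle_type m \<sigma>) (cycle_type n \<tau>))
      = (\<Sum>\<sigma> | \<sigma> permutes {1..m}. \<Sum>\<tau> | \<tau> permutes {1..n}.
          mconst (\<chi> \<sigma> \<tau>) * power_sum_part Inl (cycle_type m \<sigma>) * power_sum_part Inr (cycle_type n \<tau>))"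
  proof (intro sum.cong refl)
    fix \<sigma> \<tau> assume "\<sigma> \<in> {\<sigma>. \<sigma> permutes {1..m}}" "\<tau> \<in> {\<tau>. \<tau> permutes {1..n}}"
    then have p: "\<sigma> permutes {1..m}" "\<tau> permutes {1..n}"
      "cycle_type m \<sigma> \<in> partitions m" "cycle_type n \<tau> \<in> partitions n"
      unfolding partitions_eq_cycle_types by auto
    have "\<chi> (perm_of_type m (cycle_type m \<sigma>)) (perm_of_type n (cycle_type n \<tau>)) = \<chi> \<sigma> \<tau>"
      by (rule class_function) (simp_all only: p perm_of_type[OF p(3)] perm_of_type[OF p(4)])
    then show "?c (cycle_type m \<sigma>) (cycle_type n \<tau>)
        = mconst (\<chi> \<sigma> \<tau>) * power_sum_part Inl (cycle_type m \<sigma>) * power_sum_part Inr (cycle_type n \<tau>)"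
      by simp
  qed
  finally show ?thesis .
qed

lemma fixed_moebius_class_function:
  assumes perm: "\<sigma> permutes {1..n}" "\<sigma>' permutes {1..n}" "\<tau> permutes {1..n}" "\<tau>' permutes {1..n}"
    and type: "cycle_type n \<sigma> = cycle_type n \<sigma>'" "cycle_type n \<tau> = cycle_type n \<tau>'"
  shows "fixed_moebius \<sigma> \<tau> {1..n} {1..n} = fixed_moebius \<sigma>' \<tau>' {1..n} {1..n}"
proof -
  obtain p q where p: "p permutes {1..n}" "p \<circ> \<sigma> = \<sigma>' \<circ> p" and q: "q permutes {1..n}" "q \<circ> \<tau> = \<tau>' \<circ> q"
    using conjugate_if_orbit_type_eq[of "{1..n}" \<sigma> \<sigma>'] conjugate_if_orbit_type_eq[of "{1..n}" \<tau> \<tau>'] perm type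
    unfolding cycle_type_eq_orbit_type by blast
  have "fixed_moebius \<sigma>' \<tau>' (p ` {1..n}) (q ` {1..n}) = fixed_moebius \<sigma> \<tau> {1..n} {1..n}"
  proof (rule fixed_moebius_conjugate)
    show "\<forall>x\<in>{1..n}. \<sigma>' (p x) = p (\<sigma> x)" "\<forall>x\<in>{1..n}. \<tau>' (q x) = q (\<tau> x)"
      using p(2) q(2) by (metis o_apply)+
  qed (use perm p q in \<open>simp_all add: permutes_image permutes_inj_on\<close>)
  then show ?thesis using p q by (simp add: permutes_image)
qed

section \<open>Sums over stabilizers of pairs of subsets\<close>

definition moebius_sum :: "nat set \<Rightarrow> nat set \<Rightarrow> (nat + nat, complex) mpowser"
  where "moebius_sum S T = (\<Sum>\<alpha> | \<alpha> permutes S. \<Sum>\<beta> | \<beta> permutes T.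
    mconst (fixed_moebius \<alpha> \<beta> S T) * power_sum_part Inl (orbit_type S \<alpha>) * power_sum_part Inr (orbit_type T \<beta>))"

text \<open>Conjugation by p and q carries the permutations of S and T to those of S' and T' and
  changes neither the Moebius value nor the orbit types.\<close>

lemma moebius_sum_bij:
  assumes p: "bij_betw p S S'" and q: "bij_betw q T T'"
  shows "moebius_sum S T = moebius_sum S' T'"
proof -
  let ?p = "\<lambda>\<alpha> x. if x \<in> S' then p (\<alpha> (inv_into S p x)) else x"
  let ?q = "\<lambda>\<beta> x. if x \<in> T' then q (\<beta> (inv_into T q x)) else x"
  have im: "p ` S = S'" "q ` T = T'" and inj: "inj_on p S" "inj_on q T"
    using p q by (auto simp: bij_betw_def)
  have "moebius_sum S' T' = (\<Sum>\<alpha> | \<alpha> permutes S. \<Sum>\<beta> | \<beta> permutes T.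
      mconst (fixed_moebius (?p \<alpha>) (?q \<beta>) S' T') * power_sum_part Inl (orbit_type S' (?p \<alpha>))
        * power_sum_part Inr (orbit_type T' (?q \<beta>)))"
    unfolding moebius_sum_def
    by (subst sum.reindex_bij_betw[OF bij_betw_permutations[OF p], symmetric],
        subst sum.reindex_bij_betw[OF bij_betw_permutations[OF q], symmetric]) (rule refl)
  also have "\<dots> = moebius_sum S T"
    unfolding moebius_sum_def
  proof (intro sum.cong refl)
    fix \<alpha> \<beta> assume "\<alpha> \<in> {\<alpha>. \<alpha> permutes S}" "\<beta> \<in> {\<beta>. \<beta> permutes T}"
    then have \<alpha>: "\<alpha> ` S \<subseteq> S" and \<beta>: "\<beta> ` T \<subseteq> T" by (auto simp: permutes_image)
    have cp: "\<forall>a\<in>S. ?p \<alpha> (p a) = p (\<alpha> a)" using inj im by auto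
    have cq: "\<forall>a\<in>T. ?q \<beta> (q a) = q (\<beta> a)" using inj im by auto
    show "mconst (fixed_moebius (?p \<alpha>) (?q \<beta>) S' T') * power_sum_part Inl (orbit_type S' (?p \<alpha>))
        * power_sum_part Inr (orbit_type T' (?q \<beta>))
      = mconst (fixed_moebius \<alpha> \<beta> S T) * power_sum_part Inl (orbit_type S \<alpha>) * power_sum_part Inr (orbit_type T \<beta>)"
      using fixed_moebius_conjugate[OF inj(1) \<alpha> cp inj(2) \<beta> cq] orbit_type_conjugate[OF inj(1) \<alpha> cp]
        orbit_type_conjugate[OF inj(2) \<beta> cq] unfolding im by simp
  qed
  finally show ?thesis ..
qed

lemma moebius_sum_eq_product_frobenius:
  assumes "finite S" "finite T" "card S = i" "card T = i"
  shows "moebius_sum S T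
    = (-1) ^ i * of_nat (fact i) * of_nat (fact i) * product_frobenius i i (top_homology_character i)"
proof -
  obtain p q where p: "bij_betw p S {1..i}" and q: "bij_betw q T {1..i}"
    using assms by (metis finite_same_card_bij card_atLeastAtMost finite_atLeastAtMost diff_Suc_1)
  have sgn: "mconst ((-1) ^ i :: complex) = (-1) ^ i"
    by (simp add: mconst_power mconst_uminus)
  have inv: "of_nat (fact i) * mconst (inverse (fact i) :: complex) = 1"
  proof -
    have "of_nat (fact i) * mconst (inverse (fact i) :: complex) = mconst (of_nat (fact i) * inverse (fact i))"
      by (simp only: mconst_mult mconst_of_nat)
    then show ?thesis by simp
  qed
  have "product_frobenius i i (top_homology_character i)
      = mconst (inverse (fact i)) * mconst (inverse (fact i)) *
        (\<Sum>\<sigma> | \<sigma> permutes {1..i}. \<Sum>\<tau> | \<tau> permutes {1..i}.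
          mconst (top_homology_character i \<sigma> \<tau>) * power_sum_part Inl (cycle_type i \<sigma>)
            * power_sum_part Inr (cycle_type i \<tau>))"
  proof (rule product_frobenius_eq_average)
    fix \<sigma> \<tau> \<sigma>' \<tau>'
    assume *: "\<sigma> permutes {1..i}" "\<sigma>' permutes {1..i}" "\<tau> permutes {1..i}" "\<tau>' permutes {1..i}"
      "cycle_type i \<sigma> = cycle_type i \<sigma>'" "cycle_type i \<tau> = cycle_type i \<tau>'"
    show "top_homology_character i \<sigma> \<tau> = top_homology_character i \<sigma>' \<tau>'"
      unfolding top_homology_character_eq_moebius[OF *(1,3)] top_homology_character_eq_moebius[OF *(2,4)]
        fixed_moebius_class_function[OF *] ..
  qed
  also have "(\<Sum>\<sigma> | \<sigma> permutes {1..i}. \<Sum>\<tau> | \<tau> permutes {1..i}.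
          mconst (top_homology_character i \<sigma> \<tau>) * power_sum_part Inl (cycle_type i \<sigma>)
            * power_sum_part Inr (cycle_type i \<tau>)) = (-1) ^ i * moebius_sum {1..i} {1..i}"
    unfolding moebius_sum_def sum_distrib_left
  proof (intro sum.cong refl)
    fix \<sigma> \<tau> assume "\<sigma> \<in> {\<sigma>. \<sigma> permutes {1..i}}" "\<tau> \<in> {\<tau>. \<tau> permutes {1..i}}"
    then have "top_homology_character i \<sigma> \<tau> = (-1) ^ i * fixed_moebius \<sigma> \<tau> {1..i} {1..i}"
      by (intro top_homology_character_eq_moebius) simp_all
    then show "mconst (top_homology_character i \<sigma> \<tau>) * power_sum_part Inl (cycle_type i \<sigma>)
          * power_sum_part Inr (cycle_type i \<tau>)
        = (-1) ^ i * (mconst (fixed_moebius \<sigma> \<tau> {1..i} {1..i}) * power_sum_part Inl (orbit_type {1..i} \<sigma>)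
          * power_sum_part Inr (orbit_type {1..i} \<tau>))"
      by (simp only: mconst_mult sgn cycle_type_eq_orbit_type mult.assoc)
  qed
  finally have frob: "product_frobenius i i (top_homology_character i)
      = mconst (inverse (fact i)) * mconst (inverse (fact i)) * ((-1) ^ i * moebius_sum {1..i} {1..i})" .
  \<comment> \<open>The two factorials cancel the averaging denominators, and the sign from the
    trace formula cancels against itself.\<close>
  have "(-1) ^ i * of_nat (fact i) * of_nat (fact i) * product_frobenius i i (top_homology_character i)
      = (of_nat (fact i) * mconst (inverse (fact i))) * (of_nat (fact i) * mconst (inverse (fact i)))
        * ((-1) ^ i * ((-1) ^ i * moebius_sum {1..i} {1..i}))"
    unfolding frob by (simp only: ac_simps)
  also have "\<dots> = moebius_sum {1..i} {1..i}"
    unfolding inv by simp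
  finally show ?thesis using moebius_sum_bij[OF p q] by simp
qed

text \<open>The set stabilizer of S is a Young subgroup: a permutation preserving S also preserves
  its complement, and its two restrictions, extended by the identity, compose to it.\<close>

lemma bij_betw_permutes_stabilizer:
  assumes S: "S \<subseteq> A"
  shows "bij_betw (\<lambda>(\<alpha>, \<gamma>). \<alpha> \<circ> \<gamma>) ({\<alpha>. \<alpha> permutes S} \<times> {\<gamma>. \<gamma> permutes (A - S)})
    {\<sigma>. \<sigma> permutes A \<and> \<sigma> ` S = S}"
proof (rule bij_betw_byWitness[where f' = "\<lambda>\<sigma>. (restrict_id \<sigma> S, restrict_id \<sigma> (A - S))"])
  have comp: "(\<alpha> \<circ> \<gamma>) a = (if a \<in> S then \<alpha> a else \<gamma> a)" if "\<alpha> permutes S" "\<gamma> permutes (A - S)" for \<alpha> \<gamma> a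
  proof (cases "a \<in> S")
    case True
    then have "\<gamma> a = a" using that(2) by (simp add: permutes_not_in)
    then show ?thesis using True by simp
  next
    case False
    have "\<gamma> a \<notin> S"
    proof (cases "a \<in> A - S")
      case True
      then have "\<gamma> a \<in> A - S" using permutes_in_image[OF that(2)] by blast
      then show ?thesis by simp
    next
      case a: False
      then have "\<gamma> a = a" using that(2) by (simp add: permutes_not_in)
      then show ?thesis using False by simp
    qed
    then show ?thesis using False that(1) by (simp add: permutes_not_in)
  qed
  show "\<forall>x\<in>{\<alpha>. \<alpha> permutes S} \<times> {\<gamma>. \<gamma> permutes (A - S)}.
      (restrict_id (case x of (\<alpha>, \<gamma>) \<Rightarrow> \<alpha> \<circ> \<gamma>) S, restrict_id (case x of (\<alpha>, \<gamma>) \<Rightarrow> \<alpha> \<circ> \<gamma>) (A - S)) = x"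
  proof clarify
    fix \<alpha> \<gamma> assume *: "\<alpha> permutes S" "\<gamma> permutes (A - S)"
    have "restrict_id (\<alpha> \<circ> \<gamma>) S = \<alpha>"
    proof
      fix a show "restrict_id (\<alpha> \<circ> \<gamma>) S a = \<alpha> a"
        unfolding restrict_id_def comp[OF *] using * by (simp add: permutes_not_in)
    qed
    moreover have "restrict_id (\<alpha> \<circ> \<gamma>) (A - S) = \<gamma>"
    proof
      fix a show "restrict_id (\<alpha> \<circ> \<gamma>) (A - S) a = \<gamma> a"
        unfolding restrict_id_def comp[OF *] using *(2) by (auto simp: permutes_not_in)
    qed
    ultimately show "restrict_id (\<alpha> \<circ> \<gamma>) S = \<alpha> \<and> restrict_id (\<alpha> \<circ> \<gamma>) (A - S) = \<gamma>" by blast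
  qed
  have restr: "restrict_id \<sigma> S permutes S" "restrict_id \<sigma> (A - S) permutes (A - S)"
    if "\<sigma> permutes A" "\<sigma> ` S = S" for \<sigma>
  proof -
    have inj: "inj \<sigma>" using that(1) by (rule permutes_inj)
    have "\<sigma> ` (A - S) = A - S"
      using that permutes_image[OF that(1)] by (simp add: image_set_diff[OF inj])
    then have "bij_betw \<sigma> S S" "bij_betw \<sigma> (A - S) (A - S)"
      using that(2) inj_on_subset[OF inj subset_UNIV] unfolding bij_betw_def by blast+
    then show "restrict_id \<sigma> S permutes S" "restrict_id \<sigma> (A - S) permutes (A - S)"
      by (auto intro: permutes_restrict_id)
  qed
  show "\<forall>\<sigma>\<in>{\<sigma>. \<sigma> permutes A \<and> \<sigma> ` S = S}.
      (case (restrict_id \<sigma> S, restrict_id \<sigma> (A - S)) of (\<alpha>, \<gamma>) \<Rightarrow> \<alpha> \<circ> \<gamma>) = \<sigma>"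
  proof clarify
    fix \<sigma> assume \<sigma>: "\<sigma> permutes A" "\<sigma> ` S = S"
    have "(restrict_id \<sigma> S \<circ> restrict_id \<sigma> (A - S)) a = \<sigma> a" for a
      unfolding comp[OF restr[OF \<sigma>]] using \<sigma>(1) S by (auto simp: restrict_id_def permutes_not_in)
    then show "restrict_id \<sigma> S \<circ> restrict_id \<sigma> (A - S) = \<sigma>" by blast
  qed
  show "(\<lambda>(\<alpha>, \<gamma>). \<alpha> \<circ> \<gamma>) ` ({\<alpha>. \<alpha> permutes S} \<times> {\<gamma>. \<gamma> permutes (A - S)}) \<subseteq> {\<sigma>. \<sigma> permutes A \<and> \<sigma> ` S = S}"
  proof clarify
    fix \<alpha> \<gamma> assume *: "\<alpha> permutes S" "\<gamma> permutes (A - S)"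
    have "\<alpha> \<circ> \<gamma> permutes A"
      using * S by (intro permutes_compose) (auto intro: permutes_subset)
    moreover have "(\<alpha> \<circ> \<gamma>) ` S = \<alpha> ` S" by (intro image_cong refl) (simp add: comp[OF *, unfolded o_apply])
    ultimately show "\<alpha> \<circ> \<gamma> permutes A \<and> (\<alpha> \<circ> \<gamma>) ` S = S" using permutes_image[OF *(1)] by simp
  qed
  show "(\<lambda>\<sigma>. (restrict_id \<sigma> S, restrict_id \<sigma> (A - S))) ` {\<sigma>. \<sigma> permutes A \<and> \<sigma> ` S = S}
      \<subseteq> {\<alpha>. \<alpha> permutes S} \<times> {\<gamma>. \<gamma> permutes (A - S)}"
    using restr by auto
qed


lemma orbit_type_stabilizer:
  assumes "finite A" "S \<subseteq> A" "\<alpha> permutes S" "\<gamma> permutes (A - S)"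
  shows "orbit_type A (\<alpha> \<circ> \<gamma>) = orbit_type S \<alpha> + orbit_type (A - S) \<gamma>"
    "\<forall>a\<in>S. (\<alpha> \<circ> \<gamma>) a = \<alpha> a"
proof -
  have fin: "finite S" "finite (A - S)" using assms finite_subset by auto
  show S: "\<forall>a\<in>S. (\<alpha> \<circ> \<gamma>) a = \<alpha> a" using assms(4) by (simp add: permutes_not_in)
  have A: "\<forall>a\<in>A - S. (\<alpha> \<circ> \<gamma>) a = \<gamma> a"
  proof
    fix a assume "a \<in> A - S"
    then have "\<gamma> a \<in> A - S" using permutes_in_image[OF assms(4)] by blast
    then show "(\<alpha> \<circ> \<gamma>) a = \<gamma> a" using assms(3) by (simp add: permutes_not_in)
  qed
  have im: "\<alpha> ` S \<subseteq> S" "\<gamma> ` (A - S) \<subseteq> A - S" using permutes_image assms(3,4) by blast+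
  have "orbit_type (S \<union> (A - S)) (\<alpha> \<circ> \<gamma>) = orbit_type S (\<alpha> \<circ> \<gamma>) + orbit_type (A - S) (\<alpha> \<circ> \<gamma>)"
    using fin S A im by (intro orbit_type_Un) (auto simp: image_subset_iff)
  moreover have "S \<union> (A - S) = A" using assms(2) by blast
  ultimately show "orbit_type A (\<alpha> \<circ> \<gamma>) = orbit_type S \<alpha> + orbit_type (A - S) \<gamma>"
    using orbit_type_cong[OF im(1) S] orbit_type_cong[OF im(2) A] by simp
qed

text \<open>The Moebius value sees only the restrictions to S and T, and the power sums factor over
  a subset and its complement. The sum splits accordingly, and over the complements it produces
  complete homogeneous functions.\<close>

lemma sum_stabilizer_moebius:
  assumes fin: "finite A" and S: "S \<subseteq> A" and T: "T \<subseteq> A"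
  shows "(\<Sum>\<sigma> | \<sigma> permutes A \<and> \<sigma> ` S = S. \<Sum>\<tau> | \<tau> permutes A \<and> \<tau> ` T = T.
      mconst (fixed_moebius \<sigma> \<tau> S T) * power_sum_part Inl (orbit_type A \<sigma>) * power_sum_part Inr (orbit_type A \<tau>))
    = moebius_sum S T * (of_nat (fact (card (A - S))) * complete_hom Inl (card (A - S)))
      * (of_nat (fact (card (A - T))) * complete_hom Inr (card (A - T)))"
proof -
  let ?P = "\<lambda>S. {\<alpha>. \<alpha> permutes S}"
  let ?x = "\<lambda>S \<alpha>. power_sum_part Inl (orbit_type S \<alpha>) :: (nat + nat, complex) mpowser"
  let ?y = "\<lambda>S \<alpha>. power_sum_part Inr (orbit_type S \<alpha>) :: (nat + nat, complex) mpowser"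
  have split: "sum F {\<sigma>. \<sigma> permutes A \<and> \<sigma> ` S = S} = (\<Sum>\<alpha>\<in>?P S. \<Sum>\<gamma>\<in>?P (A - S). F (\<alpha> \<circ> \<gamma>))"
    if "S \<subseteq> A" for S and F :: "(nat \<Rightarrow> nat) \<Rightarrow> (nat + nat, complex) mpowser"
    unfolding sum.reindex_bij_betw[OF bij_betw_permutes_stabilizer[OF that], symmetric] sum.cartesian_product
    by (simp add: case_prod_beta)
  have "(\<Sum>\<sigma> | \<sigma> permutes A \<and> \<sigma> ` S = S. \<Sum>\<tau> | \<tau> permutes A \<and> \<tau> ` T = T.
      mconst (fixed_moebius \<sigma> \<tau> S T) * ?x A \<sigma> * ?y A \<tau>)
    = (\<Sum>\<alpha>\<in>?P S. \<Sum>\<gamma>\<in>?P (A - S). \<Sum>\<beta>\<in>?P T. \<Sum>\<delta>\<in>?P (A - T).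
        mconst (fixed_moebius (\<alpha> \<circ> \<gamma>) (\<beta> \<circ> \<delta>) S T) * ?x A (\<alpha> \<circ> \<gamma>) * ?y A (\<beta> \<circ> \<delta>))"
    unfolding split[OF S] split[OF T] ..
  also have "\<dots> = (\<Sum>\<alpha>\<in>?P S. \<Sum>\<gamma>\<in>?P (A - S). \<Sum>\<beta>\<in>?P T. \<Sum>\<delta>\<in>?P (A - T).
        mconst (fixed_moebius \<alpha> \<beta> S T) * ?x S \<alpha> * ?y T \<beta> * (?x (A - S) \<gamma> * ?y (A - T) \<delta>))"
  proof (intro sum.cong refl)
    fix \<alpha> \<gamma> \<beta> \<delta>
    assume "\<alpha> \<in> ?P S" "\<gamma> \<in> ?P (A - S)" "\<beta> \<in> ?P T" "\<delta> \<in> ?P (A - T)"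
    then have *: "\<alpha> permutes S" "\<gamma> permutes (A - S)" "\<beta> permutes T" "\<delta> permutes (A - T)" by simp_all
    note o1 = orbit_type_stabilizer[OF fin S *(1,2)] and o2 = orbit_type_stabilizer[OF fin T *(3,4)]
    \<comment> \<open>Conjugation with identity relabellings replaces the full permutations by their
      restrictions to S and T.\<close>
    have "fixed_moebius (\<alpha> \<circ> \<gamma>) (\<beta> \<circ> \<delta>) (id ` S) (id ` T) = fixed_moebius \<alpha> \<beta> S T"
      using o1(2) o2(2) permutes_image[OF *(1)] permutes_image[OF *(3)]
      by (intro fixed_moebius_conjugate) simp_all
    then show "mconst (fixed_moebius (\<alpha> \<circ> \<gamma>) (\<beta> \<circ> \<delta>) S T) * ?x A (\<alpha> \<circ> \<gamma>) * ?y A (\<beta> \<circ> \<delta>)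
      = mconst (fixed_moebius \<alpha> \<beta> S T) * ?x S \<alpha> * ?y T \<beta> * (?x (A - S) \<gamma> * ?y (A - T) \<delta>)"
      unfolding o1(1) o2(1) power_sum_part_add by (simp add: ac_simps)
  qed
  also have "\<dots> = (\<Sum>\<alpha>\<in>?P S. \<Sum>\<beta>\<in>?P T. \<Sum>\<gamma>\<in>?P (A - S). \<Sum>\<delta>\<in>?P (A - T).
        mconst (fixed_moebius \<alpha> \<beta> S T) * ?x S \<alpha> * ?y T \<beta> * (?x (A - S) \<gamma> * ?y (A - T) \<delta>))"
    by (intro sum.cong refl sum.swap)
  also have "\<dots> = moebius_sum S T * ((\<Sum>\<gamma>\<in>?P (A - S). ?x (A - S) \<gamma>) * (\<Sum>\<delta>\<in>?P (A - T). ?y (A - T) \<delta>))"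
  proof -
    have inner: "(\<Sum>\<gamma>\<in>?P (A - S). \<Sum>\<delta>\<in>?P (A - T). k * (?x (A - S) \<gamma> * ?y (A - T) \<delta>))
        = k * ((\<Sum>\<gamma>\<in>?P (A - S). ?x (A - S) \<gamma>) * (\<Sum>\<delta>\<in>?P (A - T). ?y (A - T) \<delta>))" for k
      unfolding sum_product unfolding sum_distrib_left ..
    have outer: "moebius_sum S T * r = (\<Sum>\<alpha>\<in>?P S. \<Sum>\<beta>\<in>?P T.
        mconst (fixed_moebius \<alpha> \<beta> S T) * ?x S \<alpha> * ?y T \<beta> * r)" for r
      by (simp only: moebius_sum_def sum_distrib_right)
    show ?thesis unfolding inner outer ..
  qed
  also have "(\<Sum>\<gamma>\<in>?P (A - S). ?x (A - S) \<gamma>) = of_nat (fact (card (A - S))) * complete_hom Inl (card (A - S))"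
    using fin by (intro sum_permutes_power_sum_part) auto
  also have "(\<Sum>\<delta>\<in>?P (A - T). ?y (A - T) \<delta>) = of_nat (fact (card (A - T))) * complete_hom Inr (card (A - T))"
    using fin by (intro sum_permutes_power_sum_part) auto
  finally show ?thesis by (simp only: mult.assoc)
qed

lemma card_pairs_of_subsets:
  "card {(S, T). S \<subseteq> {1..n :: nat} \<and> T \<subseteq> {1..n} \<and> card S = i \<and> card T = i} = (n choose i) * (n choose i)"
proof -
  have "{(S, T). S \<subseteq> {1..n} \<and> T \<subseteq> {1..n} \<and> card S = i \<and> card T = i}
      = {S. S \<subseteq> {1..n} \<and> card S = i} \<times> {T. T \<subseteq> {1..n} \<and> card T = i}" by auto
  then show ?thesis using n_subsets[of "{1..n}" i] by (simp add: card_cartesian_product)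
qed

theorem theorem3p1:
  fixes n :: nat
  assumes "n \<ge> 1"
  shows "(\<Sum>i=0..n. (-1) ^ i * complete_hom Inl (n - i) * complete_hom Inr (n - i)
            * product_frobenius i i (top_homology_character i)) = 0"
proof -
  let ?A = "{1..n}" and ?P = "{\<sigma>. \<sigma> permutes {1..n}}"
  define E where "E = {(S, T). S \<subseteq> ?A \<and> T \<subseteq> ?A \<and> card S = card T}"
  define summand where "summand i = ((-1) ^ i * complete_hom Inl (n - i) * complete_hom Inr (n - i)
    * product_frobenius i i (top_homology_character i) :: (nat + nat, complex) mpowser)" for i
  have finP: "finite ?P" by (rule finite_permutations) simp
  have finE: "finite E" by (rule finite_subset[of _ "Pow ?A \<times> Pow ?A"]) (auto simp: E_def)
  let ?f = "\<lambda>(\<sigma>, \<tau>) (S, T). mconst (fixed_moebius \<sigma> \<tau> S T) * power_sum_part Inl (orbit_type ?A \<sigma>)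
    * power_sum_part Inr (orbit_type ?A \<tau>) :: (nat + nat, complex) mpowser"
  let ?R = "\<lambda>(\<sigma>, \<tau>) (S, T). \<sigma> ` S = S \<and> \<tau> ` T = T"
  have fixed: "(\<Sum>p\<in>{p \<in> E. ?R g p}. ?f g p) = 0" if gP: "g \<in> ?P \<times> ?P" for g
  proof -
    obtain \<sigma> \<tau> where g: "g = (\<sigma>, \<tau>)" "\<sigma> permutes ?A" "\<tau> permutes ?A" using gP by auto
    have eq: "{p \<in> E. ?R g p} = fixed_pairs \<sigma> \<tau> ?A ?A"
      unfolding E_def fixed_pairs_def g by auto
    have "(\<Sum>p\<in>{p \<in> E. ?R g p}. ?f g p)
        = mconst (\<Sum>(S, T)\<in>fixed_pairs \<sigma> \<tau> ?A ?A. fixed_moebius \<sigma> \<tau> S T) * power_sum_part Inl (orbit_type ?A \<sigma>)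
          * power_sum_part Inr (orbit_type ?A \<tau>)"
      unfolding eq by (simp add: g mconst_sum sum_distrib_right case_prod_beta)
    \<comment> \<open>Here n >= 1 enters: for n = 0 bottom and top coincide and the sum would be
      1.\<close>
    also have "(\<Sum>(S, T)\<in>fixed_pairs \<sigma> \<tau> ?A ?A. fixed_moebius \<sigma> \<tau> S T) = 0"
      using assms g permutes_image by (intro sum_fixed_moebius) auto
    also have "mconst 0 = (0 :: (nat + nat, complex) mpowser)"
      using mconst_of_nat[of 0] by simp
    finally show ?thesis by simp
  qed
  have orbit_sum: "(\<Sum>g\<in>{g \<in> ?P \<times> ?P. ?R g (S, T)}. ?f g (S, T))
      = of_nat (fact (card S) * fact (n - card S)) ^ 2 * summand (card S)" if ST: "(S, T) \<in> E" for S T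
  proof -
    have sub: "S \<subseteq> ?A" "T \<subseteq> ?A" "card S = card T" using ST by (auto simp: E_def)
    then have fin: "finite S" "finite T" by (auto intro: finite_subset)
    have cd: "card (?A - S) = n - card S" "card (?A - T) = n - card S"
      using sub fin by (simp_all add: card_Diff_subset)
    have eq: "{g \<in> ?P \<times> ?P. ?R g (S, T)}
        = {\<sigma>. \<sigma> permutes ?A \<and> \<sigma> ` S = S} \<times> {\<tau>. \<tau> permutes ?A \<and> \<tau> ` T = T}" by auto
    have "(\<Sum>g\<in>{g \<in> ?P \<times> ?P. ?R g (S, T)}. ?f g (S, T))
        = (\<Sum>\<sigma> | \<sigma> permutes ?A \<and> \<sigma> ` S = S. \<Sum>\<tau> | \<tau> permutes ?A \<and> \<tau> ` T = T. ?f (\<sigma>, \<tau>) (S, T))"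
      unfolding eq sum.cartesian_product by (intro sum.cong refl) (simp add: case_prod_beta)
    also have "\<dots> = moebius_sum S T * (of_nat (fact (n - card S)) * complete_hom Inl (n - card S))
        * (of_nat (fact (n - card S)) * complete_hom Inr (n - card S))"
      using sum_stabilizer_moebius[OF _ sub(1,2)] unfolding cd by simp
    also have "moebius_sum S T = (-1) ^ card S * of_nat (fact (card S)) * of_nat (fact (card S))
        * product_frobenius (card S) (card S) (top_homology_character (card S))"
      using fin sub(3) by (intro moebius_sum_eq_product_frobenius) auto
    finally show ?thesis
      unfolding summand_def by (simp only: of_nat_mult power2_eq_square ac_simps)
  qed
  have "0 = (\<Sum>g\<in>?P \<times> ?P. \<Sum>p\<in>{p \<in> E. ?R g p}. ?f g p)"
    using fixed by simp
  also have "\<dots> = (\<Sum>p\<in>E. \<Sum>g\<in>{g \<in> ?P \<times> ?P. ?R g p}. ?f g p)"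
    using finP finE by (intro sum.swap_restrict) auto
  also have "\<dots> = (\<Sum>p\<in>E. of_nat (fact (card (fst p)) * fact (n - card (fst p))) ^ 2 * summand (card (fst p)))"
  proof (rule sum.cong[OF refl])
    fix p assume "p \<in> E"
    then show "(\<Sum>g\<in>{g \<in> ?P \<times> ?P. ?R g p}. ?f g p)
        = of_nat (fact (card (fst p)) * fact (n - card (fst p))) ^ 2 * summand (card (fst p))"
      using orbit_sum[of "fst p" "snd p"] by simp
  qed
  also have "\<dots> = (\<Sum>i\<in>{0..n}. \<Sum>p\<in>{p \<in> E. card (fst p) = i}.
      of_nat (fact (card (fst p)) * fact (n - card (fst p))) ^ 2 * summand (card (fst p)))"
  proof (rule sum.group[symmetric])
    show "(\<lambda>p. card (fst p)) ` E \<subseteq> {0..n}"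
    proof clarsimp
      fix S T assume "(S, T) \<in> E"
      then have "S \<subseteq> ?A" by (simp add: E_def)
      then show "card S \<le> n" using card_mono[of ?A S] by simp
    qed
  qed (use finE in auto)
  also have "\<dots> = (\<Sum>i\<in>{0..n}. of_nat (fact n) ^ 2 * summand i)"
  proof (rule sum.cong[OF refl])
    fix i assume i: "i \<in> {0..n}"
    have eq: "{p \<in> E. card (fst p) = i} = {(S, T). S \<subseteq> ?A \<and> T \<subseteq> ?A \<and> card S = i \<and> card T = i}"
      by (auto simp: E_def)
    have "(\<Sum>p\<in>{p \<in> E. card (fst p) = i}. of_nat (fact (card (fst p)) * fact (n - card (fst p))) ^ 2 * summand (card (fst p)))
        = of_nat (card {p \<in> E. card (fst p) = i}) * (of_nat (fact i * fact (n - i)) ^ 2 * summand i)"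
      by simp
    \<comment> \<open>The number of pairs of rank i is the square of a binomial coefficient, so it
      merges with the squared factorials into a weight that does not depend on i.\<close>
    also have "\<dots> = of_nat (fact i * fact (n - i) * (n choose i)) ^ 2 * summand i"
      unfolding eq card_pairs_of_subsets by (simp only: of_nat_mult power2_eq_square ac_simps)
    also have "fact i * fact (n - i) * (n choose i) = fact n"
      using i by (intro binomial_fact_lemma) simp
    finally show "(\<Sum>p\<in>{p \<in> E. card (fst p) = i}.
        of_nat (fact (card (fst p)) * fact (n - card (fst p))) ^ 2 * summand (card (fst p)))
      = of_nat (fact n) ^ 2 * summand i" .
  qed
  also have "\<dots> = of_nat (fact n ^ 2) * (\<Sum>i\<in>{0..n}. summand i)"
    by (simp add: sum_distrib_left)
  finally have zero: "of_nat (fact n ^ 2) * (\<Sum>i\<in>{0..n}. summand i) = 0" ..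
  \<comment> \<open>The factor n! squared is cancelled coefficient by coefficient, in the complex
    numbers.\<close>
  have "(\<Sum>i\<in>{0..n}. summand i) = 0"
  proof (rule mpowser_eqI)
    fix m
    have "of_nat (fact n ^ 2) * mcoeff (\<Sum>i\<in>{0..n}. summand i) m = 0"
      unfolding mcoeff_of_nat_times[symmetric] zero by (simp add: zero_mpowser.rep_eq)
    then show "mcoeff (\<Sum>i\<in>{0..n}. summand i) m = mcoeff 0 m"
      by (simp add: zero_mpowser.rep_eq)
  qed
  then show ?thesis unfolding summand_def .
qed

end
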